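(* Let $G$ be a finite group, $S\subseteq G$ a symmetric subset and $\mathcal{G}=\mathrm{Cay}(G,S)$. Let $M\in\mathbb{N}$ and let $f_1,\dots,f_M\in\ell^2(G)$ be a collection of real-valued functions. Then, for any $t>0$, with probability at least $$1-2M\sum_{(\pi,V)\in\hat{G}\setminus\{\mathrm{triv}\}}(\dim V)^2\left(6e^{-\frac{t\sqrt{\dim V}}{64}}+2e^{-\frac{\dim V}{12}}\right),$$ if $\mathcal{B}$ is the random real orthonormal eigenbasis of $\mathcal{G}$ described in the context, then for any $\varphi\in\mathcal{B}$ and any $i=1,\dots,M$, $$\left|\mu_\varphi[f_i]-\frac{\sum_{g\in G}f_i(g)}{|G|}\right|\le t\,\frac{\|f_i\|_{\ell^2}}{\sqrt{|G|}}.$$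
   Context: Notation. $\hat{G}$ is the set of equivalence classes of irreducible unitary representations $(\pi,V)$ of $G$ (one fixed representative of each class), $\mathrm{triv}$ the trivial one. $\ell^2(G)$ is the space of complex functions on $G$ with inner product $\langle f_1,f_2\rangle=\sum_{g}f_1(g)\overline{f_2(g)}$ and norm $\|\cdot\|_{\ell^2}$. $S$ symmetric means $S=S^{-1}$. The adjacency operator of $\mathrm{Cay}(G,S)$ is $\mathcal{A}[f](g)=\sum_{s\in S}f(gs)$; put $A=\sum_{s\in S}s\in\mathbb{C}[G]$ and $\pi(A)=\sum_{s\in S}\pi(s)$, a Hermitian operator on $V$. For a unit vector $\varphi$, $\mu_\varphi[f]=\sum_{g\in G}f(g)|\varphi(g)|^2$. Types of representations. $(\check\pi,\check V)$ denotes the dual representation. An irreducible $(\pi,V)$ equivalent to its dual has a conjugate-linear map $J:V\to V$ commuting with all $\pi(g)$ and with $J^2=\pm\mathrm{Id}$; $\pi$ is called real if $J^2=\mathrm{Id}$ and quaternionic if $J^2=-\mathrm{Id}$. If $\pi$ is real, $V_J=\{v\in V:J(v)=v\}$ is a real vector space with $V=V_J\oplus iV_J$ on which the inner product restricts to a real inner product. Random real eigenbasis $\mathcal{B}$. It is the union of the following families, with all random operators below independent. (1) For each pair $\{(\pi,V),(\check\pi,\check V)\}$ of inequivalent dual irreducible representations, choose one member $(\pi,V)$; fix an orthonormal basis $\{v_k^V\}_{k=1}^{\dim V}$ of $V$ of eigenvectors of $\pi(A)$ and an orthonormal basis $\{e_j^V\}_{j=1}^{\dim V}$ of $V$; let $u$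 be a Haar random element of the unitary group $U(V)$, and $w_j^V=ue_j^V$. Include in $\mathcal{B}$ the functions $$x_{k,j}^V(g)=\frac{\sqrt{2\dim V}}{\sqrt{|G|}}\mathrm{Re}\langle\pi(g)v_k^V,w_j^V\rangle,\qquad y_{k,j}^V(g)=\frac{\sqrt{2\dim V}}{\sqrt{|G|}}\mathrm{Im}\langle\pi(g)v_k^V,w_j^V\rangle,\qquad 1\le j,k\le\dim V.$$ (2) For each real $(\pi,V)$, fix an orthonormal basis $\{v_k^V\}$ of $V_J$ of eigenvectors of $\pi(A)$ and an orthonormal basis $\{e_j^V\}$ of $V_J$; let $o$ be a Haar random element of the orthogonal group of $V_J$ (written $O(V)$), and $w_j^V=oe_j^V$. Include in $\mathcal{B}$ the functions $$\varphi_{kj}^V(g)=\frac{\sqrt{\dim V}}{\sqrt{|G|}}\langle\pi(g)v_k^V,w_j^V\rangle,\qquad 1\le j,k\le\dim V.$$ (3) For each quaternionic $(\pi,V)$ ($\dim V$ is then even), fix an orthonormal basis of $V$ of eigenvectors of $\pi(A)$ of the form $\{v_k^V,J(v_k^V)\}_{k=1}^{\frac12\dim V}$ and an orthonormal basis $\{e_j^V\}_{j=1}^{\dim V}$ of $V$; let $u$ be a Haar random element of $U(V)$, and $w_j^V=ue_j^V$. Include in $\mathcal{B}$ the functions $$x_{kj}^V(g)=\frac{\sqrt{2\dim V}}{\sqrt{|G|}}\mathrm{Re}\langle\pi(g)v_k^V,w_j^V\rangle,\qquad y_{kj}^V(g)=\frac{\sqrt{2\dim V}}{\sqrt{|G|}}\mathrm{Im}\langle\pi(g)v_k^V,w_j^V\rangle,\qquad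 1\le k\le\tfrac12\dim V,\ 1\le j\le\dim V.$$ Thus the probability measure is the product of the Haar probability measures on $U(V)$ (one for each non-self-dual pair and each quaternionic representation) and on $O(V)$ (one for each real representation). *)

theory Defs
  imports
    "HOL-Probability.Probability"
    "HOL-Algebra.Coset"
    "Jordan_Normal_Form.VS_Connect"
    "Jordan_Normal_Form.Schur_Decomposition"
begin

definition unitary_group :: "nat \<Rightarrow> complex mat monoid" where
  "unitary_group n =
     \<lparr>carrier = {u \<in> carrier_mat n n. mat_adjoint u * u = 1\<^sub>m n \<and> u * mat_adjoint u = 1\<^sub>m n},
      mult = (*), one = 1\<^sub>m n\<rparr>"

text \<open>Choosing an orthonormal basis, a representation space is \<open>V = \<complex>\<^sup>n\<close>, that is,
  \<open>carrier_vec n\<close> with the Hermitian product \<open>\<bullet>c\<close> (linear in the first argument).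
  The dimension can be read off the matrix of the neutral element.\<close>

type_synonym 'g rep = "'g \<Rightarrow> complex mat"

definition rep_dim :: "('g, 'm) monoid_scheme \<Rightarrow> 'g rep \<Rightarrow> nat" where
  "rep_dim G \<pi> = dim_row (\<pi> \<one>\<^bsub>G\<^esub>)"

abbreviation rep_space :: "('g, 'm) monoid_scheme \<Rightarrow> 'g rep \<Rightarrow> complex vec set" where
  "rep_space G \<pi> \<equiv> carrier_vec (rep_dim G \<pi>)"

definition unitary_rep :: "('g, 'm) monoid_scheme \<Rightarrow> 'g rep \<Rightarrow> bool" where
  "unitary_rep G \<pi> \<longleftrightarrow> \<pi> \<in> hom G (unitary_group (rep_dim G \<pi>))"

definition irreducible_unitary_rep :: "('g, 'm) monoid_scheme \<Rightarrow> 'g rep \<Rightarrow> bool" where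
  "irreducible_unitary_rep G \<pi> \<longleftrightarrow>
     unitary_rep G \<pi> \<and> rep_dim G \<pi> > 0 \<and>
     (\<forall>W. VectorSpace.subspace class_ring W (module_vec TYPE(complex) (rep_dim G \<pi>)) \<and>
          (\<forall>g\<in>carrier G. \<forall>w\<in>W. \<pi> g *\<^sub>v w \<in> W) \<longrightarrow>
          W = {0\<^sub>v (rep_dim G \<pi>)} \<or> W = rep_space G \<pi>)"

definition equivalent_rep :: "('g, 'm) monoid_scheme \<Rightarrow> 'g rep \<Rightarrow> 'g rep \<Rightarrow> bool" where
  "equivalent_rep G \<pi> \<rho> \<longleftrightarrow>
     rep_dim G \<pi> = rep_dim G \<rho> \<and>
     (\<exists>T \<in> carrier_mat (rep_dim G \<pi>) (rep_dim G \<pi>).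
        invertible_mat T \<and> (\<forall>g\<in>carrier G. T * \<pi> g = \<rho> g * T))"

definition trivial_rep :: "'g rep" where
  "trivial_rep = (\<lambda>g. 1\<^sub>m 1)"

text \<open>The contragredient representation, written in the basis dual to the standard one.\<close>

definition dual_rep :: "('g, 'm) monoid_scheme \<Rightarrow> 'g rep \<Rightarrow> 'g rep" where
  "dual_rep G \<pi> = (\<lambda>g. transpose_mat (\<pi> (inv\<^bsub>G\<^esub> g)))"

text \<open>\<open>R\<close> is the unitary dual of \<open>G\<close>: one fixed representative of each class.\<close>

definition irrep_representatives :: "('g, 'm) monoid_scheme \<Rightarrow> 'g rep set \<Rightarrow> bool" where
  "irrep_representatives G R \<longleftrightarrow>
     (\<forall>\<pi>\<in>R. irreducible_unitary_rep G \<pi>) \<and>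
     (\<forall>\<sigma>. irreducible_unitary_rep G \<sigma> \<longrightarrow> (\<exists>!\<pi>. \<pi> \<in> R \<and> equivalent_rep G \<sigma> \<pi>))"

definition self_dual :: "('g, 'm) monoid_scheme \<Rightarrow> 'g rep \<Rightarrow> bool" where
  "self_dual G \<pi> \<longleftrightarrow> equivalent_rep G \<pi> (dual_rep G \<pi>)"

definition conjugate_linear :: "nat \<Rightarrow> (complex vec \<Rightarrow> complex vec) \<Rightarrow> bool" where
  "conjugate_linear n J \<longleftrightarrow>
     J \<in> carrier_vec n \<rightarrow> carrier_vec n \<and>
     (\<forall>x\<in>carrier_vec n. \<forall>y\<in>carrier_vec n. J (x + y) = J x + J y) \<and>
     (\<forall>c. \<forall>x\<in>carrier_vec n. J (c \<cdot>\<^sub>v x) = cnj c \<cdot>\<^sub>v J x)"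

text \<open>\<open>\<epsilon> = 1\<close> gives the real case, \<open>\<epsilon> = -1\<close> the quaternionic one.\<close>

definition structure_map ::
  "('g, 'm) monoid_scheme \<Rightarrow> 'g rep \<Rightarrow> complex \<Rightarrow> (complex vec \<Rightarrow> complex vec) \<Rightarrow> bool" where
  "structure_map G \<pi> \<epsilon> J \<longleftrightarrow>
     conjugate_linear (rep_dim G \<pi>) J \<and>
     (\<forall>g\<in>carrier G. \<forall>x\<in>rep_space G \<pi>. J (\<pi> g *\<^sub>v x) = \<pi> g *\<^sub>v J x) \<and>
     (\<forall>x\<in>rep_space G \<pi>. J (J x) = \<epsilon> \<cdot>\<^sub>v x)"

definition real_rep :: "('g, 'm) monoid_scheme \<Rightarrow> 'g rep \<Rightarrow> bool" where
  "real_rep G \<pi> \<longleftrightarrow> self_dual G \<pi> \<and> (\<exists>J. structure_map G \<pi> 1 J)"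

definition quaternionic_rep :: "('g, 'm) monoid_scheme \<Rightarrow> 'g rep \<Rightarrow> bool" where
  "quaternionic_rep G \<pi> \<longleftrightarrow> self_dual G \<pi> \<and> (\<exists>J. structure_map G \<pi> (-1) J)"

definition fixed_space ::
  "('g, 'm) monoid_scheme \<Rightarrow> 'g rep \<Rightarrow> (complex vec \<Rightarrow> complex vec) \<Rightarrow> complex vec set" where
  "fixed_space G \<pi> J = {x \<in> rep_space G \<pi>. J x = x}"

text \<open>\<open>C\<close> contains exactly one member of each pair of inequivalent dual classes.\<close>

definition dual_pair_representatives ::
  "('g, 'm) monoid_scheme \<Rightarrow> 'g rep set \<Rightarrow> 'g rep set \<Rightarrow> bool" where
  "dual_pair_representatives G R C \<longleftrightarrow>
     C \<subseteq> {\<pi>\<in>R. \<not> self_dual G \<pi>} \<and>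
     (\<forall>\<pi>\<in>R. \<not> self_dual G \<pi> \<longrightarrow>
        (\<exists>!\<sigma>. \<sigma> \<in> C \<and> (equivalent_rep G \<sigma> \<pi> \<or> equivalent_rep G \<sigma> (dual_rep G \<pi>))))"

text \<open>An orthonormal basis, indexed by \<open>{..<n}\<close>, of a space \<open>W \<subseteq> \<complex>\<^sup>m\<close> over the scalars \<open>F\<close>,
  where \<open>F\<close> is \<open>UNIV\<close> or \<open>\<real>\<close> (as a subset of the complex numbers).\<close>

definition orthonormal_basis ::
  "complex set \<Rightarrow> nat \<Rightarrow> complex vec set \<Rightarrow> nat \<Rightarrow> (nat \<Rightarrow> complex vec) \<Rightarrow> bool" where
  "orthonormal_basis F m W n b \<longleftrightarrow>
     (\<forall>k<n. b k \<in> W) \<and>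
     (\<forall>j<n. \<forall>k<n. b j \<bullet>c b k = (if j = k then 1 else 0)) \<and>
     (\<forall>x\<in>W. \<exists>c. (\<forall>k<n. c k \<in> F) \<and>
        x = finsum_vec TYPE(complex) m (\<lambda>k. c k \<cdot>\<^sub>v b k) {..<n})"

definition rep_sum :: "('g, 'm) monoid_scheme \<Rightarrow> 'g rep \<Rightarrow> 'g set \<Rightarrow> complex mat" where
  "rep_sum G \<pi> S =
     mat (rep_dim G \<pi>) (rep_dim G \<pi>) (\<lambda>(a, b). \<Sum>s\<in>S. \<pi> s $$ (a, b))"

definition is_eigenvector :: "complex mat \<Rightarrow> complex vec \<Rightarrow> bool" where
  "is_eigenvector A x \<longleftrightarrow> (\<exists>k. eigenvector A x k)"

definition quaternionic_family ::
  "nat \<Rightarrow> (complex vec \<Rightarrow> complex vec) \<Rightarrow> (nat \<Rightarrow> complex vec) \<Rightarrow> nat \<Rightarrow> complex vec" where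
  "quaternionic_family n J v k = (if k < n div 2 then v k else J (v (k - n div 2)))"

text \<open>An operator in the orthogonal group of \<open>V\<^sub>J\<close> is identified with its unique complex linear
  extension to \<open>V = V\<^sub>J \<oplus> iV\<^sub>J\<close>, a unitary operator which preserves \<open>V\<^sub>J\<close>.\<close>

definition orthogonal_group ::
  "('g, 'm) monoid_scheme \<Rightarrow> 'g rep \<Rightarrow> (complex vec \<Rightarrow> complex vec) \<Rightarrow> complex mat monoid" where
  "orthogonal_group G \<pi> J = (unitary_group (rep_dim G \<pi>))
     \<lparr>carrier := {u \<in> carrier (unitary_group (rep_dim G \<pi>)).
                   (\<lambda>x. u *\<^sub>v x) ` fixed_space G \<pi> J = fixed_space G \<pi> J}\<rparr>"

text \<open>The type of matrices carries no topology; the Borel sets of a set of \<open>n \<times> n\<close> matrices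
  are those generated by the entries.\<close>

definition matrix_borel :: "nat \<Rightarrow> complex mat set \<Rightarrow> complex mat measure" where
  "matrix_borel n K =
     sigma K {{u \<in> K. u $$ (a, b) \<in> B} |a b B. a < n \<and> b < n \<and> B \<in> sets borel}"

text \<open>On a compact group this determines the measure uniquely, and left invariance
  implies right invariance.\<close>

definition haar_prob :: "nat \<Rightarrow> complex mat monoid \<Rightarrow> complex mat measure \<Rightarrow> bool" where
  "haar_prob n K H \<longleftrightarrow>
     prob_space H \<and> space H = carrier K \<and> sets H = sets (matrix_borel n (carrier K)) \<and>
     (\<forall>u\<in>carrier K. distr H H (\<lambda>x. u \<otimes>\<^bsub>K\<^esub> x) = H)"

definition matrix_coeff :: "'g rep \<Rightarrow> complex vec \<Rightarrow> complex vec \<Rightarrow> 'g \<Rightarrow> complex" where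
  "matrix_coeff \<pi> v w = (\<lambda>g. (\<pi> g *\<^sub>v v) \<bullet>c w)"

definition x_fun ::
  "('g, 'm) monoid_scheme \<Rightarrow> 'g rep \<Rightarrow> complex vec \<Rightarrow> complex vec \<Rightarrow> 'g \<Rightarrow> complex" where
  "x_fun G \<pi> v w = (\<lambda>g. complex_of_real
     (sqrt (2 * real (rep_dim G \<pi>)) / sqrt (real (order G)) * Re (matrix_coeff \<pi> v w g)))"

definition y_fun ::
  "('g, 'm) monoid_scheme \<Rightarrow> 'g rep \<Rightarrow> complex vec \<Rightarrow> complex vec \<Rightarrow> 'g \<Rightarrow> complex" where
  "y_fun G \<pi> v w = (\<lambda>g. complex_of_real
     (sqrt (2 * real (rep_dim G \<pi>)) / sqrt (real (order G)) * Im (matrix_coeff \<pi> v w g)))"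

definition phi_fun ::
  "('g, 'm) monoid_scheme \<Rightarrow> 'g rep \<Rightarrow> complex vec \<Rightarrow> complex vec \<Rightarrow> 'g \<Rightarrow> complex" where
  "phi_fun G \<pi> v w = (\<lambda>g. complex_of_real
     (sqrt (real (rep_dim G \<pi>)) / sqrt (real (order G))) * matrix_coeff \<pi> v w g)"

definition random_index ::
  "('g, 'm) monoid_scheme \<Rightarrow> 'g rep set \<Rightarrow> 'g rep set \<Rightarrow> 'g rep set" where
  "random_index G R C = C \<union> {\<pi>\<in>R. real_rep G \<pi>} \<union> {\<pi>\<in>R. quaternionic_rep G \<pi>}"

text \<open>The sample point \<open>\<omega>\<close> assigns to each index its random operator, so that
  \<open>w\<^sub>j = \<omega> \<pi> *\<^sub>v e \<pi> j\<close>. All basis indices start at \<open>0\<close>.\<close>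

definition random_eigenbasis ::
  "('g, 'm) monoid_scheme \<Rightarrow> 'g rep set \<Rightarrow> 'g rep set \<Rightarrow> ('g rep \<Rightarrow> nat \<Rightarrow> complex vec) \<Rightarrow>
   ('g rep \<Rightarrow> nat \<Rightarrow> complex vec) \<Rightarrow> ('g rep \<Rightarrow> complex mat) \<Rightarrow> ('g \<Rightarrow> complex) set" where
  "random_eigenbasis G R C v e \<omega> =
     {x_fun G \<pi> (v \<pi> k) (\<omega> \<pi> *\<^sub>v e \<pi> j) |\<pi> k j.
        \<pi> \<in> C \<and> k < rep_dim G \<pi> \<and> j < rep_dim G \<pi>} \<union>
     {y_fun G \<pi> (v \<pi> k) (\<omega> \<pi> *\<^sub>v e \<pi> j) |\<pi> k j.
        \<pi> \<in> C \<and> k < rep_dim G \<pi> \<and> j < rep_dim G \<pi>} \<union>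
     {phi_fun G \<pi> (v \<pi> k) (\<omega> \<pi> *\<^sub>v e \<pi> j) |\<pi> k j.
        \<pi> \<in> R \<and> real_rep G \<pi> \<and> k < rep_dim G \<pi> \<and> j < rep_dim G \<pi>} \<union>
     {x_fun G \<pi> (v \<pi> k) (\<omega> \<pi> *\<^sub>v e \<pi> j) |\<pi> k j.
        \<pi> \<in> R \<and> quaternionic_rep G \<pi> \<and> k < rep_dim G \<pi> div 2 \<and> j < rep_dim G \<pi>} \<union>
     {y_fun G \<pi> (v \<pi> k) (\<omega> \<pi> *\<^sub>v e \<pi> j) |\<pi> k j.
        \<pi> \<in> R \<and> quaternionic_rep G \<pi> \<and> k < rep_dim G \<pi> div 2 \<and> j < rep_dim G \<pi>}"

definition l2_norm :: "('g, 'm) monoid_scheme \<Rightarrow> ('g \<Rightarrow> real) \<Rightarrow> real" where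
  "l2_norm G f = sqrt (\<Sum>g\<in>carrier G. (f g)\<^sup>2)"

definition mu :: "('g, 'm) monoid_scheme \<Rightarrow> ('g \<Rightarrow> complex) \<Rightarrow> ('g \<Rightarrow> real) \<Rightarrow> real" where
  "mu G \<phi> f = (\<Sum>g\<in>carrier G. f g * (cmod (\<phi> g))\<^sup>2)"

end

theory Submission
  imports Defs "Jordan_Normal_Form.Spectral_Radius"
begin

text \<open>Each function of the eigenbasis satisfies
  \<open>\<bar>\<phi>(g)\<bar>\<^sup>2 = (D / \<bar>G\<bar>) (Re \<langle>\<pi>(g) v, w\<rangle>)\<^sup>2\<close> (for \<open>y\<close> with \<open>- \<i> v\<close> in place of \<open>v\<close>), where \<open>w\<close> is
  a random unit vector of a real Euclidean space of dimension \<open>D\<close>. Hence \<open>\<mu>\<^sub>\<phi>[f]\<close> is a quadratic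
  form of \<open>w\<close> whose mean is the average of \<open>f\<close>, and Schur orthogonality bounds the Frobenius norm
  of its matrix by \<open>D \<parallel>f\<parallel> / \<surd>(\<bar>G\<bar> dim V)\<close>. Invariance of Haar measure under one-parameter families of
  group elements, differentiated at the identity, yields an integration by parts formula on the
  sphere; applied to powers of a traceless quadratic form \<open>q\<close> with Frobenius norm at most \<open>1\<close> it gives
  \<open>E q\<^bsup>2k\<^esup> \<le> (2k)! (3/D)\<^bsup>2k\<^esup>\<close>, hence a tail \<open>P(\<bar>q\<bar> > s/D) \<le> 3 exp(- s/12)\<close>. This is stronger than what the
  union bound over all representations, basis vectors and functions needs, and it makes the terms
  \<open>exp(- dim V / 12)\<close> superfluous. The union bound is finite because \<open>G\<close> has at most \<open>\<bar>G\<bar>\<close>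
  inequivalent irreducible representations, and the trivial one contributes nothing since its
  function has constant modulus.\<close>

section \<open>First-order expansions with uniform remainder\<close>

text \<open>Haar measure is used through one fact only, the invariance under left multiplication;
  from it the identity \<open>stein\<close> is extracted, and everything after that is common to the
  real and the complex case. The obstacle is the complex case: U(V) is much smaller than the
  rotation group of the real space of dimension 2 dim V and contains no single coordinate rotation.
  The identity \<open>stein\<close>, however, asks only that a sum of derivatives over all
  coordinate rotations vanish in mean, and this sum can be reached from the unitary generators. The
  identity does not close up, since it bounds a moment of q by a mean involving |Qx|^2. This is why
  moments are bounded for a whole class of matrices at once, a class stable under Q -> Q^2 minus its
  trace part. The constant 3 comes from 4(4k+3) <= 9(2k+2) in the recursion, and 12 from using the
  moment of order 2k with 6k <= s/2. With s = t sqrt(dim V) the real dimension D cancels, so both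
  cases give the same tail.\<close>

definition first_order ::
  "'a set \<Rightarrow> (real \<Rightarrow> 'a \<Rightarrow> real) \<Rightarrow> ('a \<Rightarrow> real) \<Rightarrow> ('a \<Rightarrow> real) \<Rightarrow> bool" where
  "first_order S f f0 f1 \<longleftrightarrow> (\<exists>C\<ge>0. \<forall>x\<in>S. \<bar>f0 x\<bar> \<le> C \<and> \<bar>f1 x\<bar> \<le> C \<and>
     (\<forall>t\<in>{0..1}. \<bar>f t x - f0 x - t * f1 x\<bar> \<le> C * t\<^sup>2))"

lemma first_order_const:
  assumes "\<And>x. x \<in> S \<Longrightarrow> \<bar>c x\<bar> \<le> B"
  shows "first_order S (\<lambda>t. c) c (\<lambda>x. 0)"
  unfolding first_order_def
  by (rule exI[of _ "max B 0"]) (use assms in \<open>auto simp: le_max_iff_disj\<close>)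

lemma first_order_time:
  assumes "C \<ge> 0" "\<And>t. t \<in> {0..1} \<Longrightarrow> \<bar>a t - a0 - t * a1\<bar> \<le> C * t\<^sup>2"
  shows "first_order S (\<lambda>t x. a t) (\<lambda>x. a0) (\<lambda>x. a1)"
  unfolding first_order_def
proof (intro exI[of _ "max C (max \<bar>a0\<bar> \<bar>a1\<bar>)"] conjI ballI)
  fix t :: real assume "t \<in> {0..1}"
  then have "\<bar>a t - a0 - t * a1\<bar> \<le> C * t\<^sup>2" by (rule assms(2))
  also have "\<dots> \<le> max C (max \<bar>a0\<bar> \<bar>a1\<bar>) * t\<^sup>2" by (intro mult_right_mono) auto
  finally show "\<bar>a t - a0 - t * a1\<bar> \<le> max C (max \<bar>a0\<bar> \<bar>a1\<bar>) * t\<^sup>2" .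
qed (use assms(1) in auto)

lemma abs_cos_minus_1_le: "\<bar>cos x - 1\<bar> \<le> x\<^sup>2 / 2" for x :: real
proof -
  have "\<bar>sin (x / 2)\<bar>\<^sup>2 \<le> \<bar>x / 2\<bar>\<^sup>2"
    by (intro power_mono abs_sin_x_le_abs_x) auto
  moreover have "cos x - 1 = - 2 * (sin (x / 2))\<^sup>2"
    using cos_double_sin[of "x / 2"] by simp
  ultimately show ?thesis by (simp add: power_divide abs_mult)
qed

lemma abs_sin_minus_self_le: "\<bar>sin x - x\<bar> \<le> x\<^sup>2 / 2" for x :: real
  using Maclaurin_sin_bound[of x 2] by (simp add: numeral_2_eq_2 sin_coeff_def field_simps)

lemma first_order_add:
  assumes "first_order S f f0 f1" "first_order S g g0 g1"
  shows "first_order S (\<lambda>t x. f t x + g t x) (\<lambda>x. f0 x + g0 x) (\<lambda>x. f1 x + g1 x)"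
proof -
  obtain C where C: "C \<ge> 0" "\<And>x. x \<in> S \<Longrightarrow> \<bar>f0 x\<bar> \<le> C" "\<And>x. x \<in> S \<Longrightarrow> \<bar>f1 x\<bar> \<le> C"
    "\<And>x t. x \<in> S \<Longrightarrow> t \<in> {0..1} \<Longrightarrow> \<bar>f t x - f0 x - t * f1 x\<bar> \<le> C * t\<^sup>2"
    using assms(1) unfolding first_order_def by blast
  obtain D where D: "D \<ge> 0" "\<And>x. x \<in> S \<Longrightarrow> \<bar>g0 x\<bar> \<le> D" "\<And>x. x \<in> S \<Longrightarrow> \<bar>g1 x\<bar> \<le> D"
    "\<And>x t. x \<in> S \<Longrightarrow> t \<in> {0..1} \<Longrightarrow> \<bar>g t x - g0 x - t * g1 x\<bar> \<le> D * t\<^sup>2"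
    using assms(2) unfolding first_order_def by blast
  show ?thesis
    unfolding first_order_def
  proof (intro exI[of _ "C + D"] conjI ballI)
    show "0 \<le> C + D" using C(1) D(1) by simp
    fix x assume x: "x \<in> S"
    show "\<bar>f0 x + g0 x\<bar> \<le> C + D" using C(2)[OF x] D(2)[OF x] by linarith
    show "\<bar>f1 x + g1 x\<bar> \<le> C + D" using C(3)[OF x] D(3)[OF x] by linarith
    fix t :: real assume t: "t \<in> {0..1}"
    show "\<bar>f t x + g t x - (f0 x + g0 x) - t * (f1 x + g1 x)\<bar> \<le> (C + D) * t\<^sup>2"
      using C(4)[OF x t] D(4)[OF x t] by (simp add: algebra_simps)
  qed
qed

text \<open>Here the bounds on the two leading coefficients in \<open>first_order\<close> pay off:
  with them the remainder of a product stays quadratic in t, uniformly on S. Expansions of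
  coordinates thus propagate to all polynomials in them.\<close>

lemma first_order_mult:
  assumes "first_order S f f0 f1" "first_order S g g0 g1"
  shows "first_order S (\<lambda>t x. f t x * g t x) (\<lambda>x. f0 x * g0 x) (\<lambda>x. f1 x * g0 x + f0 x * g1 x)"
proof -
  obtain C where C: "C \<ge> 0" "\<And>x. x \<in> S \<Longrightarrow> \<bar>f0 x\<bar> \<le> C" "\<And>x. x \<in> S \<Longrightarrow> \<bar>f1 x\<bar> \<le> C"
    "\<And>x t. x \<in> S \<Longrightarrow> t \<in> {0..1} \<Longrightarrow> \<bar>f t x - f0 x - t * f1 x\<bar> \<le> C * t\<^sup>2"
    using assms(1) unfolding first_order_def by blast
  obtain D where D: "D \<ge> 0" "\<And>x. x \<in> S \<Longrightarrow> \<bar>g0 x\<bar> \<le> D" "\<And>x. x \<in> S \<Longrightarrow> \<bar>g1 x\<bar> \<le> D"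
    "\<And>x t. x \<in> S \<Longrightarrow> t \<in> {0..1} \<Longrightarrow> \<bar>g t x - g0 x - t * g1 x\<bar> \<le> D * t\<^sup>2"
    using assms(2) unfolding first_order_def by blast
  have CD: "0 \<le> C * D" using C(1) D(1) by simp
  have prod_le: "\<bar>a * b\<bar> \<le> A * B" if "\<bar>a\<bar> \<le> A" "\<bar>b\<bar> \<le> B" for a b A B :: real
    unfolding abs_mult using that by (intro mult_mono) auto
  show ?thesis
    unfolding first_order_def
  \<comment> \<open>The remainder is split below into three products, bounded by 3, 2 and 1 times C
    D t^2 because t <= 1.\<close>
  proof (intro exI[of _ "6 * (C * D)"] conjI ballI)
    show "0 \<le> 6 * (C * D)" using CD by simp
    fix x assume x: "x \<in> S"
    show "\<bar>f0 x * g0 x\<bar> \<le> 6 * (C * D)"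
      using prod_le[OF C(2)[OF x] D(2)[OF x]] CD by linarith
    show "\<bar>f1 x * g0 x + f0 x * g1 x\<bar> \<le> 6 * (C * D)"
      using prod_le[OF C(3)[OF x] D(2)[OF x]] prod_le[OF C(2)[OF x] D(3)[OF x]] CD by linarith
    fix t :: real assume t: "t \<in> {0..1}"
    define r where "r = f t x - f0 x - t * f1 x"
    define s where "s = g t x - g0 x - t * g1 x"
    have t': "\<bar>t\<bar> \<le> 1" "t\<^sup>2 \<le> 1" using t by (auto simp: power_le_one)
    have r: "\<bar>r\<bar> \<le> C * t\<^sup>2" and s: "\<bar>s\<bar> \<le> D * t\<^sup>2"
      unfolding r_def s_def using C(4)[OF x t] D(4)[OF x t] by auto
    have "D * t\<^sup>2 \<le> D" using D(1) t' by (simp add: mult_left_le)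
    moreover have "\<bar>t * g1 x\<bar> \<le> D" using prod_le[OF t'(1) D(3)[OF x]] by simp
    ultimately have "\<bar>g0 x + t * g1 x + s\<bar> \<le> 3 * D" using D(2)[OF x] s by linarith
    from prod_le[OF r this] have 1: "\<bar>r * (g0 x + t * g1 x + s)\<bar> \<le> 3 * (C * D) * t\<^sup>2"
      by (simp add: algebra_simps)
    have "\<bar>t * f1 x\<bar> \<le> C" using prod_le[OF t'(1) C(3)[OF x]] by simp
    then have "\<bar>f0 x + t * f1 x\<bar> \<le> 2 * C" using C(2)[OF x] by linarith
    from prod_le[OF s this] have 2: "\<bar>s * (f0 x + t * f1 x)\<bar> \<le> 2 * (C * D) * t\<^sup>2"
      by (simp add: algebra_simps)
    have "\<bar>f1 x * g1 x\<bar> * t\<^sup>2 \<le> C * D * t\<^sup>2"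
      using prod_le[OF C(3)[OF x] D(3)[OF x]] by (intro mult_right_mono) auto
    then have 3: "\<bar>f1 x * g1 x * t\<^sup>2\<bar> \<le> C * D * t\<^sup>2" by (simp add: abs_mult)
    have "f t x * g t x - f0 x * g0 x - t * (f1 x * g0 x + f0 x * g1 x)
       = r * (g0 x + t * g1 x + s) + s * (f0 x + t * f1 x) + f1 x * g1 x * t\<^sup>2"
      unfolding r_def s_def by (simp add: algebra_simps power2_eq_square)
    also have "\<bar>\<dots>\<bar> \<le> 3 * (C * D) * t\<^sup>2 + 2 * (C * D) * t\<^sup>2 + C * D * t\<^sup>2"
      using 1 2 3 by linarith
    finally show "\<bar>f t x * g t x - f0 x * g0 x - t * (f1 x * g0 x + f0 x * g1 x)\<bar>
      \<le> 6 * (C * D) * t\<^sup>2"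
      by simp
  qed
qed

lemma first_order_cmult:
  assumes "first_order S f f0 f1"
  shows "first_order S (\<lambda>t x. c * f t x) (\<lambda>x. c * f0 x) (\<lambda>x. c * f1 x)"
  using first_order_mult[OF first_order_const[of S "\<lambda>_. c" "\<bar>c\<bar>"] assms] by simp

lemma first_order_sum:
  assumes "finite A" "\<And>i. i \<in> A \<Longrightarrow> first_order S (f i) (f0 i) (f1 i)"
  shows "first_order S (\<lambda>t x. \<Sum>i\<in>A. f i t x) (\<lambda>x. \<Sum>i\<in>A. f0 i x) (\<lambda>x. \<Sum>i\<in>A. f1 i x)"
  using assms
proof (induction A rule: finite_induct)
  case empty
  then show ?case using first_order_const[of S "\<lambda>_. 0" 0] by simp
next
  case (insert a A)
  then show ?case by (simp add: first_order_add)
qed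

lemma first_order_power_Suc:
  assumes "first_order S f f0 f1"
  shows "first_order S (\<lambda>t x. f t x ^ Suc n) (\<lambda>x. f0 x ^ Suc n)
    (\<lambda>x. real (Suc n) * f0 x ^ n * f1 x)"
proof (induction n)
  case 0
  then show ?case using assms by simp
next
  case (Suc n)
  from first_order_mult[OF assms Suc] show ?case by (simp add: algebra_simps)
qed

text \<open>A mean that is constant along the family has derivative zero. The uniform remainder
  replaces differentiation under the integral: t |E f1| <= C t^2 on [0,1], and dividing by a small
  positive t forces E f1 = 0.\<close>

lemma (in prob_space) expectation_first_order:
  assumes fo: "first_order (space M) f f0 f1"
    and meas: "f1 \<in> borel_measurable M" "f0 \<in> borel_measurable M"
      "\<And>t. t \<in> {0..1} \<Longrightarrow> f t \<in> borel_measurable M"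
    and inv: "\<And>t. t \<in> {0..1} \<Longrightarrow> expectation (f t) = expectation f0"
  shows "expectation f1 = 0"
proof -
  obtain C where C: "C \<ge> 0" "\<And>x. x \<in> space M \<Longrightarrow> \<bar>f0 x\<bar> \<le> C" "\<And>x. x \<in> space M \<Longrightarrow> \<bar>f1 x\<bar> \<le> C"
    "\<And>x t. x \<in> space M \<Longrightarrow> t \<in> {0..1} \<Longrightarrow> \<bar>f t x - f0 x - t * f1 x\<bar> \<le> C * t\<^sup>2"
    using fo unfolding first_order_def by blast
  have int0: "integrable M f0" and int1: "integrable M f1"
    using C(2,3) by (auto intro!: integrable_const_bound[where B=C] meas)
  have bound: "t * \<bar>expectation f1\<bar> \<le> C * t\<^sup>2" if t: "t \<in> {0..1}" for t
  proof -
    have intr: "integrable M (\<lambda>x. f t x - f0 x - t * f1 x)"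
      using C(4)[OF _ t] meas t
      by (auto intro!: integrable_const_bound[where B="C * t\<^sup>2"])
    have intt: "integrable M (f t)"
      using Bochner_Integration.integrable_add[OF Bochner_Integration.integrable_add[OF intr int0]
        integrable_mult_right[OF int1, of t]] by simp
    have "t * expectation f1 = - expectation (\<lambda>x. f t x - f0 x - t * f1 x)"
      using inv[OF t] int0 int1 intt by simp
    also have "\<bar>\<dots>\<bar> \<le> expectation (\<lambda>x. \<bar>f t x - f0 x - t * f1 x\<bar>)"
      using integral_abs_bound[of M "\<lambda>x. f t x - f0 x - t * f1 x"] by simp
    also have "\<dots> \<le> expectation (\<lambda>_. C * t\<^sup>2)"
      using intr C(4)[OF _ t] by (intro integral_mono) auto
    finally show ?thesis using t by (simp add: abs_mult prob_space)
  qed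
  show ?thesis
  proof (rule ccontr)
    assume "expectation f1 \<noteq> 0"
    then have e: "\<bar>expectation f1\<bar> > 0" by simp
    \<comment> \<open>Small enough that C t < |E f1|; \<open>C + 1\<close> keeps the denominator
      positive when \<open>C\<close> is 0.\<close>
    define t where "t = min 1 (\<bar>expectation f1\<bar> / (2 * (C + 1)))"
    have t: "t \<in> {0..1}" "t > 0" using e C(1) by (auto simp: t_def)
    have "\<bar>expectation f1\<bar> \<le> C * t"
      using bound[OF t(1)] t(2) by (simp add: power2_eq_square)
    also have "\<dots> \<le> C * (\<bar>expectation f1\<bar> / (2 * (C + 1)))"
      using C(1) by (intro mult_left_mono) (auto simp: t_def)
    also have "\<dots> < \<bar>expectation f1\<bar>"
      using C(1) e mult_nonneg_nonneg[of C "\<bar>expectation f1\<bar>"] by (simp add: field_simps del: mult_nonneg_nonneg)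
    finally show False by simp
  qed
qed

section \<open>Quadratic forms of a random unit vector\<close>

definition dotp :: "'i set \<Rightarrow> ('i \<Rightarrow> real) \<Rightarrow> ('i \<Rightarrow> real) \<Rightarrow> real" where
  "dotp I x y = (\<Sum>i\<in>I. x i * y i)"

definition lapply :: "'i set \<Rightarrow> ('i \<Rightarrow> 'i \<Rightarrow> real) \<Rightarrow> ('i \<Rightarrow> real) \<Rightarrow> 'i \<Rightarrow> real" where
  "lapply I A x i = (\<Sum>j\<in>I. A i j * x j)"

definition qform :: "'i set \<Rightarrow> ('i \<Rightarrow> 'i \<Rightarrow> real) \<Rightarrow> ('i \<Rightarrow> real) \<Rightarrow> real" where
  "qform I Q x = dotp I x (lapply I Q x)"

definition tr :: "'i set \<Rightarrow> ('i \<Rightarrow> 'i \<Rightarrow> real) \<Rightarrow> real" where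
  "tr I Q = (\<Sum>i\<in>I. Q i i)"

definition frob2 :: "'i set \<Rightarrow> ('i \<Rightarrow> 'i \<Rightarrow> real) \<Rightarrow> real" where
  "frob2 I Q = (\<Sum>i\<in>I. \<Sum>j\<in>I. (Q i j)\<^sup>2)"

definition symmetric_on :: "'i set \<Rightarrow> ('i \<Rightarrow> 'i \<Rightarrow> real) \<Rightarrow> bool" where
  "symmetric_on I Q \<longleftrightarrow> (\<forall>i\<in>I. \<forall>j\<in>I. Q i j = Q j i)"

lemma dotp_lapply_sym:
  assumes "symmetric_on I Q"
  shows "dotp I x (lapply I Q y) = dotp I y (lapply I Q x)"
proof -
  have "dotp I x (lapply I Q y) = (\<Sum>i\<in>I. \<Sum>j\<in>I. x i * Q i j * y j)"
    by (simp add: dotp_def lapply_def sum_distrib_left mult.assoc)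
  also have "\<dots> = (\<Sum>j\<in>I. \<Sum>i\<in>I. x i * Q i j * y j)" by (rule sum.swap)
  also have "\<dots> = (\<Sum>j\<in>I. \<Sum>i\<in>I. y j * Q j i * x i)"
    using assms by (intro sum.cong refl) (simp add: symmetric_on_def)
  also have "\<dots> = dotp I y (lapply I Q x)"
    by (simp add: dotp_def lapply_def sum_distrib_left mult.assoc)
  finally show ?thesis .
qed

lemma dotp_cauchy_schwarz: "(dotp I x y)\<^sup>2 \<le> dotp I x x * dotp I y y"
  using Cauchy_Schwarz_ineq_sum[of x y I] by (simp add: dotp_def power2_eq_square)

lemma lapply_norm_le: "dotp I (lapply I Q x) (lapply I Q x) \<le> frob2 I Q * dotp I x x"
proof -
  have "dotp I (lapply I Q x) (lapply I Q x) = (\<Sum>i\<in>I. (dotp I (Q i) x)\<^sup>2)"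
    by (simp add: dotp_def lapply_def power2_eq_square)
  also have "\<dots> \<le> (\<Sum>i\<in>I. dotp I (Q i) (Q i) * dotp I x x)"
    by (intro sum_mono dotp_cauchy_schwarz)
  also have "\<dots> = frob2 I Q * dotp I x x"
    by (simp add: frob2_def dotp_def sum_distrib_right power2_eq_square)
  finally show ?thesis .
qed

text \<open>Gives the starting value of the moment iteration: a Frobenius norm of at most 1 makes
  all even moments at most 1.\<close>

lemma qform_sq_le:
  assumes "dotp I x x = 1"
  shows "(qform I Q x)\<^sup>2 \<le> frob2 I Q"
  using dotp_cauchy_schwarz[of I x "lapply I Q x"] lapply_norm_le[of I Q x] assms
  by (simp add: qform_def)

text \<open>The derivative of \<open>x\<^sub>k q(x)\<^bsup>n+1\<^esup> (Q x)\<^sub>l\<close> along the linear vector field \<open>A\<close>,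
  where \<open>q\<close> is the quadratic form of \<open>Q\<close>.\<close>

definition test_deriv ::
  "'i set \<Rightarrow> ('i \<Rightarrow> 'i \<Rightarrow> real) \<Rightarrow> ('i \<Rightarrow> 'i \<Rightarrow> real) \<Rightarrow> nat \<Rightarrow> 'i \<Rightarrow> 'i \<Rightarrow> ('i \<Rightarrow> real) \<Rightarrow> real" where
  "test_deriv I A Q n k l x =
     lapply I A x k * qform I Q x ^ Suc n * lapply I Q x l
     + x k * (real (Suc n) * qform I Q x ^ n * (2 * dotp I (lapply I Q x) (lapply I A x))) * lapply I Q x l
     + x k * qform I Q x ^ Suc n * lapply I Q (lapply I A x) l"

lemma lapply_lincomb: "lapply I (\<lambda>i j. a * A i j + b * B i j) x = (\<lambda>i. a * lapply I A x i + b * lapply I B x i)"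
  by (auto simp: lapply_def fun_eq_iff sum.distrib sum_distrib_left algebra_simps)

lemma test_deriv_lincomb:
  "test_deriv I (\<lambda>i j. a * A i j + b * B i j) Q n k l x
     = a * test_deriv I A Q n k l x + b * test_deriv I B Q n k l x"
proof -
  have 1: "dotp I y (\<lambda>i. a * u i + b * v i) = a * dotp I y u + b * dotp I y v" for y u v
    by (auto simp: dotp_def sum.distrib sum_distrib_left algebra_simps)
  have 2: "lapply I Q (\<lambda>i. a * u i + b * v i) l = a * lapply I Q u l + b * lapply I Q v l" for u v
    by (auto simp: lapply_def sum.distrib sum_distrib_left algebra_simps)
  show ?thesis
    unfolding test_deriv_def lapply_lincomb 1 2 by (simp add: algebra_simps)
qed

text \<open>The matrix b a^T - a b^T. For orthonormal a and b it generates the rotation turning a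
  towards b. It is bilinear and alternating in (a, b), hence can be polarised.\<close>

definition rot_gen :: "('i \<Rightarrow> real) \<Rightarrow> ('i \<Rightarrow> real) \<Rightarrow> 'i \<Rightarrow> 'i \<Rightarrow> real" where
  "rot_gen a b i j = b i * a j - a i * b j"

lemma lapply_rot_gen: "lapply I (rot_gen a b) x i = dotp I a x * b i - dotp I b x * a i"
  by (simp add: lapply_def rot_gen_def dotp_def sum_distrib_left sum_subtractf algebra_simps)

definition std :: "'i \<Rightarrow> 'i \<Rightarrow> real" where
  "std k i = (if i = k then 1 else 0)"

lemma dotp_std:
  assumes "finite I" "k \<in> I"
  shows "dotp I (std k) x = x k"
  using assms by (simp add: dotp_def std_def if_distrib[of "\<lambda>u. u * _"] cong: if_cong)

lemma dotp_commute: "dotp I x y = dotp I y x"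
  by (simp add: dotp_def mult.commute)

text \<open>With F(x) = q(x)^(n+1) Qx and D = \<open>card I\<close>, the sum is div F - <x, DF x> -
  (D - 1) <x, F>, the divergence on the unit sphere of the tangential part of F, where DF is the
  Jacobian. F is homogeneous of degree 2n + 3, which gives the coefficient (D - 1) + (2n + 3) = D +
  2(n + 1) of q^(n+2); div F produces the other two terms.\<close>

lemma sum_test_deriv_rot:
  fixes x :: "'i \<Rightarrow> real"
  assumes I: "finite I" and Q: "symmetric_on I Q" and x: "dotp I x x = 1"
  shows "(\<Sum>k\<in>I. \<Sum>l\<in>I. test_deriv I (rot_gen (std k) (std l)) Q n k l x) =
     2 * real (Suc n) * qform I Q x ^ n * dotp I (lapply I Q x) (lapply I Q x)
     + qform I Q x ^ Suc n * tr I Q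
     - (real (card I) + 2 * real (Suc n)) * qform I Q x ^ (n + 2)"
proof -
  define y where "y = lapply I Q x"
  define q where "q = qform I Q x"
  have xy: "(\<Sum>k\<in>I. x k * y k) = q" by (simp add: q_def y_def qform_def dotp_def)
  have xx: "(\<Sum>k\<in>I. x k * x k) = 1" using x by (simp add: dotp_def)
  have yy: "(\<Sum>k\<in>I. y k * y k) = dotp I y y" by (simp add: dotp_def)
  \<comment> \<open>Each term is a factor in k times a factor in l, so its double sum factors; the
    exceptions, treated separately, are the Kronecker delta \<open>std l k\<close> and the entry
    \<open>Q l k\<close>.\<close>
  have eq: "test_deriv I (rot_gen (std k) (std l)) Q n k l x =
      q ^ Suc n * (x k * (std l k * y l)) - q ^ Suc n * (1 * (x l * y l))
      + 2 * real (Suc n) * q ^ n * ((x k * x k) * (y l * y l))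
      - 2 * real (Suc n) * q ^ n * ((x k * y k) * (x l * y l))
      + q ^ Suc n * ((x k * x k) * Q l l) - q ^ Suc n * (x k * (Q l k * x l))"
    if k: "k \<in> I" and l: "l \<in> I" for k l
  proof -
    have A: "lapply I (rot_gen (std k) (std l)) x = (\<lambda>i. x k * std l i - x l * std k i)"
      using I k l by (simp add: lapply_rot_gen dotp_std fun_eq_iff)
    have d: "dotp I y (\<lambda>i. x k * std l i - x l * std k i) = x k * y l - x l * y k"
    proof -
      have "dotp I y (\<lambda>i. x k * std l i - x l * std k i) = x k * dotp I (std l) y - x l * dotp I (std k) y"
        by (simp add: dotp_def right_diff_distrib sum_subtractf sum_distrib_left mult_ac)
      then show ?thesis using I k l by (simp add: dotp_std)
    qed
    have e: "lapply I Q (\<lambda>i. x k * std l i - x l * std k i) l = x k * Q l l - x l * Q l k"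
    proof -
      have "lapply I Q (\<lambda>i. x k * std l i - x l * std k i) l = x k * dotp I (std l) (Q l) - x l * dotp I (std k) (Q l)"
        by (simp add: lapply_def dotp_def right_diff_distrib sum_subtractf sum_distrib_left mult_ac)
      then show ?thesis using I k l by (simp add: dotp_std)
    qed
    have s: "std k k = (1::real)" by (simp add: std_def)
    show ?thesis
      unfolding test_deriv_def A y_def[symmetric] q_def[symmetric] d e s
      by (simp add: algebra_simps)
  qed
  have delta: "(\<Sum>k\<in>I. \<Sum>l\<in>I. x k * (std l k * y l)) = q"
  proof -
    have "(\<Sum>l\<in>I. x k * (std l k * y l)) = x k * y k" if "k \<in> I" for k
    proof -
      have "(\<Sum>l\<in>I. x k * (std l k * y l)) = x k * dotp I (std k) y"
        unfolding dotp_def sum_distrib_left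
        by (intro sum.cong) (auto simp: std_def)
      then show ?thesis using I that by (simp add: dotp_std)
    qed
    then show ?thesis using xy by simp
  qed
  have xQx: "(\<Sum>k\<in>I. \<Sum>l\<in>I. x k * (Q l k * x l)) = q"
  proof -
    have "(\<Sum>k\<in>I. \<Sum>l\<in>I. x k * (Q l k * x l)) = (\<Sum>k\<in>I. \<Sum>l\<in>I. x k * (Q k l * x l))"
      using Q by (intro sum.cong refl) (simp add: symmetric_on_def)
    then show ?thesis by (simp add: q_def qform_def dotp_def lapply_def sum_distrib_left)
  qed
  have const: "(\<Sum>k\<in>I. \<Sum>l\<in>I. 1 * (x l * y l)) = real (card I) * q"
    by (simp add: xy)
  have "(\<Sum>k\<in>I. \<Sum>l\<in>I. test_deriv I (rot_gen (std k) (std l)) Q n k l x) =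
     q ^ Suc n * (\<Sum>k\<in>I. \<Sum>l\<in>I. x k * (std l k * y l)) - q ^ Suc n * (\<Sum>k\<in>I. \<Sum>l\<in>I. 1 * (x l * y l))
      + 2 * real (Suc n) * q ^ n * (\<Sum>k\<in>I. \<Sum>l\<in>I. (x k * x k) * (y l * y l))
      - 2 * real (Suc n) * q ^ n * (\<Sum>k\<in>I. \<Sum>l\<in>I. (x k * y k) * (x l * y l))
      + q ^ Suc n * (\<Sum>k\<in>I. \<Sum>l\<in>I. (x k * x k) * Q l l)
      - q ^ Suc n * (\<Sum>k\<in>I. \<Sum>l\<in>I. x k * (Q l k * x l))"
    by (simp only: eq sum.distrib sum_subtractf sum_distrib_left cong: sum.cong)
  also have "\<dots> = q ^ Suc n * q - q ^ Suc n * (real (card I) * q)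
      + 2 * real (Suc n) * q ^ n * dotp I y y - 2 * real (Suc n) * q ^ n * (q * q)
      + q ^ Suc n * tr I Q - q ^ Suc n * q"
    unfolding delta xQx const
    by (simp only: sum_product[symmetric] xx xy yy tr_def mult_1)
  also have "\<dots> = 2 * real (Suc n) * q ^ n * dotp I y y + q ^ Suc n * tr I Q
     - (real (card I) + 2 * real (Suc n)) * q ^ (n + 2)"
    by (simp add: algebra_simps)
  finally show ?thesis by (simp add: y_def q_def)
qed

text \<open>No particular law on the sphere is fixed here. Invariance enters later through
  \<open>killing\<close> and \<open>stein\<close>, so the moment bounds serve the orthogonal case on
  R^d and the unitary case on R^(2d) alike.\<close>

locale random_unit_vector = prob_space M for M :: "'a measure" +
  fixes I :: "'i set" and X :: "'a \<Rightarrow> 'i \<Rightarrow> real"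
  assumes finite_I: "finite I" and I_nonempty: "I \<noteq> {}"
    and X_measurable: "\<And>i. i \<in> I \<Longrightarrow> (\<lambda>\<omega>. X \<omega> i) \<in> borel_measurable M"
    and X_unit: "\<And>\<omega>. \<omega> \<in> space M \<Longrightarrow> dotp I (X \<omega>) (X \<omega>) = 1"
begin

definition bdd_rv :: "('a \<Rightarrow> real) \<Rightarrow> bool" where
  "bdd_rv f \<longleftrightarrow> f \<in> borel_measurable M \<and> (\<exists>C. \<forall>\<omega>\<in>space M. \<bar>f \<omega>\<bar> \<le> C)"

lemma bdd_rv_integrable: "bdd_rv f \<Longrightarrow> integrable M f"
  unfolding bdd_rv_def real_norm_def[symmetric] by (blast intro: integrable_const_bound AE_I2)

lemma bdd_rv_const: "bdd_rv (\<lambda>_. c)"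
  unfolding bdd_rv_def by auto

lemma bdd_rv_add: "bdd_rv f \<Longrightarrow> bdd_rv g \<Longrightarrow> bdd_rv (\<lambda>\<omega>. f \<omega> + g \<omega>)"
  unfolding bdd_rv_def by (fastforce intro: order_trans[OF abs_triangle_ineq] add_mono)

lemma bdd_rv_mult:
  assumes "bdd_rv f" "bdd_rv g"
  shows "bdd_rv (\<lambda>\<omega>. f \<omega> * g \<omega>)"
proof -
  obtain C D where "\<And>\<omega>. \<omega> \<in> space M \<Longrightarrow> \<bar>f \<omega>\<bar> \<le> C" "\<And>\<omega>. \<omega> \<in> space M \<Longrightarrow> \<bar>g \<omega>\<bar> \<le> D"
    using assms unfolding bdd_rv_def by blast
  then have "\<bar>f \<omega> * g \<omega>\<bar> \<le> C * D" if "\<omega> \<in> space M" for \<omega>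
    unfolding abs_mult using that by (intro mult_mono) (auto intro: order_trans[OF abs_ge_zero])
  then show ?thesis using assms unfolding bdd_rv_def by auto
qed

lemma bdd_rv_power: "bdd_rv f \<Longrightarrow> bdd_rv (\<lambda>\<omega>. f \<omega> ^ n)"
  by (induction n) (auto intro: bdd_rv_const bdd_rv_mult)

lemma bdd_rv_sum:
  assumes "finite A" "\<And>i. i \<in> A \<Longrightarrow> bdd_rv (f i)"
  shows "bdd_rv (\<lambda>\<omega>. \<Sum>i\<in>A. f i \<omega>)"
  using assms by (induction A rule: finite_induct) (auto intro: bdd_rv_const bdd_rv_add)

lemma X_abs_le_1:
  assumes "\<omega> \<in> space M" "i \<in> I"
  shows "\<bar>X \<omega> i\<bar> \<le> 1"
proof -
  have "X \<omega> i * X \<omega> i \<le> dotp I (X \<omega>) (X \<omega>)"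
    unfolding dotp_def using assms finite_I by (intro member_le_sum) auto
  then have "(X \<omega> i)\<^sup>2 \<le> 1" using X_unit assms by (simp add: power2_eq_square)
  then show ?thesis by (simp add: abs_square_le_1)
qed

lemma bdd_rv_X: "i \<in> I \<Longrightarrow> bdd_rv (\<lambda>\<omega>. X \<omega> i)"
  unfolding bdd_rv_def using X_measurable X_abs_le_1 by blast

lemma bdd_rv_lapply:
  assumes "\<And>j. j \<in> I \<Longrightarrow> bdd_rv (\<lambda>\<omega>. Y \<omega> j)"
  shows "bdd_rv (\<lambda>\<omega>. lapply I A (Y \<omega>) i)"
  unfolding lapply_def using finite_I assms
  by (intro bdd_rv_sum bdd_rv_mult bdd_rv_const) auto

lemma bdd_rv_dotp:
  assumes "\<And>j. j \<in> I \<Longrightarrow> bdd_rv (\<lambda>\<omega>. Y \<omega> j)" "\<And>j. j \<in> I \<Longrightarrow> bdd_rv (\<lambda>\<omega>. Z \<omega> j)"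
  shows "bdd_rv (\<lambda>\<omega>. dotp I (Y \<omega>) (Z \<omega>))"
  unfolding dotp_def using finite_I assms by (intro bdd_rv_sum bdd_rv_mult) auto

lemma bdd_rv_qform: "bdd_rv (\<lambda>\<omega>. qform I Q (X \<omega>))"
  unfolding qform_def by (intro bdd_rv_dotp bdd_rv_lapply bdd_rv_X)

lemma bdd_rv_test_deriv:
  assumes "k \<in> I"
  shows "bdd_rv (\<lambda>\<omega>. test_deriv I A Q n k l (X \<omega>))"
  unfolding test_deriv_def using assms
  by (intro bdd_rv_add bdd_rv_mult bdd_rv_const bdd_rv_power bdd_rv_qform bdd_rv_dotp bdd_rv_lapply bdd_rv_X)

text \<open>Infinitesimal invariance of the law of \<open>X\<close> under the linear vector field \<open>A\<close>.\<close>

definition killing :: "('i \<Rightarrow> 'i \<Rightarrow> real) \<Rightarrow> bool" where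
  "killing A \<longleftrightarrow> (\<forall>Q n. \<forall>k\<in>I. \<forall>l\<in>I. symmetric_on I Q \<longrightarrow>
     expectation (\<lambda>\<omega>. test_deriv I A Q n k l (X \<omega>)) = 0)"

text \<open>\<open>test_deriv\<close> is linear in the field. Infinitesimal invariance therefore
  passes to combinations of generators, including fields for which no flow is written down.\<close>

lemma killing_lincomb:
  assumes "killing A" "killing B"
  shows "killing (\<lambda>i j. a * A i j + b * B i j)"
  using assms unfolding killing_def test_deriv_lincomb
  by (simp add: bdd_rv_integrable bdd_rv_test_deriv)

lemma killing_zero: "killing (\<lambda>i j. 0)"
  unfolding killing_def test_deriv_def by (simp add: lapply_def dotp_def)

lemma killing_sum:
  assumes "finite K" "\<And>k. k \<in> K \<Longrightarrow> killing (A k)"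
  shows "killing (\<lambda>i j. \<Sum>k\<in>K. A k i j)"
  using assms
proof (induction K rule: finite_induct)
  case (insert a K)
  then have "killing (\<lambda>i j. 1 * A a i j + 1 * (\<Sum>k\<in>K. A k i j))"
    by (intro killing_lincomb) auto
  then show ?case using insert.hyps by simp
qed (simp add: killing_zero)

text \<open>Chain rule for the test function \<open>F\<close>: under measure-preserving maps the
  mean of \<open>F (X (\<Phi> t \<omega>))\<close> does not depend on t, so the mean of its
  first-order term vanishes.\<close>

lemma killing_flow:
  assumes meas: "\<And>t. t \<in> {0..1} \<Longrightarrow> \<Phi> t \<in> measurable M M"
    and inv: "\<And>t. t \<in> {0..1} \<Longrightarrow> distr M M (\<Phi> t) = M"
    and fo: "\<And>i. i \<in> I \<Longrightarrow> first_order (space M) (\<lambda>t \<omega>. X (\<Phi> t \<omega>) i) (\<lambda>\<omega>. X \<omega> i)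
      (\<lambda>\<omega>. lapply I A (X \<omega>) i)"
  shows "killing A"
  unfolding killing_def
proof (intro allI ballI impI)
  fix Q n k l
  assume k: "k \<in> I" and l: "l \<in> I" and Q: "symmetric_on I Q"
  have lap: "first_order (space M) (\<lambda>t \<omega>. lapply I Q (X (\<Phi> t \<omega>)) i) (\<lambda>\<omega>. lapply I Q (X \<omega>) i)
      (\<lambda>\<omega>. lapply I Q (lapply I A (X \<omega>)) i)" for i
    unfolding lapply_def[of I Q] by (intro first_order_sum first_order_cmult finite_I fo)
  have "first_order (space M) (\<lambda>t \<omega>. qform I Q (X (\<Phi> t \<omega>))) (\<lambda>\<omega>. qform I Q (X \<omega>))
      (\<lambda>\<omega>. \<Sum>i\<in>I. lapply I A (X \<omega>) i * lapply I Q (X \<omega>) i + X \<omega> i * lapply I Q (lapply I A (X \<omega>)) i)"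
    unfolding qform_def dotp_def by (intro first_order_sum first_order_mult finite_I fo lap)
  moreover have "(\<Sum>i\<in>I. lapply I A x i * lapply I Q x i + x i * lapply I Q (lapply I A x) i)
      = 2 * dotp I (lapply I Q x) (lapply I A x)" for x
    using dotp_lapply_sym[OF Q, of x "lapply I A x"]
    by (simp add: sum.distrib dotp_def mult.commute)
  ultimately have qf: "first_order (space M) (\<lambda>t \<omega>. qform I Q (X (\<Phi> t \<omega>))) (\<lambda>\<omega>. qform I Q (X \<omega>))
      (\<lambda>\<omega>. 2 * dotp I (lapply I Q (X \<omega>)) (lapply I A (X \<omega>)))"
    by simp
  define F where "F x = x k * qform I Q x ^ Suc n * lapply I Q x l" for x
  have F: "first_order (space M) (\<lambda>t \<omega>. F (X (\<Phi> t \<omega>))) (\<lambda>\<omega>. F (X \<omega>))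
      (\<lambda>\<omega>. test_deriv I A Q n k l (X \<omega>))"
    using first_order_mult[OF first_order_mult[OF fo[OF k] first_order_power_Suc[OF qf, of n]] lap[of l]]
    unfolding F_def test_deriv_def by (simp only: distrib_right)
  have FX: "bdd_rv (\<lambda>\<omega>. F (X \<omega>))"
    unfolding F_def using k by (intro bdd_rv_mult bdd_rv_power bdd_rv_qform bdd_rv_lapply bdd_rv_X)
  then have FXm: "(\<lambda>\<omega>. F (X \<omega>)) \<in> borel_measurable M" by (simp add: bdd_rv_def)
  show "expectation (\<lambda>\<omega>. test_deriv I A Q n k l (X \<omega>)) = 0"
  proof (rule expectation_first_order[OF F])
    show "(\<lambda>\<omega>. test_deriv I A Q n k l (X \<omega>)) \<in> borel_measurable M"
      using bdd_rv_test_deriv[OF k] by (simp add: bdd_rv_def)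
    show "(\<lambda>\<omega>. F (X \<omega>)) \<in> borel_measurable M" by fact
    fix t :: real assume t: "t \<in> {0..1}"
    show "(\<lambda>\<omega>. F (X (\<Phi> t \<omega>))) \<in> borel_measurable M"
      using measurable_compose[OF meas[OF t] FXm] .
    have "expectation (\<lambda>\<omega>. F (X \<omega>)) = integral\<^sup>L (distr M M (\<Phi> t)) (\<lambda>\<omega>. F (X \<omega>))"
      by (simp add: inv[OF t])
    also have "\<dots> = expectation (\<lambda>\<omega>. F (X (\<Phi> t \<omega>)))"
      by (rule integral_distr[OF meas[OF t] FXm])
    finally show "expectation (\<lambda>\<omega>. F (X (\<Phi> t \<omega>))) = expectation (\<lambda>\<omega>. F (X \<omega>))" ..
  qed
qed

text \<open>The shape of every flow used later. Up to scaling, a rotation by the angle t adds (cos t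
  - 1) times the projection \<open>Y\<close> onto its plane and sin t times the generator, and cos t
  - 1 = O(t^2), sin t = t + O(t^2).\<close>

lemma killing_rotation:
  assumes "\<And>t. t \<in> {0..1} \<Longrightarrow> \<Phi> t \<in> measurable M M"
    and "\<And>t. t \<in> {0..1} \<Longrightarrow> distr M M (\<Phi> t) = M"
    and C: "C \<ge> 0" "\<And>t. t \<in> {0..1} \<Longrightarrow> \<bar>\<alpha> t\<bar> \<le> C * t\<^sup>2" "\<And>t. t \<in> {0..1} \<Longrightarrow> \<bar>\<beta> t - t\<bar> \<le> C * t\<^sup>2"
    and Y: "\<And>i. i \<in> I \<Longrightarrow> bdd_rv (Y i)"
    and eq: "\<And>t i \<omega>. i \<in> I \<Longrightarrow> \<omega> \<in> space M \<Longrightarrow>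
      X (\<Phi> t \<omega>) i = X \<omega> i + \<alpha> t * Y i \<omega> + \<beta> t * lapply I A (X \<omega>) i"
  shows "killing A"
proof (rule killing_flow[of \<Phi>])
  fix i assume i: "i \<in> I"
  have bdd: "first_order (space M) (\<lambda>t. f) f (\<lambda>_. 0)" if "bdd_rv f" for f
  proof -
    from that obtain B where "\<forall>\<omega>\<in>space M. \<bar>f \<omega>\<bar> \<le> B" unfolding bdd_rv_def by blast
    then show ?thesis by (intro first_order_const[of _ _ B]) simp
  qed
  have "first_order (space M) (\<lambda>t \<omega>. X \<omega> i + \<alpha> t * Y i \<omega> + \<beta> t * lapply I A (X \<omega>) i)
     (\<lambda>\<omega>. X \<omega> i + 0 * Y i \<omega> + 0 * lapply I A (X \<omega>) i)
     (\<lambda>\<omega>. 0 + (0 * Y i \<omega> + 0 * 0) + (1 * lapply I A (X \<omega>) i + 0 * 0))"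
    using C i
    by (intro first_order_add first_order_mult first_order_time[of C] bdd bdd_rv_X Y bdd_rv_lapply) auto
  then have "first_order (space M) (\<lambda>t \<omega>. X \<omega> i + \<alpha> t * Y i \<omega> + \<beta> t * lapply I A (X \<omega>) i)
     (\<lambda>\<omega>. X \<omega> i) (\<lambda>\<omega>. lapply I A (X \<omega>) i)" by simp
  then show "first_order (space M) (\<lambda>t \<omega>. X (\<Phi> t \<omega>) i) (\<lambda>\<omega>. X \<omega> i) (\<lambda>\<omega>. lapply I A (X \<omega>) i)"
    unfolding first_order_def using eq[OF i] by simp
qed (use assms in auto)

text \<open>Integration by parts on the sphere for the vector field \<open>q(x)\<^bsup>n+1\<^esup> Q x\<close>.\<close>

definition stein :: bool where
  "stein \<longleftrightarrow> (\<forall>Q n. symmetric_on I Q \<longrightarrow>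
     (real (card I) + 2 * real (Suc n)) * expectation (\<lambda>\<omega>. qform I Q (X \<omega>) ^ (n + 2)) =
     2 * real (Suc n) * expectation (\<lambda>\<omega>. qform I Q (X \<omega>) ^ n * dotp I (lapply I Q (X \<omega>)) (lapply I Q (X \<omega>)))
     + tr I Q * expectation (\<lambda>\<omega>. qform I Q (X \<omega>) ^ Suc n))"

text \<open>Asks for the mean of the sum, not of each summand: for the unitary group the single
  coordinate rotations are not at hand.\<close>

lemma stein_if_sum_rot:
  assumes "\<And>Q n. symmetric_on I Q \<Longrightarrow>
     expectation (\<lambda>\<omega>. \<Sum>k\<in>I. \<Sum>l\<in>I. test_deriv I (rot_gen (std k) (std l)) Q n k l (X \<omega>)) = 0"
  shows stein
  unfolding stein_def
proof (intro allI impI)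
  fix Q n assume Q: "symmetric_on I Q"
  let ?q = "\<lambda>\<omega>. qform I Q (X \<omega>)"
  let ?y = "\<lambda>\<omega>. dotp I (lapply I Q (X \<omega>)) (lapply I Q (X \<omega>))"
  have int: "integrable M (\<lambda>\<omega>. ?q \<omega> ^ n * ?y \<omega>)" "integrable M (\<lambda>\<omega>. ?q \<omega> ^ Suc n)"
    "integrable M (\<lambda>\<omega>. ?q \<omega> ^ (n + 2))"
    by (auto intro!: bdd_rv_integrable bdd_rv_mult bdd_rv_power bdd_rv_qform bdd_rv_dotp bdd_rv_lapply bdd_rv_X
      simp del: power_Suc)
  have "0 = expectation (\<lambda>\<omega>. \<Sum>k\<in>I. \<Sum>l\<in>I. test_deriv I (rot_gen (std k) (std l)) Q n k l (X \<omega>))"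
    using assms[OF Q] by simp
  also have "\<dots> = expectation (\<lambda>\<omega>. 2 * real (Suc n) * (?q \<omega> ^ n * ?y \<omega>)
      + tr I Q * ?q \<omega> ^ Suc n - (real (card I) + 2 * real (Suc n)) * ?q \<omega> ^ (n + 2))"
    by (intro Bochner_Integration.integral_cong refl)
       (simp only: sum_test_deriv_rot[OF finite_I Q X_unit] mult_ac)
  also have "\<dots> = 2 * real (Suc n) * expectation (\<lambda>\<omega>. ?q \<omega> ^ n * ?y \<omega>)
      + tr I Q * expectation (\<lambda>\<omega>. ?q \<omega> ^ Suc n)
      - (real (card I) + 2 * real (Suc n)) * expectation (\<lambda>\<omega>. ?q \<omega> ^ (n + 2))"
    using int by simp
  finally show "(real (card I) + 2 * real (Suc n)) * expectation (\<lambda>\<omega>. ?q \<omega> ^ (n + 2)) =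
     2 * real (Suc n) * expectation (\<lambda>\<omega>. ?q \<omega> ^ n * ?y \<omega>)
     + tr I Q * expectation (\<lambda>\<omega>. ?q \<omega> ^ Suc n)"
    by linarith
qed

lemma expectation_sum_test_deriv:
  assumes "\<And>k l. k \<in> I \<Longrightarrow> l \<in> I \<Longrightarrow> killing (A k l)" "symmetric_on I Q"
  shows "expectation (\<lambda>\<omega>. \<Sum>k\<in>I. \<Sum>l\<in>I. test_deriv I (A k l) Q n k l (X \<omega>)) = 0"
proof -
  have "expectation (\<lambda>\<omega>. \<Sum>k\<in>I. \<Sum>l\<in>I. test_deriv I (A k l) Q n k l (X \<omega>))
      = (\<Sum>k\<in>I. \<Sum>l\<in>I. expectation (\<lambda>\<omega>. test_deriv I (A k l) Q n k l (X \<omega>)))"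
    by (subst Bochner_Integration.integral_sum)
       (auto intro!: sum.cong Bochner_Integration.integral_sum bdd_rv_integrable bdd_rv_test_deriv
         bdd_rv_sum finite_I)
  then show ?thesis using assms by (simp add: killing_def)
qed

lemma stein_orthogonal:
  assumes "\<And>k l. k \<in> I \<Longrightarrow> l \<in> I \<Longrightarrow> killing (rot_gen (std k) (std l))"
  shows stein
  using assms by (intro stein_if_sum_rot expectation_sum_test_deriv)

text \<open>\<open>\<Omega>\<close> with \<open>(\<Omega> c) i = s (\<sigma> i) * c (\<sigma> i)\<close> is multiplication by \<open>\<i>\<close>, and the generators of the
  unitary group are the rotations in the planes spanned by \<open>c\<close> and \<open>\<Omega> c\<close>. They span the fields
  \<open>rot_gen a b + rot_gen (\<Omega> a) (\<Omega> b)\<close>; the contribution of the second summand to the Stein identity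
  vanishes because it coincides with that of the scalar field \<open>\<Omega>\<close> alone.\<close>

lemma stein_unitary:
  fixes \<sigma> :: "'i \<Rightarrow> 'i" and s :: "'i \<Rightarrow> real"
  assumes \<sigma>: "\<And>k. \<sigma> (\<sigma> k) = k" "\<And>k. \<sigma> k \<in> I \<longleftrightarrow> k \<in> I"
    and s: "\<And>k. s (\<sigma> k) = - s k" "\<And>k. s k * s k = 1"
    and K: "\<And>c. killing (rot_gen c (\<lambda>i. s (\<sigma> i) * c (\<sigma> i)))"
  shows stein
proof -
  \<comment> \<open>With e_k = \<open>std k\<close>, this is \<Omega> e_k, plus or minus the basis
    vector at \<open>\<sigma> k\<close>.\<close>
  define od where "od k i = s (\<sigma> i) * std k (\<sigma> i)" for k i
  have od_eq: "od k i = (if i = \<sigma> k then s k else 0)" for k i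
    unfolding od_def std_def using \<sigma>(1) by auto
  have \<sigma>_ne: "\<sigma> k \<noteq> k" for k
  proof
    assume "\<sigma> k = k"
    then have "s k = 0" using s(1)[of k] by simp
    then show False using s(2)[of k] by simp
  qed
  have bij: "bij_betw \<sigma> I I"
    by (rule bij_betw_byWitness[where f'=\<sigma>]) (use \<sigma> in auto)
  have reindex: "(\<Sum>k\<in>I. g (\<sigma> k)) = (\<Sum>k\<in>I. g k)" for g :: "'i \<Rightarrow> real"
    using sum.reindex_bij_betw[OF bij] .
  have dotp_od: "dotp I (od k) x = s k * x (\<sigma> k)" if "k \<in> I" for k x
  proof -
    have "dotp I (od k) x = (\<Sum>i\<in>I. if i = \<sigma> k then s k * x i else 0)"
      unfolding dotp_def od_eq by (intro sum.cong) auto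
    then show ?thesis using that finite_I \<sigma>(2) by simp
  qed
  have lapply_od: "lapply I Q (od k) l = s k * Q l (\<sigma> k)" if "k \<in> I" for Q k l
    using dotp_od[OF that, of "Q l"] by (simp add: lapply_def dotp_def mult.commute)
  have K1: "killing (rot_gen (std k) (od k))" for k
    using K[of "std k"] unfolding od_def .
  have "(\<lambda>i. s (\<sigma> i) * (std k (\<sigma> i) + od l (\<sigma> i))) = (\<lambda>i. od k i - std l i)" for k l
    unfolding od_def \<sigma>(1) using s by (auto simp: algebra_simps fun_eq_iff simp flip: mult.assoc)
  then have K2: "killing (rot_gen (\<lambda>i. std k i + od l i) (\<lambda>i. od k i - std l i))" for k l
    using K[of "\<lambda>i. std k i + od l i"] by simp
  \<comment> \<open>Polarisation: c = e_k + \<Omega> e_l has \<Omega> c = \<Omega> e_k - e_l, and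
    expanding the alternating form gives rot(c, \<Omega> c) = rot(e_k, \<Omega> e_k) + rot(e_l,
    \<Omega> e_l) - \<open>A k l\<close>.\<close>
  define A where "A k l = (\<lambda>i j. rot_gen (std k) (std l) i j + rot_gen (od k) (od l) i j)" for k l
  have KA: "killing (A k l)" for k l
  proof -
    have "A k l = (\<lambda>i j. 1 * (1 * rot_gen (std k) (od k) i j + 1 * rot_gen (std l) (od l) i j)
      + (-1) * rot_gen (\<lambda>i. std k i + od l i) (\<lambda>i. od k i - std l i) i j)"
      unfolding A_def rot_gen_def by (simp add: fun_eq_iff algebra_simps)
    then show ?thesis by (simp only: killing_lincomb[OF killing_lincomb[OF K1 K1] K2])
  qed
  \<comment> \<open>Each complex coordinate line occurs twice, through either of its two real
    coordinates, so \<open>W\<close> acts as 2 \<Omega>.\<close>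
  define W where "W = (\<lambda>i j. \<Sum>k\<in>I. rot_gen (std k) (od k) i j)"
  have KW: "killing W" unfolding W_def by (intro killing_sum finite_I K1)
  have W: "lapply I W x i = -2 * (s i * x (\<sigma> i))" if "i \<in> I" for x i
  proof -
    have "lapply I W x i = (\<Sum>k\<in>I. lapply I (rot_gen (std k) (od k)) x i)"
      unfolding W_def lapply_def sum_distrib_right by (rule sum.swap)
    also have "\<dots> = (\<Sum>k\<in>I. od k i * x k - std k i * (s k * x (\<sigma> k)))"
      using finite_I by (intro sum.cong refl) (simp add: lapply_rot_gen dotp_std dotp_od)
    also have "\<dots> = (\<Sum>k\<in>I. (if k = \<sigma> i then s k * x k else 0)) - (\<Sum>k\<in>I. if k = i then s k * x (\<sigma> k) else 0)"
      unfolding sum_subtractf[symmetric] using \<sigma>(1) by (intro sum.cong refl) (auto simp: od_eq std_def)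
    also have "\<dots> = s (\<sigma> i) * x (\<sigma> i) - s i * x (\<sigma> i)"
      using finite_I that \<sigma>(2) by simp
    finally show ?thesis by (simp add: s(1))
  qed
  \<comment> \<open>With F(x) = q(x)^(n+1) Qx, the right side is the derivative of <\<Omega> x, F>
    along \<Omega>: the weights \<open>s l\<close> combine the test functions x(\<sigma> l) F_l into
    <p, F> with p = -\<Omega> x, and \<open>W\<close> is 2 \<Omega>. Both sides are evaluated to the
    closed form in \<open>L\<close>.\<close>
  have pointwise: "(\<Sum>k\<in>I. \<Sum>l\<in>I. test_deriv I (rot_gen (od k) (od l)) Q n k l x)
      = (\<Sum>l\<in>I. (- 1 / 2) * s l * test_deriv I W Q n (\<sigma> l) l x)"
    if Q: "symmetric_on I Q" for Q n x
  proof -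
    define y where "y = lapply I Q x"
    define q where "q = qform I Q x"
    define p where "p = (\<lambda>k. s k * x (\<sigma> k))"
    define r where "r = (\<lambda>k. s k * y (\<sigma> k))"
    define N where "N = 2 * real (Suc n)"
    define \<tau> where "\<tau> = (\<Sum>l\<in>I. p l * y l)"
    have xy: "(\<Sum>k\<in>I. x k * y k) = q" by (simp add: q_def y_def qform_def dotp_def)
    \<comment> \<open>\<Omega> is skew, so x and p are orthogonal; reindexing by
      \<open>\<sigma>\<close> reverses the sign of the sum. This removes the two terms of
      \<open>eq\<close> that carry the factor \<open>x k * p k\<close>.\<close>
    have xp: "(\<Sum>k\<in>I. x k * p k) = 0"
    proof -
      have "(\<Sum>k\<in>I. x k * p k) = (\<Sum>k\<in>I. x (\<sigma> k) * p (\<sigma> k))" by (rule reindex[symmetric])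
      also have "\<dots> = - (\<Sum>k\<in>I. x k * p k)"
        by (simp add: p_def \<sigma>(1) s(1) sum_negf mult_ac)
      finally show ?thesis by simp
    qed
    have xr: "(\<Sum>k\<in>I. x k * r k) = - \<tau>"
    proof -
      have "(\<Sum>k\<in>I. x k * r k) = (\<Sum>k\<in>I. x (\<sigma> k) * r (\<sigma> k))" by (rule reindex[symmetric])
      also have "\<dots> = - \<tau>"
        by (simp add: p_def r_def \<tau>_def \<sigma>(1) s(1) sum_negf mult_ac)
      finally show ?thesis .
    qed
    have sx: "(\<Sum>k\<in>I. s k * x k * Q l (\<sigma> k)) = - lapply I Q p l" for l
    proof -
      have "(\<Sum>k\<in>I. s k * x k * Q l (\<sigma> k)) = (\<Sum>k\<in>I. s (\<sigma> k) * x (\<sigma> k) * Q l k)"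
        using reindex[of "\<lambda>k. s k * x k * Q l (\<sigma> k)"] by (simp add: \<sigma>(1))
      then show ?thesis by (simp add: lapply_def p_def s(1) sum_negf mult_ac)
    qed
    have eq: "test_deriv I (rot_gen (od k) (od l)) Q n k l x =
        q ^ Suc n * (p k * od l k * y l)
        + N * q ^ n * ((x k * p k) * (r l * y l)) - N * q ^ n * ((x k * r k) * (p l * y l))
        + q ^ Suc n * ((x k * p k) * (s l * Q l (\<sigma> l))) - (q ^ Suc n) * (p l * (s k * x k * Q l (\<sigma> k)))"
      if k: "k \<in> I" and l: "l \<in> I" for k l
    proof -
      have A: "lapply I (rot_gen (od k) (od l)) x = (\<lambda>i. p k * od l i - p l * od k i)"
        using k l by (simp add: lapply_rot_gen dotp_od fun_eq_iff p_def)
      have d: "dotp I y (\<lambda>i. p k * od l i - p l * od k i) = p k * r l - p l * r k"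
      proof -
        have "dotp I y (\<lambda>i. p k * od l i - p l * od k i) = p k * dotp I (od l) y - p l * dotp I (od k) y"
          by (simp add: dotp_def right_diff_distrib sum_subtractf sum_distrib_left mult_ac)
        then show ?thesis using k l by (simp add: dotp_od r_def)
      qed
      have e: "lapply I Q (\<lambda>i. p k * od l i - p l * od k i) l = p k * (s l * Q l (\<sigma> l)) - p l * (s k * Q l (\<sigma> k))"
      proof -
        have "lapply I Q (\<lambda>i. p k * od l i - p l * od k i) l = p k * lapply I Q (od l) l - p l * lapply I Q (od k) l"
          by (simp add: lapply_def right_diff_distrib sum_subtractf sum_distrib_left mult_ac)
        then show ?thesis using k l by (simp add: lapply_od)
      qed
      have z: "od k k = 0" using \<sigma>_ne[of k] by (simp add: od_eq)
      show ?thesis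
        unfolding test_deriv_def A y_def[symmetric] q_def[symmetric] d e z N_def
        by (simp add: algebra_simps)
    qed
    have s1: "(\<Sum>k\<in>I. \<Sum>l\<in>I. p k * od l k * y l) = - q"
    proof -
      have "(\<Sum>k\<in>I. \<Sum>l\<in>I. p k * od l k * y l) = (\<Sum>l\<in>I. \<Sum>k\<in>I. p k * od l k * y l)"
        by (rule sum.swap)
      also have "\<dots> = (\<Sum>l\<in>I. dotp I (od l) p * y l)"
        unfolding dotp_def sum_distrib_right by (intro sum.cong refl) simp
      also have "\<dots> = (\<Sum>l\<in>I. - (x l * y l))"
        using s by (intro sum.cong refl) (simp add: dotp_od p_def \<sigma>(1) flip: mult.assoc)
      finally show ?thesis by (simp add: sum_negf xy)
    qed
    have s5: "(\<Sum>k\<in>I. \<Sum>l\<in>I. p l * (s k * x k * Q l (\<sigma> k))) = - qform I Q p"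
    proof -
      have "(\<Sum>k\<in>I. \<Sum>l\<in>I. p l * (s k * x k * Q l (\<sigma> k))) = (\<Sum>l\<in>I. \<Sum>k\<in>I. p l * (s k * x k * Q l (\<sigma> k)))"
        by (rule sum.swap)
      also have "\<dots> = (\<Sum>l\<in>I. p l * - lapply I Q p l)"
        by (simp only: sum_distrib_left[symmetric] sx)
      finally show ?thesis by (simp add: qform_def dotp_def sum_negf)
    qed
    have "(\<Sum>k\<in>I. \<Sum>l\<in>I. test_deriv I (rot_gen (od k) (od l)) Q n k l x) =
        q ^ Suc n * (\<Sum>k\<in>I. \<Sum>l\<in>I. p k * od l k * y l)
        + N * q ^ n * (\<Sum>k\<in>I. \<Sum>l\<in>I. (x k * p k) * (r l * y l))
        - N * q ^ n * (\<Sum>k\<in>I. \<Sum>l\<in>I. (x k * r k) * (p l * y l))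
        + q ^ Suc n * (\<Sum>k\<in>I. \<Sum>l\<in>I. (x k * p k) * (s l * Q l (\<sigma> l)))
        - (q ^ Suc n) * (\<Sum>k\<in>I. \<Sum>l\<in>I. p l * (s k * x k * Q l (\<sigma> k)))"
      by (simp only: eq sum.distrib sum_subtractf sum_distrib_left cong: sum.cong)
    also have "\<dots> = - (q ^ Suc n) * q + N * q ^ n * (\<tau> * \<tau>) + q ^ Suc n * qform I Q p"
      unfolding s1 s5 by (simp add: sum_product[symmetric] xp xr \<tau>_def[symmetric])
    finally have L: "(\<Sum>k\<in>I. \<Sum>l\<in>I. test_deriv I (rot_gen (od k) (od l)) Q n k l x)
      = - (q ^ Suc n) * q + N * q ^ n * (\<tau> * \<tau>) + q ^ Suc n * qform I Q p" .
    have eq': "(- 1 / 2) * s l * test_deriv I W Q n (\<sigma> l) l x =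
        - (q ^ Suc n) * (x l * y l) + N * q ^ n * \<tau> * (p l * y l) + q ^ Suc n * (p l * lapply I Q p l)"
      if l: "l \<in> I" for l
    proof -
      have a: "lapply I W x (\<sigma> l) = 2 * (s l * x l)"
        using W[of "\<sigma> l" x] l \<sigma> s(1)[of l] by simp
      have d: "dotp I y (lapply I W x) = -2 * \<tau>"
      proof -
        have "dotp I y (lapply I W x) = (\<Sum>k\<in>I. -2 * (p k * y k))"
          unfolding dotp_def by (intro sum.cong refl) (simp add: W p_def)
        then show ?thesis by (simp only: sum_distrib_left[symmetric] \<tau>_def)
      qed
      have e: "lapply I Q (lapply I W x) l = -2 * lapply I Q p l"
      proof -
        have "lapply I Q (lapply I W x) l = (\<Sum>k\<in>I. -2 * (Q l k * p k))"
          unfolding lapply_def[of I Q] by (intro sum.cong refl) (simp add: W p_def)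
        then show ?thesis by (simp only: sum_distrib_left[symmetric] lapply_def)
      qed
      have "(- 1 / 2) * s l * test_deriv I W Q n (\<sigma> l) l x =
        - (s l * s l) * q ^ Suc n * (x l * y l) + N * q ^ n * \<tau> * (p l * y l) + q ^ Suc n * (p l * lapply I Q p l)"
        unfolding test_deriv_def a y_def[symmetric] q_def[symmetric] d e N_def p_def
        by (simp add: algebra_simps)
      then show ?thesis by (simp add: s(2))
    qed
    have "(\<Sum>l\<in>I. (- 1 / 2) * s l * test_deriv I W Q n (\<sigma> l) l x) =
       - (q ^ Suc n) * (\<Sum>l\<in>I. x l * y l) + N * q ^ n * \<tau> * (\<Sum>l\<in>I. p l * y l)
       + q ^ Suc n * (\<Sum>l\<in>I. p l * lapply I Q p l)"
      by (simp only: eq' sum.distrib sum_distrib_left cong: sum.cong)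
    also have "\<dots> = - (q ^ Suc n) * q + N * q ^ n * (\<tau> * \<tau>) + q ^ Suc n * qform I Q p"
      by (simp only: xy \<tau>_def[symmetric] qform_def dotp_def mult.assoc)
    finally show ?thesis using L by simp
  qed
  show stein
  proof (rule stein_if_sum_rot)
    fix Q n assume Q: "symmetric_on I Q"
    let ?od = "\<lambda>\<omega>. \<Sum>k\<in>I. \<Sum>l\<in>I. test_deriv I (rot_gen (od k) (od l)) Q n k l (X \<omega>)"
    let ?rot = "\<lambda>\<omega>. \<Sum>k\<in>I. \<Sum>l\<in>I. test_deriv I (rot_gen (std k) (std l)) Q n k l (X \<omega>)"
    have od0: "expectation ?od = 0"
    proof -
      have "expectation ?od = expectation (\<lambda>\<omega>. \<Sum>l\<in>I. (- 1 / 2) * s l * test_deriv I W Q n (\<sigma> l) l (X \<omega>))"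
        by (simp only: pointwise[OF Q])
      also have "\<dots> = (\<Sum>l\<in>I. expectation (\<lambda>\<omega>. (- 1 / 2) * s l * test_deriv I W Q n (\<sigma> l) l (X \<omega>)))"
        using \<sigma>(2) by (intro Bochner_Integration.integral_sum bdd_rv_integrable bdd_rv_mult bdd_rv_const bdd_rv_test_deriv) auto
      also have "\<dots> = (\<Sum>l\<in>I. (- 1 / 2) * s l * expectation (\<lambda>\<omega>. test_deriv I W Q n (\<sigma> l) l (X \<omega>)))"
        by (simp only: integral_mult_right_zero)
      also have "\<dots> = 0"
        using KW Q \<sigma>(2) unfolding killing_def by (intro sum.neutral) auto
      finally show ?thesis .
    qed
    have "0 = expectation (\<lambda>\<omega>. \<Sum>k\<in>I. \<Sum>l\<in>I. test_deriv I (A k l) Q n k l (X \<omega>))"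
      using expectation_sum_test_deriv[OF KA Q] by simp
    also have "\<dots> = expectation (\<lambda>\<omega>. ?rot \<omega> + ?od \<omega>)"
      using test_deriv_lincomb[of I 1 "rot_gen (std _) (std _)" 1 "rot_gen (od _) (od _)" Q n]
      by (simp add: A_def sum.distrib)
    also have "\<dots> = expectation ?rot + expectation ?od"
      by (intro Bochner_Integration.integral_add bdd_rv_integrable bdd_rv_sum finite_I bdd_rv_test_deriv)
    finally show "expectation ?rot = 0" using od0 by simp
  qed
qed

end

section \<open>Moments and tails of traceless quadratic forms\<close>

definition mat_sq :: "'i set \<Rightarrow> ('i \<Rightarrow> 'i \<Rightarrow> real) \<Rightarrow> 'i \<Rightarrow> 'i \<Rightarrow> real" where
  "mat_sq I Q i j = (\<Sum>m\<in>I. Q i m * Q m j)"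

definition centre :: "'i set \<Rightarrow> ('i \<Rightarrow> 'i \<Rightarrow> real) \<Rightarrow> 'i \<Rightarrow> 'i \<Rightarrow> real" where
  "centre I Q i j = Q i j - tr I Q / real (card I) * std i j"

lemma symmetric_mat_sq: "symmetric_on I Q \<Longrightarrow> symmetric_on I (mat_sq I Q)"
  unfolding symmetric_on_def mat_sq_def by (auto intro!: sum.cong)

lemma symmetric_centre: "symmetric_on I Q \<Longrightarrow> symmetric_on I (centre I Q)"
  unfolding symmetric_on_def centre_def std_def by auto

lemma tr_mat_sq: "symmetric_on I Q \<Longrightarrow> tr I (mat_sq I Q) = frob2 I Q"
  unfolding symmetric_on_def mat_sq_def tr_def frob2_def
  by (auto intro!: sum.cong simp: power2_eq_square)

text \<open>The entries of Q^2 are inner products of rows of Q, so Cauchy-Schwarz applies entry by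
  entry. Together with \<open>frob2_centre\<close> this keeps the class of forms stable under Q ->
  Q^2 minus its trace part.\<close>

lemma frob2_mat_sq:
  assumes "symmetric_on I Q"
  shows "frob2 I (mat_sq I Q) \<le> (frob2 I Q)\<^sup>2"
proof -
  have "frob2 I (mat_sq I Q) = (\<Sum>i\<in>I. \<Sum>j\<in>I. (dotp I (Q i) (Q j))\<^sup>2)"
    unfolding frob2_def mat_sq_def dotp_def
    using assms by (intro sum.cong refl) (simp add: symmetric_on_def)
  also have "\<dots> \<le> (\<Sum>i\<in>I. \<Sum>j\<in>I. dotp I (Q i) (Q i) * dotp I (Q j) (Q j))"
    by (intro sum_mono dotp_cauchy_schwarz)
  also have "\<dots> = (frob2 I Q)\<^sup>2"
    unfolding sum_product[symmetric] by (simp add: frob2_def dotp_def power2_eq_square)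
  finally show ?thesis .
qed

lemma qform_mat_sq:
  assumes "symmetric_on I Q"
  shows "qform I (mat_sq I Q) x = dotp I (lapply I Q x) (lapply I Q x)"
proof -
  have "lapply I (mat_sq I Q) x i = lapply I Q (lapply I Q x) i" for i
  proof -
    have "lapply I (mat_sq I Q) x i = (\<Sum>j\<in>I. \<Sum>m\<in>I. Q i m * (Q m j * x j))"
      by (simp add: lapply_def mat_sq_def sum_distrib_right mult.assoc)
    also have "\<dots> = (\<Sum>m\<in>I. \<Sum>j\<in>I. Q i m * (Q m j * x j))" by (rule sum.swap)
    finally show ?thesis by (simp add: lapply_def sum_distrib_left)
  qed
  then have "qform I (mat_sq I Q) x = dotp I x (lapply I Q (lapply I Q x))"
    by (simp add: qform_def dotp_def)
  then show ?thesis using dotp_lapply_sym[OF assms, of x "lapply I Q x"] by simp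
qed

lemma sum_std:
  assumes "finite I" "i \<in> I"
  shows "(\<Sum>j\<in>I. std i j * f j) = f i"
  using dotp_std[OF assms, of f] by (simp add: dotp_def)

lemma std_same: "std i i = 1"
  by (simp add: std_def)

context
  fixes I :: "'i set"
  assumes fin: "finite I" and ne: "I \<noteq> {}"
begin

lemma tr_centre: "tr I (centre I Q) = 0"
  using fin ne by (simp add: tr_def centre_def sum_subtractf std_same)

text \<open>Removing the trace part is an orthogonal projection for the Frobenius product; it lowers
  the squared norm by \<open>card I\<close> times c^2.\<close>

lemma frob2_centre: "frob2 I (centre I Q) \<le> frob2 I Q"
proof -
  define c where "c = tr I Q / real (card I)"
  have "frob2 I (centre I Q) = (\<Sum>i\<in>I. \<Sum>j\<in>I. (Q i j)\<^sup>2 - std i j * (2 * c * Q i j) + std i j * c\<^sup>2)"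
    unfolding frob2_def centre_def c_def[symmetric]
    by (intro sum.cong refl) (auto simp: std_def power2_eq_square algebra_simps)
  also have "\<dots> = frob2 I Q - (\<Sum>i\<in>I. 2 * c * Q i i) + (\<Sum>i\<in>I. c\<^sup>2)"
    using fin by (simp add: sum.distrib sum_subtractf frob2_def sum_std cong: sum.cong)
  also have "\<dots> = frob2 I Q - real (card I) * c\<^sup>2"
  proof -
    have "(\<Sum>i\<in>I. 2 * c * Q i i) = 2 * c * (real (card I) * c)"
      using fin ne unfolding sum_distrib_left[symmetric] tr_def[symmetric] by (simp add: c_def)
    then show ?thesis by (simp add: power2_eq_square algebra_simps)
  qed
  finally show ?thesis by simp
qed

lemma qform_centre:
  assumes "dotp I x x = 1"
  shows "qform I (centre I Q) x = qform I Q x - tr I Q / real (card I)"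
proof -
  define c where "c = tr I Q / real (card I)"
  have "lapply I (centre I Q) x i = lapply I Q x i - c * x i" if "i \<in> I" for i
  proof -
    have "lapply I (centre I Q) x i = (\<Sum>j\<in>I. Q i j * x j) - (\<Sum>j\<in>I. std i j * (c * x j))"
      unfolding lapply_def centre_def c_def[symmetric] sum_subtractf[symmetric]
      by (intro sum.cong refl) (simp add: algebra_simps)
    then show ?thesis using fin that by (simp add: sum_std lapply_def)
  qed
  then have "qform I (centre I Q) x = (\<Sum>i\<in>I. x i * (lapply I Q x i - c * x i))"
    by (simp add: qform_def dotp_def)
  also have "\<dots> = qform I Q x - c * dotp I x x"
    by (simp add: qform_def dotp_def sum_subtractf sum_distrib_left algebra_simps)
  finally show ?thesis using assms by (simp add: c_def)
qed

end

text \<open>The product is at most the (k+1)-st power of the larger of a and b. It separates the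
  mixed moment that arises in \<open>moment_step\<close>.\<close>

lemma power_mult_le_sum_power:
  fixes a b :: real
  assumes "a \<ge> 0" "b \<ge> 0"
  shows "a ^ k * b \<le> a ^ Suc k + b ^ Suc k"
proof (cases "a \<le> b")
  case True
  then have "a ^ k * b \<le> b ^ k * b" using assms by (intro mult_right_mono power_mono) auto
  then show ?thesis using assms by (simp add: mult.commute add_increasing)
next
  case False
  then have "a ^ k * b \<le> a ^ k * a" using assms by (intro mult_left_mono) auto
  then show ?thesis using assms by (simp add: mult.commute add_increasing2)
qed

context random_unit_vector
begin

definition unit_class :: "('i \<Rightarrow> 'i \<Rightarrow> real) \<Rightarrow> bool" where
  "unit_class Q \<longleftrightarrow> symmetric_on I Q \<and> tr I Q = 0 \<and> frob2 I Q \<le> 1"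

lemma qform_moment_le_1:
  assumes "unit_class Q"
  shows "expectation (\<lambda>\<omega>. qform I Q (X \<omega>) ^ (2 * k)) \<le> 1"
proof -
  have "qform I Q (X \<omega>) ^ (2 * k) \<le> 1" if "\<omega> \<in> space M" for \<omega>
  proof -
    have "(qform I Q (X \<omega>))\<^sup>2 \<le> 1"
      using qform_sq_le[OF X_unit[OF that], of Q] assms by (simp add: unit_class_def)
    then have "((qform I Q (X \<omega>))\<^sup>2) ^ k \<le> 1" by (rule power_le_one[OF zero_le_power2])
    then show ?thesis by (simp only: power_mult)
  qed
  then have "expectation (\<lambda>\<omega>. qform I Q (X \<omega>) ^ (2 * k)) \<le> expectation (\<lambda>_. 1)"
    by (intro integral_mono bdd_rv_integrable bdd_rv_power bdd_rv_qform bdd_rv_const) auto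
  then show ?thesis by (simp add: prob_space)
qed

text \<open>\<open>\<bar>Q x\<bar>\<^sup>2\<close> is, up to its mean, again a quadratic form of the same class. So the Stein identity
  bounds a moment by a lower moment plus half of any bound \<open>L\<close> valid for the same moment over the
  whole class; iterating this from \<open>L = 1\<close> removes the second term.\<close>

lemma moment_step:
  assumes stein and T: "\<And>Q. unit_class Q \<Longrightarrow> expectation (\<lambda>\<omega>. qform I Q (X \<omega>) ^ (2 * k)) \<le> T"
    and L: "\<And>Q. unit_class Q \<Longrightarrow> expectation (\<lambda>\<omega>. qform I Q (X \<omega>) ^ (2 * Suc k)) \<le> L"
    and Q: "unit_class Q"
    and a: "a = 2 * real (Suc (2 * k)) / real (card I)"
  shows "expectation (\<lambda>\<omega>. qform I Q (X \<omega>) ^ (2 * Suc k)) \<le> a * (1 / real (card I) + a) * T + L / 2"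
proof -
  define D where "D = real (card I)"
  have D: "D > 0" using finite_I I_nonempty by (simp add: D_def card_gt_0_iff)
  have a0: "a > 0" unfolding a D_def[symmetric] using D by (intro divide_pos_pos) auto
  define P where "P = centre I (mat_sq I Q)"
  have sym: "symmetric_on I Q" and frob: "frob2 I Q \<le> 1" and tr0: "tr I Q = 0"
    using Q by (auto simp: unit_class_def)
  have frob0: "frob2 I Q \<ge> 0" by (simp add: frob2_def sum_nonneg)
  have "(frob2 I Q)\<^sup>2 \<le> 1" using frob frob0 by (simp add: power_le_one)
  then have P: "unit_class P"
    unfolding unit_class_def P_def
    using frob2_mat_sq[OF sym] frob2_centre[OF finite_I I_nonempty, of "mat_sq I Q"]
    by (auto simp: tr_centre[OF finite_I I_nonempty] symmetric_centre symmetric_mat_sq sym)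
  let ?q = "\<lambda>\<omega>. qform I Q (X \<omega>)" and ?p = "\<lambda>\<omega>. qform I P (X \<omega>)"
  let ?y = "\<lambda>\<omega>. dotp I (lapply I Q (X \<omega>)) (lapply I Q (X \<omega>))"
  let ?b = "\<lambda>\<omega>. (1 / D + a) * ?q \<omega> ^ (2 * k) + 1 / (4 * a) * ?q \<omega> ^ (2 * Suc k) + 1 / (4 * a) * ?p \<omega> ^ (2 * Suc k)"
  have pw: "?q \<omega> ^ (2 * k) * ?y \<omega> \<le> ?b \<omega>" if \<omega>: "\<omega> \<in> space M" for \<omega>
  proof -
    have "?y \<omega> = ?p \<omega> + frob2 I Q / D"
      using qform_centre[OF finite_I I_nonempty X_unit[OF \<omega>], of "mat_sq I Q"]
      by (simp add: P_def qform_mat_sq[OF sym] tr_mat_sq[OF sym] D_def)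
    also have "\<dots> \<le> \<bar>?p \<omega>\<bar> + 1 / D"
      using frob D by (intro add_mono divide_right_mono) auto
    \<comment> \<open>AM-GM with its weight chosen so that, after multiplication by
      \<open>a\<close>, the moments of \<open>?q\<close> and \<open>?p\<close> each keep the factor
      1/4; together they give L / 2.\<close>
    also have "\<bar>?p \<omega>\<bar> \<le> a + (?p \<omega>)\<^sup>2 / (4 * a)"
    proof -
      have "0 \<le> (\<bar>?p \<omega>\<bar> - 2 * a)\<^sup>2" by simp
      then have "\<bar>?p \<omega>\<bar> * (4 * a) \<le> 4 * a * a + (?p \<omega>)\<^sup>2"
        by (simp add: power2_diff power2_eq_square algebra_simps)
      then show ?thesis using a0 by (simp add: field_simps)
    qed
    finally have y: "?y \<omega> \<le> 1 / D + a + (?p \<omega>)\<^sup>2 / (4 * a)" by simp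
    have q0: "?q \<omega> ^ (2 * k) \<ge> 0" by (simp add: power_mult)
    have "?q \<omega> ^ (2 * k) * ?y \<omega> \<le> ?q \<omega> ^ (2 * k) * (1 / D + a + (?p \<omega>)\<^sup>2 / (4 * a))"
      by (rule mult_left_mono[OF y q0])
    also have "\<dots> = (1 / D + a) * ?q \<omega> ^ (2 * k) + 1 / (4 * a) * (((?q \<omega>)\<^sup>2) ^ k * (?p \<omega>)\<^sup>2)"
    proof -
      have "?q \<omega> ^ (2 * k) = ((?q \<omega>)\<^sup>2) ^ k" by (rule power_mult)
      then show ?thesis by (simp only: distrib_left times_divide_eq_right mult_1 mult_1_right
        times_divide_eq_left mult.commute)
    qed
    also have "\<dots> \<le> (1 / D + a) * ?q \<omega> ^ (2 * k)
        + 1 / (4 * a) * (((?q \<omega>)\<^sup>2) ^ Suc k + ((?p \<omega>)\<^sup>2) ^ Suc k)"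
      using a0 by (intro add_left_mono mult_left_mono power_mult_le_sum_power) auto
    also have "\<dots> = ?b \<omega>"
      unfolding power_mult[symmetric] by (simp only: distrib_left add.assoc)
    finally show ?thesis .
  qed
  note bdd = bdd_rv_add bdd_rv_mult bdd_rv_const bdd_rv_power bdd_rv_qform bdd_rv_dotp bdd_rv_lapply bdd_rv_X
  have nonneg: "expectation (\<lambda>\<omega>. ?q \<omega> ^ (2 * Suc k)) \<ge> 0"
    by (intro integral_nonneg_AE AE_I2) (simp only: power_mult, simp)
  \<comment> \<open>Even moments are nonnegative, so the factor D + 2(2k + 1) of the Stein identity
    may be lowered to D.\<close>
  have "D * expectation (\<lambda>\<omega>. ?q \<omega> ^ (2 * Suc k))
      \<le> (D + 2 * real (Suc (2 * k))) * expectation (\<lambda>\<omega>. ?q \<omega> ^ (2 * Suc k))"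
    using nonneg by (intro mult_right_mono) auto
  also have "\<dots> = 2 * real (Suc (2 * k)) * expectation (\<lambda>\<omega>. ?q \<omega> ^ (2 * k) * ?y \<omega>)"
  proof -
    have "2 * k + 2 = 2 * Suc k" by simp
    then show ?thesis
      using \<open>stein\<close>[unfolded stein_def, rule_format, OF sym, of "2 * k"] tr0
      unfolding D_def by (simp only: mult_zero_left add_0_right)
  qed
  finally have "expectation (\<lambda>\<omega>. ?q \<omega> ^ (2 * Suc k)) \<le> a * expectation (\<lambda>\<omega>. ?q \<omega> ^ (2 * k) * ?y \<omega>)"
    using D unfolding a D_def[symmetric] by (simp add: field_simps)
  also have "\<dots> \<le> a * expectation ?b"
    using a0 pw by (intro mult_left_mono integral_mono bdd_rv_integrable bdd) auto
  also have "expectation ?b = (1 / D + a) * expectation (\<lambda>\<omega>. ?q \<omega> ^ (2 * k))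
      + 1 / (4 * a) * expectation (\<lambda>\<omega>. ?q \<omega> ^ (2 * Suc k)) + 1 / (4 * a) * expectation (\<lambda>\<omega>. ?p \<omega> ^ (2 * Suc k))"
  proof -
    have "integrable M (\<lambda>\<omega>. qform I Q (X \<omega>) ^ n)" for Q n
      by (intro bdd_rv_integrable bdd)
    then show ?thesis by (simp del: power_Suc mult_Suc_right)
  qed
  also have "a * \<dots> \<le> a * ((1 / D + a) * T + 1 / (4 * a) * L + 1 / (4 * a) * L)"
    using a0 D T[OF Q] L[OF Q] L[OF P]
    by (intro mult_left_mono add_mono) auto
  also have "\<dots> = a * (1 / D + a) * T + L / 2"
    using a0 by (simp add: field_simps)
  finally show ?thesis by (simp add: D_def)
qed

lemma moment_bound:
  assumes stein and "unit_class Q"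
  shows "expectation (\<lambda>\<omega>. qform I Q (X \<omega>) ^ (2 * k)) \<le> fact (2 * k) * (3 / real (card I)) ^ (2 * k)"
  using assms(2)
proof (induction k arbitrary: Q)
  case 0
  then show ?case by (simp add: prob_space)
next
  case (Suc k)
  define D where "D = real (card I)"
  have D: "D > 0" using finite_I I_nonempty by (simp add: D_def card_gt_0_iff)
  define T where "T = (fact (2 * k) * (3 / D) ^ (2 * k) :: real)"
  have T0: "T \<ge> 0" using D by (simp add: T_def)
  have IHk: "expectation (\<lambda>\<omega>. qform I Q (X \<omega>) ^ (2 * k)) \<le> T" if "unit_class Q" for Q
    using Suc.IH[OF that] by (simp add: T_def D_def)
  define a where "a = 2 * real (Suc (2 * k)) / D"
  define W where "W = a * (1 / D + a) * T"
  \<comment> \<open>One round turns a bound L for the whole class into W + L / 2, whose fixed point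
    is 2 W. Starting from 2 W + 1, which exceeds the trivial bound 1, the slack halves each
    time.\<close>
  have iter: "expectation (\<lambda>\<omega>. qform I Q (X \<omega>) ^ (2 * Suc k)) \<le> 2 * W + (1 / 2) ^ n"
    if "unit_class Q" for Q n
    using that
  proof (induction n arbitrary: Q)
    case 0
    have "W \<ge> 0" unfolding W_def a_def using D T0 by simp
    then show ?case using qform_moment_le_1[OF 0, of "Suc k"] by simp
  next
    case (Suc n)
    have "expectation (\<lambda>\<omega>. qform I Q (X \<omega>) ^ (2 * Suc k))
        \<le> a * (1 / real (card I) + a) * T + (2 * W + (1 / 2) ^ n) / 2"
      by (rule moment_step[OF \<open>stein\<close>]) (fact IHk Suc.IH Suc.prems a_def[unfolded D_def])+
    then have "expectation (\<lambda>\<omega>. qform I Q (X \<omega>) ^ (2 * Suc k)) \<le> W + (2 * W + (1 / 2) ^ n) / 2"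
      by (simp only: W_def D_def)
    also have "W + (2 * W + (1 / 2) ^ n) / 2 = 2 * W + (1 / 2) ^ Suc n" by simp
    finally show ?case .
  qed
  have lim: "(\<lambda>n. 2 * W + (1 / 2 :: real) ^ n) \<longlonglongrightarrow> 2 * W + 0"
    by (intro tendsto_intros LIMSEQ_power_zero) auto
  have "expectation (\<lambda>\<omega>. qform I Q (X \<omega>) ^ (2 * Suc k)) \<le> 2 * W"
    using LIMSEQ_le_const[OF lim] iter[OF Suc.prems] by simp
  also have "2 * W = 4 * real (Suc (2 * k)) * real (4 * k + 3) / D\<^sup>2 * T"
    using D by (simp add: W_def a_def power2_eq_square field_simps)
  \<comment> \<open>Uses 4(4k + 3) <= 9(2k + 2). The quotient of 16k + 12 by 2k + 2 stays below 8
    and tends to it, and 3 is the least integer whose square is at least 8.\<close>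
  also have "\<dots> \<le> 9 * real (Suc (2 * k)) * real (2 * k + 2) / D\<^sup>2 * T"
  proof -
    have "real (Suc (2 * k)) * (4 * real (4 * k + 3)) \<le> real (Suc (2 * k)) * (9 * real (2 * k + 2))"
      by (intro mult_left_mono) auto
    then have "4 * real (Suc (2 * k)) * real (4 * k + 3) \<le> 9 * real (Suc (2 * k)) * real (2 * k + 2)"
      by (simp only: mult.left_commute mult.assoc)
    then show ?thesis using T0 by (intro mult_right_mono divide_right_mono) auto
  qed
  also have "\<dots> = fact (2 * Suc k) * (3 / D) ^ (2 * Suc k)"
    using D by (simp add: T_def power2_eq_square field_simps)
  finally show ?case by (simp add: D_def)
qed

text \<open>Markov's inequality for the moment of order 2k with k about s / 12; division by
  \<open>B\<close> brings the centred form into \<open>unit_class\<close>.\<close>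

lemma qform_tail:
  assumes stein and Q: "symmetric_on I Q" and B: "frob2 I Q \<le> B\<^sup>2" "B > 0" and s: "s > 0"
  shows "prob {\<omega> \<in> space M. \<bar>qform I Q (X \<omega>) - tr I Q / real (card I)\<bar> > s * B / real (card I)}
    \<le> 3 * exp (- (s / 12))"
proof -
  define D where "D = real (card I)"
  have D: "D > 0" using finite_I I_nonempty by (simp add: D_def card_gt_0_iff)
  define P where "P = (\<lambda>i j. centre I Q i j / B)"
  have qP: "qform I P x = qform I (centre I Q) x / B" for x
    unfolding qform_def dotp_def lapply_def P_def
    by (simp add: sum_divide_distrib sum_distrib_left)
  have "frob2 I P = frob2 I (centre I Q) / B\<^sup>2"
    by (simp add: frob2_def P_def power_divide sum_divide_distrib)
  also have "\<dots> \<le> 1"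
    using frob2_centre[OF finite_I I_nonempty, of Q] B by simp
  finally have P: "unit_class P"
    unfolding unit_class_def
    using symmetric_centre[OF Q] tr_centre[OF finite_I I_nonempty, of Q]
    by (simp add: P_def symmetric_on_def tr_def sum_divide_distrib[symmetric])
  \<comment> \<open>The largest k with 6k / s <= 1/2. Then (2k)! (3/s)^(2k) <= (6k/s)^(2k) <= 4^(-k)
    <= e^(-k). Rounding down costs a factor e <= 3, which also covers k = 0.\<close>
  define k where "k = nat \<lfloor>s / 12\<rfloor>"
  have k: "real k \<le> s / 12" "s / 12 < real k + 1"
    using s unfolding k_def by linarith+
  let ?q = "\<lambda>\<omega>. qform I P (X \<omega>)"
  let ?E = "{\<omega> \<in> space M. \<bar>qform I Q (X \<omega>) - tr I Q / real (card I)\<bar> > s * B / real (card I)}"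
  have bq: "bdd_rv (\<lambda>\<omega>. ?q \<omega> ^ (2 * k))" by (intro bdd_rv_power bdd_rv_qform)
  have sub: "?E \<subseteq> {\<omega> \<in> space M. ?q \<omega> ^ (2 * k) \<ge> (s / D) ^ (2 * k)}"
  proof safe
    fix \<omega> assume \<omega>: "\<omega> \<in> space M"
      and gt: "\<bar>qform I Q (X \<omega>) - tr I Q / real (card I)\<bar> > s * B / real (card I)"
    have "?q \<omega> = (qform I Q (X \<omega>) - tr I Q / D) / B"
      unfolding qP using qform_centre[OF finite_I I_nonempty X_unit[OF \<omega>], of Q] by (simp add: D_def)
    then have "\<bar>?q \<omega>\<bar> = \<bar>qform I Q (X \<omega>) - tr I Q / D\<bar> / B" using B by simp
    also have "\<dots> \<ge> (s * B / D) / B"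
      using gt B by (intro divide_right_mono) (auto simp: D_def)
    finally have "s / D \<le> \<bar>?q \<omega>\<bar>" using B by simp
    then have "(s / D) ^ (2 * k) \<le> \<bar>?q \<omega>\<bar> ^ (2 * k)"
      using s D by (intro power_mono) auto
    then show "(s / D) ^ (2 * k) \<le> ?q \<omega> ^ (2 * k)" by (simp add: power_mult)
  qed
  have sD: "(s / D) ^ (2 * k) > 0" using s D by simp
  have meas: "(\<lambda>\<omega>. ?q \<omega> ^ (2 * k)) \<in> borel_measurable M" using bq by (simp add: bdd_rv_def)
  have "prob ?E \<le> prob {\<omega> \<in> space M. ?q \<omega> ^ (2 * k) \<ge> (s / D) ^ (2 * k)}"
    using sub meas by (intro finite_measure_mono) auto
  also have "\<dots> \<le> expectation (\<lambda>\<omega>. ?q \<omega> ^ (2 * k)) / (s / D) ^ (2 * k)"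
    using bdd_rv_integrable[OF bq] sD
    by (intro integral_Markov_inequality_measure[where A="{}"]) (auto simp: power_mult)
  also have "\<dots> \<le> fact (2 * k) * (3 / D) ^ (2 * k) / (s / D) ^ (2 * k)"
    using moment_bound[OF \<open>stein\<close> P, of k] sD by (intro divide_right_mono) (auto simp: D_def)
  also have "\<dots> = fact (2 * k) * (3 / s) ^ (2 * k)"
    using D s by (simp add: power_divide)
  also have "\<dots> \<le> real ((2 * k) ^ (2 * k)) * (3 / s) ^ (2 * k)"
    using s by (intro mult_right_mono fact_le_power) auto
  also have "\<dots> = (real (2 * k) * (3 / s)) ^ (2 * k)"
    by (simp only: power_mult_distrib[of "real (2 * k)"] of_nat_power)
  also have "\<dots> \<le> (1 / 2) ^ (2 * k)"
    using k s by (intro power_mono) (auto simp: field_simps)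
  also have "\<dots> = (1 / 4) ^ k" by (simp add: power_mult power2_eq_square)
  also have "\<dots> \<le> exp (- 1) ^ k"
  proof (intro power_mono)
    have "exp (1::real) \<le> 4" using exp_le by simp
    then show "1 / 4 \<le> exp (- 1 :: real)" by (simp add: exp_minus field_simps)
  qed auto
  also have "\<dots> = exp (- real k)" using exp_of_nat_mult[of k "- 1 :: real"] by simp
  also have "\<dots> \<le> exp (1 + - (s / 12))" using k by simp
  also have "\<dots> \<le> 3 * exp (- (s / 12))"
    unfolding exp_add using exp_le by (intro mult_right_mono) auto
  finally show ?thesis .
qed

end

section \<open>Unitary representations and Schur orthogonality\<close>

unbundle no vec_syntax

section \<open>Hermitian product and adjoint in coordinates\<close>

lemma cscalar_prod_sum:
  fixes x y :: "complex vec"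
  assumes "y \<in> carrier_vec n"
  shows "x \<bullet>c y = (\<Sum>i<n. x $ i * cnj (y $ i))"
  using assms by (auto simp: scalar_prod_def lessThan_atLeast0 intro!: sum.cong)

lemma cscalar_prod_self:
  fixes x :: "complex vec"
  assumes "x \<in> carrier_vec n"
  shows "x \<bullet>c x = of_real (\<Sum>i<n. (cmod (x $ i))\<^sup>2)"
  by (simp add: cscalar_prod_sum[OF assms] complex_norm_square del: of_real_power)

lemma cscalar_prod_cnj:
  fixes x y :: "complex vec"
  assumes "x \<in> carrier_vec n" "y \<in> carrier_vec n"
  shows "cnj (x \<bullet>c y) = y \<bullet>c x"
  by (simp add: cscalar_prod_sum[OF assms(1)] cscalar_prod_sum[OF assms(2)] mult.commute)

lemma mult_mat_vec_sum:
  assumes "A \<in> carrier_mat n m" "x \<in> carrier_vec m" "i < n"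
  shows "(A *\<^sub>v x) $ i = (\<Sum>j<m. A $$ (i, j) * x $ j)"
  using assms by (auto simp: scalar_prod_def lessThan_atLeast0 intro!: sum.cong)

lemma mult_mat_sum:
  assumes "A \<in> carrier_mat n m" "B \<in> carrier_mat m k" "i < n" "j < k"
  shows "(A * B) $$ (i, j) = (\<Sum>l<m. A $$ (i, l) * B $$ (l, j))"
  using assms by (auto simp: scalar_prod_def lessThan_atLeast0 intro!: sum.cong)

lemma mat_adjoint_carrier: "A \<in> carrier_mat n m \<Longrightarrow> mat_adjoint A \<in> carrier_mat m n"
  unfolding mat_adjoint_def by (auto simp: mat_of_rows_def)

lemma mat_adjoint_index:
  fixes A :: "complex mat"
  assumes "A \<in> carrier_mat n m" "i < m" "j < n"
  shows "mat_adjoint A $$ (i, j) = cnj (A $$ (j, i))"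
  using assms unfolding mat_adjoint_def by (auto simp: mat_of_rows_def)

lemma mat_adjoint_mult:
  fixes A B :: "complex mat"
  assumes A: "A \<in> carrier_mat n m" and B: "B \<in> carrier_mat m k"
  shows "mat_adjoint (A * B) = mat_adjoint B * mat_adjoint A"
proof (rule eq_matI)
  note [simp] = mat_adjoint_carrier[OF A] mat_adjoint_carrier[OF B] A B
  have AB: "A * B \<in> carrier_mat n k" using A B by (rule mult_carrier_mat)
  note adj = mat_adjoint_carrier[OF AB]
  have BA: "mat_adjoint B * mat_adjoint A \<in> carrier_mat k n"
    by (rule mult_carrier_mat[OF mat_adjoint_carrier[OF B] mat_adjoint_carrier[OF A]])
  show "dim_row (mat_adjoint (A * B)) = dim_row (mat_adjoint B * mat_adjoint A)"
    "dim_col (mat_adjoint (A * B)) = dim_col (mat_adjoint B * mat_adjoint A)"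
    using adj BA by auto
  fix i j assume "i < dim_row (mat_adjoint B * mat_adjoint A)" "j < dim_col (mat_adjoint B * mat_adjoint A)"
  then have ij: "i < k" "j < n" using BA by auto
  show "mat_adjoint (A * B) $$ (i, j) = (mat_adjoint B * mat_adjoint A) $$ (i, j)"
    using ij by (simp add: mat_adjoint_index[OF AB] mult_mat_sum[OF A B]
      mult_mat_sum[OF mat_adjoint_carrier[OF B] mat_adjoint_carrier[OF A]]
      mat_adjoint_index[OF A] mat_adjoint_index[OF B] mult.commute del: index_mult_mat)
qed

lemma cscalar_prod_adjoint:
  fixes A :: "complex mat"
  assumes A: "A \<in> carrier_mat n m" and x: "x \<in> carrier_vec m" and y: "y \<in> carrier_vec n"
  shows "(A *\<^sub>v x) \<bullet>c y = x \<bullet>c (mat_adjoint A *\<^sub>v y)"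
proof -
  note adj = mat_adjoint_carrier[OF A]
  have "(A *\<^sub>v x) \<bullet>c y = (\<Sum>i<n. \<Sum>j<m. A $$ (i, j) * x $ j * cnj (y $ i))"
    using mult_mat_vec_sum[OF A x]
    by (simp add: cscalar_prod_sum[OF y] sum_distrib_right del: index_mult_mat_vec)
  also have "\<dots> = (\<Sum>j<m. \<Sum>i<n. A $$ (i, j) * x $ j * cnj (y $ i))" by (rule sum.swap)
  also have "\<dots> = (\<Sum>j<m. x $ j * cnj ((mat_adjoint A *\<^sub>v y) $ j))"
    using mult_mat_vec_sum[OF adj y]
    by (simp add: mat_adjoint_index[OF A] sum_distrib_left mult_ac del: index_mult_mat_vec)
  also have "\<dots> = x \<bullet>c (mat_adjoint A *\<^sub>v y)"
    using adj y by (intro cscalar_prod_sum[symmetric]) auto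
  finally show ?thesis .
qed

locale finite_unitary_rep = group G for G :: "('g, 'm) monoid_scheme" (structure) +
  fixes \<pi> :: "'g rep" and d :: nat
  assumes finite_G: "finite (carrier G)" and unitary: "unitary_rep G \<pi>" and d_eq: "rep_dim G \<pi> = d"
begin

lemma in_unitary_group: "g \<in> carrier G \<Longrightarrow> \<pi> g \<in> carrier (unitary_group d)"
  using unitary by (auto simp: unitary_rep_def hom_def d_eq)

lemma rep_carrier: "g \<in> carrier G \<Longrightarrow> \<pi> g \<in> carrier_mat d d"
  using in_unitary_group by (auto simp: unitary_group_def)

lemma rep_mult: "g \<in> carrier G \<Longrightarrow> h \<in> carrier G \<Longrightarrow> \<pi> (g \<otimes> h) = \<pi> g * \<pi> h"
  using unitary by (auto simp: unitary_rep_def hom_def d_eq unitary_group_def)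

lemma rep_adjoint_mult:
  assumes "g \<in> carrier G"
  shows "mat_adjoint (\<pi> g) * \<pi> g = 1\<^sub>m d" "\<pi> g * mat_adjoint (\<pi> g) = 1\<^sub>m d"
  using in_unitary_group[OF assms] by (auto simp: unitary_group_def)

lemma rep_one: "\<pi> \<one> = 1\<^sub>m d"
proof -
  have c: "\<pi> \<one> \<in> carrier_mat d d" and a: "mat_adjoint (\<pi> \<one>) \<in> carrier_mat d d"
    using rep_carrier[OF one_closed] mat_adjoint_carrier by auto
  have "\<pi> \<one> = mat_adjoint (\<pi> \<one>) * \<pi> \<one> * \<pi> \<one>"
    using rep_adjoint_mult(1)[OF one_closed] c by simp
  also have "\<dots> = mat_adjoint (\<pi> \<one>) * (\<pi> \<one> * \<pi> \<one>)" by (rule assoc_mult_mat[OF a c c])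
  also have "\<pi> \<one> * \<pi> \<one> = \<pi> \<one>" using rep_mult[OF one_closed one_closed] by simp
  finally show ?thesis using rep_adjoint_mult(1)[OF one_closed] by simp
qed

lemma rep_adjoint:
  assumes g: "g \<in> carrier G"
  shows "mat_adjoint (\<pi> g) = \<pi> (inv g)"
proof -
  have c: "\<pi> g \<in> carrier_mat d d" "\<pi> (inv g) \<in> carrier_mat d d" and a: "mat_adjoint (\<pi> g) \<in> carrier_mat d d"
    using rep_carrier g mat_adjoint_carrier by auto
  have "\<pi> g * \<pi> (inv g) = 1\<^sub>m d"
    using rep_mult[OF g inv_closed[OF g]] unfolding r_inv[OF g] rep_one by simp
  then have "mat_adjoint (\<pi> g) = mat_adjoint (\<pi> g) * (\<pi> g * \<pi> (inv g))"
    using a by simp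
  also have "\<dots> = mat_adjoint (\<pi> g) * \<pi> g * \<pi> (inv g)" by (rule assoc_mult_mat[OF a c, symmetric])
  finally show ?thesis using rep_adjoint_mult(1)[OF g] c by simp
qed

lemma rep_vec_carrier: "g \<in> carrier G \<Longrightarrow> x \<in> carrier_vec d \<Longrightarrow> \<pi> g *\<^sub>v x \<in> carrier_vec d"
  by (rule mult_mat_vec_carrier[OF rep_carrier])

lemma rep_mult_vec:
  assumes "g \<in> carrier G" "h \<in> carrier G" "x \<in> carrier_vec d"
  shows "\<pi> g *\<^sub>v (\<pi> h *\<^sub>v x) = \<pi> (g \<otimes> h) *\<^sub>v x"
  using assoc_mult_mat_vec[OF rep_carrier rep_carrier] assms by (simp add: rep_mult)

lemma rep_cscalar_prod:
  assumes "g \<in> carrier G" "x \<in> carrier_vec d" "y \<in> carrier_vec d"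
  shows "(\<pi> g *\<^sub>v x) \<bullet>c y = x \<bullet>c (\<pi> (inv g) *\<^sub>v y)"
  using cscalar_prod_adjoint[OF rep_carrier] assms by (simp add: rep_adjoint)

lemma rep_isometry:
  assumes "g \<in> carrier G" "x \<in> carrier_vec d" "y \<in> carrier_vec d"
  shows "(\<pi> g *\<^sub>v x) \<bullet>c (\<pi> g *\<^sub>v y) = x \<bullet>c y"
  using assms rep_one by (simp add: rep_cscalar_prod rep_vec_carrier rep_mult_vec)

lemma order_pos: "order G > 0"
  using finite_G by (simp add: order_gt_0_iff_finite)

lemma sum_left_translate:
  assumes "h \<in> carrier G"
  shows "(\<Sum>g\<in>carrier G. f (h \<otimes> g)) = (\<Sum>g\<in>carrier G. f g)"
proof (rule sum.reindex_bij_witness[where i="\<lambda>g. inv h \<otimes> g" and j="\<lambda>g. h \<otimes> g"])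
qed (use assms in \<open>auto simp: m_assoc[symmetric]\<close>)

end

text \<open>An eigenspace of \<open>T\<close> is a nonzero invariant subspace, hence the whole
  space.\<close>

lemma schur_scalar:
  assumes "finite_unitary_rep G \<pi> d" and irr: "irreducible_unitary_rep G \<pi>"
    and T: "T \<in> carrier_mat d d" and comm: "\<And>g. g \<in> carrier G \<Longrightarrow> \<pi> g * T = T * \<pi> g"
  obtains c where "T = c \<cdot>\<^sub>m 1\<^sub>m d"
proof -
  interpret finite_unitary_rep G \<pi> d by fact
  have d: "d > 0" using irr by (simp add: irreducible_unitary_rep_def d_eq)
  obtain c where "eigenvalue T c" using spectrum_non_empty[OF T d] by (auto simp: spectrum_def)
  then obtain x where x: "x \<in> carrier_vec d" "x \<noteq> 0\<^sub>v d" "T *\<^sub>v x = c \<cdot>\<^sub>v x"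
    using T by (auto simp: eigenvalue_def eigenvector_def)
  define W where "W = {x \<in> carrier_vec d. T *\<^sub>v x = c \<cdot>\<^sub>v x}"
  interpret V: vec_space "TYPE(complex)" d .
  have "VectorSpace.subspace class_ring W (module_vec TYPE(complex) d)"
    unfolding VectorSpace.subspace_def LinearCombinations.submodule_def
  proof (intro conjI allI impI)
    show "vectorspace class_ring (module_vec TYPE(complex) d)" by (rule vec_vs)
    show "Module.module class_ring (module_vec TYPE(complex) d)" by (rule vec_module)
  qed (use T in \<open>auto simp: W_def module_vec_simps mult_add_distrib_mat_vec[OF T] smult_add_distrib_vec
        mult_mat_vec[OF T] smult_smult_assoc mult.commute\<close>)
  moreover have "\<pi> g *\<^sub>v w \<in> W" if g: "g \<in> carrier G" and w: "w \<in> W" for g w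
  proof -
    have w': "w \<in> carrier_vec d" "T *\<^sub>v w = c \<cdot>\<^sub>v w" using w by (auto simp: W_def)
    have "T *\<^sub>v (\<pi> g *\<^sub>v w) = (T * \<pi> g) *\<^sub>v w"
      using assoc_mult_mat_vec[OF T rep_carrier[OF g] w'(1)] by simp
    also have "\<dots> = \<pi> g *\<^sub>v (T *\<^sub>v w)"
      using assoc_mult_mat_vec[OF rep_carrier[OF g] T w'(1)] by (simp add: comm[OF g])
    also have "\<dots> = c \<cdot>\<^sub>v (\<pi> g *\<^sub>v w)"
      using mult_mat_vec[OF rep_carrier[OF g] w'(1)] w'(2) by simp
    finally show ?thesis using rep_vec_carrier[OF g w'(1)] by (simp add: W_def)
  qed
  ultimately have "W = {0\<^sub>v d} \<or> W = carrier_vec d"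
    using irr by (simp add: irreducible_unitary_rep_def d_eq)
  moreover have "x \<in> W" using x by (simp add: W_def)
  ultimately have W: "W = carrier_vec d" using x(2) by auto
  have "T = c \<cdot>\<^sub>m 1\<^sub>m d"
  proof (rule eq_matI)
    fix i j assume ij: "i < dim_row (c \<cdot>\<^sub>m 1\<^sub>m d)" "j < dim_col (c \<cdot>\<^sub>m 1\<^sub>m d)"
    have "unit_vec d j \<in> W" using W by simp
    then have "T *\<^sub>v unit_vec d j = c \<cdot>\<^sub>v unit_vec d j" by (simp add: W_def)
    then have "(T *\<^sub>v unit_vec d j) $ i = c * unit_vec d j $ i" using ij by simp
    moreover have "(T *\<^sub>v unit_vec d j) $ i = T $$ (i, j)"
      using ij T by simp
    ultimately show "T $$ (i, j) = (c \<cdot>\<^sub>m 1\<^sub>m d) $$ (i, j)"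
      using ij by (simp add: unit_vec_def)
  qed (use T in auto)
  then show thesis by (rule that)
qed

definition intertwiner ::
  "('g, 'm) monoid_scheme \<Rightarrow> 'g rep \<Rightarrow> 'g rep \<Rightarrow> complex vec \<Rightarrow> complex vec \<Rightarrow> complex mat" where
  "intertwiner G \<rho> \<pi> w v = mat (rep_dim G \<rho>) (rep_dim G \<pi>)
     (\<lambda>(a, b). \<Sum>g\<in>carrier G. (\<rho> g *\<^sub>v w) $ a * cnj ((\<pi> g *\<^sub>v v) $ b))"

context
  fixes G :: "('g, 'm) monoid_scheme" (structure) and \<rho> \<pi> :: "'g rep" and k d :: nat
    and w v :: "complex vec"
  assumes \<rho>: "finite_unitary_rep G \<rho> k" and \<pi>: "finite_unitary_rep G \<pi> d"
    and w: "w \<in> carrier_vec k" and v: "v \<in> carrier_vec d"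
begin

interpretation R: finite_unitary_rep G \<rho> k by (rule \<rho>)
interpretation P: finite_unitary_rep G \<pi> d by (rule \<pi>)

lemma intertwiner_carrier: "intertwiner G \<rho> \<pi> w v \<in> carrier_mat k d"
  by (simp add: intertwiner_def R.d_eq P.d_eq)

lemma intertwiner_index:
  "a < k \<Longrightarrow> b < d \<Longrightarrow> intertwiner G \<rho> \<pi> w v $$ (a, b)
     = (\<Sum>g\<in>carrier G. (\<rho> g *\<^sub>v w) $ a * cnj ((\<pi> g *\<^sub>v v) $ b))"
  by (simp add: intertwiner_def R.d_eq P.d_eq)

lemma intertwiner_commute:
  assumes h: "h \<in> carrier G"
  shows "\<rho> h * intertwiner G \<rho> \<pi> w v = intertwiner G \<rho> \<pi> w v * \<pi> h"
proof (rule eq_matI)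
  let ?T = "intertwiner G \<rho> \<pi> w v"
  note T = intertwiner_carrier
  note cr = R.rep_carrier[OF h] and cp = P.rep_carrier[OF h]
  show "dim_row (\<rho> h * ?T) = dim_row (?T * \<pi> h)" "dim_col (\<rho> h * ?T) = dim_col (?T * \<pi> h)"
    using T cr cp by auto
  fix a b assume "a < dim_row (?T * \<pi> h)" "b < dim_col (?T * \<pi> h)"
  then have ab: "a < k" "b < d" using T cp by auto
  have "(\<rho> h * ?T) $$ (a, b) = (\<Sum>c<k. \<Sum>g\<in>carrier G. \<rho> h $$ (a, c) * ((\<rho> g *\<^sub>v w) $ c * cnj ((\<pi> g *\<^sub>v v) $ b)))"
    using ab by (simp add: mult_mat_sum[OF cr T] intertwiner_index sum_distrib_left
        del: index_mult_mat_vec index_mult_mat)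
  also have "\<dots> = (\<Sum>g\<in>carrier G. \<Sum>c<k. \<rho> h $$ (a, c) * ((\<rho> g *\<^sub>v w) $ c * cnj ((\<pi> g *\<^sub>v v) $ b)))"
    by (rule sum.swap)
  also have "\<dots> = (\<Sum>g\<in>carrier G. (\<rho> (h \<otimes> g) *\<^sub>v w) $ a * cnj ((\<pi> g *\<^sub>v v) $ b))"
  proof (rule sum.cong[OF refl])
    fix g assume g: "g \<in> carrier G"
    have "(\<rho> (h \<otimes> g) *\<^sub>v w) $ a = (\<rho> h *\<^sub>v (\<rho> g *\<^sub>v w)) $ a"
      using R.rep_mult_vec[OF h g w] by simp
    also have "\<dots> = (\<Sum>c<k. \<rho> h $$ (a, c) * (\<rho> g *\<^sub>v w) $ c)"
      by (rule mult_mat_vec_sum[OF cr R.rep_vec_carrier[OF g w] ab(1)])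
    finally show "(\<Sum>c<k. \<rho> h $$ (a, c) * ((\<rho> g *\<^sub>v w) $ c * cnj ((\<pi> g *\<^sub>v v) $ b)))
      = (\<rho> (h \<otimes> g) *\<^sub>v w) $ a * cnj ((\<pi> g *\<^sub>v v) $ b)"
      by (simp add: sum_distrib_right mult.assoc del: index_mult_mat_vec)
  qed
  \<comment> \<open>Writing g as h^(-1) (h g) makes the summand a function of h g alone, so the
    summation variable can be translated.\<close>
  also have "\<dots> = (\<Sum>g\<in>carrier G. (\<rho> (h \<otimes> g) *\<^sub>v w) $ a * cnj ((\<pi> (inv h \<otimes> (h \<otimes> g)) *\<^sub>v v) $ b))"
    using h by (intro sum.cong refl) (simp add: R.m_assoc[symmetric] del: index_mult_mat_vec)
  also have "\<dots> = (\<Sum>g\<in>carrier G. (\<rho> g *\<^sub>v w) $ a * cnj ((\<pi> (inv h \<otimes> g) *\<^sub>v v) $ b))"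
    by (rule R.sum_left_translate[OF h])
  also have "\<dots> = (\<Sum>g\<in>carrier G. \<Sum>c<d. (\<rho> g *\<^sub>v w) $ a * cnj ((\<pi> g *\<^sub>v v) $ c) * \<pi> h $$ (c, b))"
  proof (rule sum.cong[OF refl])
    fix g assume g: "g \<in> carrier G"
    have "(\<pi> (inv h \<otimes> g) *\<^sub>v v) $ b = (mat_adjoint (\<pi> h) *\<^sub>v (\<pi> g *\<^sub>v v)) $ b"
      using P.rep_mult_vec[OF R.inv_closed[OF h] g v] P.rep_adjoint[OF h] by simp
    also have "\<dots> = (\<Sum>c<d. mat_adjoint (\<pi> h) $$ (b, c) * (\<pi> g *\<^sub>v v) $ c)"
      by (rule mult_mat_vec_sum[OF mat_adjoint_carrier[OF cp] P.rep_vec_carrier[OF g v] ab(2)])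
    also have "\<dots> = (\<Sum>c<d. cnj (\<pi> h $$ (c, b)) * (\<pi> g *\<^sub>v v) $ c)"
      using ab by (simp add: mat_adjoint_index[OF cp] del: index_mult_mat_vec)
    finally show "(\<rho> g *\<^sub>v w) $ a * cnj ((\<pi> (inv h \<otimes> g) *\<^sub>v v) $ b)
       = (\<Sum>c<d. (\<rho> g *\<^sub>v w) $ a * cnj ((\<pi> g *\<^sub>v v) $ c) * \<pi> h $$ (c, b))"
      by (simp add: sum_distrib_left mult_ac del: index_mult_mat_vec)
  qed
  also have "\<dots> = (\<Sum>c<d. \<Sum>g\<in>carrier G. (\<rho> g *\<^sub>v w) $ a * cnj ((\<pi> g *\<^sub>v v) $ c) * \<pi> h $$ (c, b))"
    by (rule sum.swap)
  also have "\<dots> = (?T * \<pi> h) $$ (a, b)"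
    using ab by (simp add: mult_mat_sum[OF T cp] intertwiner_index sum_distrib_right
        del: index_mult_mat_vec index_mult_mat)
  finally show "(\<rho> h * ?T) $$ (a, b) = (?T * \<pi> h) $$ (a, b)" .
qed

text \<open>Both sides are w* T v for the intertwiner T, so Schur's lemma for T evaluates the sum of
  products of coefficients.\<close>

lemma sum_coeff_intertwiner:
  "(\<Sum>g\<in>carrier G. ((\<rho> g *\<^sub>v w) \<bullet>c w) * cnj ((\<pi> g *\<^sub>v v) \<bullet>c v))
     = (\<Sum>a<k. \<Sum>b<d. cnj (w $ a) * v $ b * intertwiner G \<rho> \<pi> w v $$ (a, b))"
proof -
  have "(\<Sum>g\<in>carrier G. ((\<rho> g *\<^sub>v w) \<bullet>c w) * cnj ((\<pi> g *\<^sub>v v) \<bullet>c v))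
    = (\<Sum>g\<in>carrier G. \<Sum>a<k. \<Sum>b<d. cnj (w $ a) * v $ b * ((\<rho> g *\<^sub>v w) $ a * cnj ((\<pi> g *\<^sub>v v) $ b)))"
    unfolding cscalar_prod_sum[OF w] cscalar_prod_sum[OF v] cnj_sum sum_product
    by (intro sum.cong refl) (simp add: mult_ac del: index_mult_mat_vec)
  also have "\<dots> = (\<Sum>a<k. \<Sum>g\<in>carrier G. \<Sum>b<d. cnj (w $ a) * v $ b * ((\<rho> g *\<^sub>v w) $ a * cnj ((\<pi> g *\<^sub>v v) $ b)))"
    by (rule sum.swap)
  also have "\<dots> = (\<Sum>a<k. \<Sum>b<d. \<Sum>g\<in>carrier G. cnj (w $ a) * v $ b * ((\<rho> g *\<^sub>v w) $ a * cnj ((\<pi> g *\<^sub>v v) $ b)))"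
    by (intro sum.cong refl sum.swap)
  also have "\<dots> = (\<Sum>a<k. \<Sum>b<d. cnj (w $ a) * v $ b * intertwiner G \<rho> \<pi> w v $$ (a, b))"
    by (intro sum.cong refl) (simp add: intertwiner_index sum_distrib_left del: index_mult_mat_vec)
  finally show ?thesis .
qed

end

definition diag_coeff :: "'g rep \<Rightarrow> complex vec \<Rightarrow> 'g \<Rightarrow> complex" where
  "diag_coeff \<pi> v g = (\<pi> g *\<^sub>v v) \<bullet>c v"

text \<open>The intertwiner of \<pi> with itself is a scalar c. Its trace is the sum of the squared
  norms of the unit vectors \<pi>(g) v, so d c = |G|.\<close>

lemma schur_norm:
  assumes \<pi>: "finite_unitary_rep G \<pi> d" and irr: "irreducible_unitary_rep G \<pi>"
    and v: "v \<in> carrier_vec d" "v \<bullet>c v = 1"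
  shows "(\<Sum>g\<in>carrier G. diag_coeff \<pi> v g * cnj (diag_coeff \<pi> v g)) = of_nat (order G) / of_nat d"
proof -
  interpret finite_unitary_rep G \<pi> d by fact
  have d: "d > 0" using irr by (simp add: irreducible_unitary_rep_def d_eq)
  let ?T = "intertwiner G \<pi> \<pi> v v"
  note idx = intertwiner_index[OF \<pi> \<pi> v(1) v(1)]
  obtain c where c: "?T = c \<cdot>\<^sub>m 1\<^sub>m d"
    using schur_scalar[OF \<pi> irr intertwiner_carrier[OF \<pi> \<pi> v(1) v(1)] intertwiner_commute[OF \<pi> \<pi> v(1) v(1)]]
    by blast
  have T: "?T $$ (a, b) = (if a = b then c else 0)" if "a < d" "b < d" for a b
    using that by (simp add: c)
  have "of_nat d * c = (\<Sum>a<d. ?T $$ (a, a))" by (simp add: T)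
  also have "\<dots> = (\<Sum>a<d. \<Sum>g\<in>carrier G. (\<pi> g *\<^sub>v v) $ a * cnj ((\<pi> g *\<^sub>v v) $ a))"
    by (intro sum.cong refl idx) auto
  also have "\<dots> = (\<Sum>g\<in>carrier G. \<Sum>a<d. (\<pi> g *\<^sub>v v) $ a * cnj ((\<pi> g *\<^sub>v v) $ a))"
    by (rule sum.swap)
  also have "\<dots> = (\<Sum>g\<in>carrier G. (\<pi> g *\<^sub>v v) \<bullet>c (\<pi> g *\<^sub>v v))"
    using rep_vec_carrier v(1) by (intro sum.cong refl cscalar_prod_sum[symmetric]) auto
  also have "\<dots> = of_nat (order G)"
    using v by (simp add: rep_isometry order_def)
  finally have cd: "of_nat d * c = of_nat (order G)" .
  have "(\<Sum>g\<in>carrier G. diag_coeff \<pi> v g * cnj (diag_coeff \<pi> v g)) = (\<Sum>a<d. \<Sum>b<d. cnj (v $ a) * v $ b * ?T $$ (a, b))"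
    unfolding diag_coeff_def by (rule sum_coeff_intertwiner[OF \<pi> \<pi> v(1) v(1)])
  also have "\<dots> = (\<Sum>a<d. \<Sum>b<d. if a = b then c * (v $ a * cnj (v $ a)) else 0)"
    by (intro sum.cong refl) (auto simp: T)
  also have "\<dots> = c * (v \<bullet>c v)"
    by (simp add: cscalar_prod_sum[OF v(1)] sum_distrib_left)
  finally show ?thesis using cd d v(2) by (simp add: field_simps)
qed

text \<open>\<open>schur_scalar\<close> concerns endomorphisms, so it is applied to T T* and T* T.
  If T had a nonzero entry, it would be a nonzero multiple of a unitary and hence an
  equivalence.\<close>

lemma schur_orthogonality:
  assumes \<rho>: "finite_unitary_rep G \<rho> k" "irreducible_unitary_rep G \<rho>"
    and \<pi>: "finite_unitary_rep G \<pi> d" "irreducible_unitary_rep G \<pi>"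
    and neq: "\<not> equivalent_rep G \<pi> \<rho>"
    and w: "w \<in> carrier_vec k" and v: "v \<in> carrier_vec d"
  shows "(\<Sum>g\<in>carrier G. diag_coeff \<rho> w g * cnj (diag_coeff \<pi> v g)) = 0"
proof -
  interpret R: finite_unitary_rep G \<rho> k by fact
  interpret P: finite_unitary_rep G \<pi> d by fact
  define T where "T = intertwiner G \<rho> \<pi> w v"
  have T: "T \<in> carrier_mat k d" unfolding T_def by (rule intertwiner_carrier[OF \<rho>(1) \<pi>(1) w v])
  have A: "mat_adjoint T \<in> carrier_mat d k" by (rule mat_adjoint_carrier[OF T])
  have comm: "\<rho> h * T = T * \<pi> h" if "h \<in> carrier G" for h
    unfolding T_def by (rule intertwiner_commute[OF \<rho>(1) \<pi>(1) w v that])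
  have comm': "\<pi> h * mat_adjoint T = mat_adjoint T * \<rho> h" if h: "h \<in> carrier G" for h
  proof -
    have "mat_adjoint (\<rho> (inv\<^bsub>G\<^esub> h) * T) = mat_adjoint (T * \<pi> (inv\<^bsub>G\<^esub> h))"
      using comm[OF R.inv_closed[OF h]] by simp
    moreover have "mat_adjoint (\<rho> (inv\<^bsub>G\<^esub> h) * T) = mat_adjoint T * \<rho> h"
      using mat_adjoint_mult[OF R.rep_carrier[OF R.inv_closed[OF h]] T] R.rep_adjoint[OF R.inv_closed[OF h]] h
      by simp
    moreover have "mat_adjoint (T * \<pi> (inv\<^bsub>G\<^esub> h)) = \<pi> h * mat_adjoint T"
      using mat_adjoint_mult[OF T P.rep_carrier[OF R.inv_closed[OF h]]] P.rep_adjoint[OF R.inv_closed[OF h]] h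
      by simp
    ultimately show ?thesis by simp
  qed
  have "\<rho> g * (T * mat_adjoint T) = T * mat_adjoint T * \<rho> g" if g: "g \<in> carrier G" for g
  proof -
    note r = R.rep_carrier[OF g] and p = P.rep_carrier[OF g]
    have "\<rho> g * (T * mat_adjoint T) = T * \<pi> g * mat_adjoint T"
      using assoc_mult_mat[OF r T A] comm[OF g] by simp
    also have "\<dots> = T * (mat_adjoint T * \<rho> g)"
      using assoc_mult_mat[OF T p A] comm'[OF g] by simp
    also have "\<dots> = T * mat_adjoint T * \<rho> g" by (rule assoc_mult_mat[OF T A r, symmetric])
    finally show ?thesis .
  qed
  then obtain x where x: "T * mat_adjoint T = x \<cdot>\<^sub>m 1\<^sub>m k"
    using schur_scalar[OF \<rho> mult_carrier_mat[OF T A]] by blast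
  have "\<pi> g * (mat_adjoint T * T) = mat_adjoint T * T * \<pi> g" if g: "g \<in> carrier G" for g
  proof -
    note r = R.rep_carrier[OF g] and p = P.rep_carrier[OF g]
    have "\<pi> g * (mat_adjoint T * T) = mat_adjoint T * \<rho> g * T"
      using assoc_mult_mat[OF p A T] comm'[OF g] by simp
    also have "\<dots> = mat_adjoint T * (T * \<pi> g)"
      using assoc_mult_mat[OF A r T] comm[OF g] by simp
    also have "\<dots> = mat_adjoint T * T * \<pi> g" by (rule assoc_mult_mat[OF A T p, symmetric])
    finally show ?thesis .
  qed
  then obtain y where y: "mat_adjoint T * T = y \<cdot>\<^sub>m 1\<^sub>m d"
    using schur_scalar[OF \<pi> mult_carrier_mat[OF A T]] by blast
  have T0: "T $$ (a, b) = 0" if ab: "a < k" "b < d" for a b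
  proof (rule ccontr)
    assume nz: "T $$ (a, b) \<noteq> 0"
    have "x = (T * mat_adjoint T) $$ (a, a)" using ab by (simp add: x)
    also have "\<dots> = (\<Sum>l<d. of_real ((cmod (T $$ (a, l)))\<^sup>2))"
      using ab by (simp add: mult_mat_sum[OF T A] mat_adjoint_index[OF T] complex_norm_square
        del: index_mult_mat of_real_power)
    finally have "x = of_real (\<Sum>l<d. (cmod (T $$ (a, l)))\<^sup>2)" by simp
    moreover have "(\<Sum>l<d. (cmod (T $$ (a, l)))\<^sup>2) > 0"
      using nz ab by (intro sum_pos2[of _ b]) auto
    ultimately have x0: "x \<noteq> 0" by (metis less_irrefl of_real_eq_0_iff)
    have "x \<cdot>\<^sub>m T = T * mat_adjoint T * T"
      using mult_smult_assoc_mat[of "1\<^sub>m k" k k T d x] T by (simp add: x)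
    also have "\<dots> = T * (mat_adjoint T * T)" by (rule assoc_mult_mat[OF T A T])
    also have "\<dots> = y \<cdot>\<^sub>m T" using mult_smult_distrib[OF T, of "1\<^sub>m d" d y] T by (simp add: y)
    finally have "(x \<cdot>\<^sub>m T) $$ (a, b) = (y \<cdot>\<^sub>m T) $$ (a, b)" by simp
    then have xy: "x = y" using ab T nz by simp
    \<comment> \<open>T T* and T* T have the same trace, so the equal nonzero scalars x and y force
      equal dimensions.\<close>
    have "of_nat k * x = (\<Sum>i<k. (T * mat_adjoint T) $$ (i, i))" by (simp add: x)
    also have "\<dots> = (\<Sum>i<k. \<Sum>l<d. T $$ (i, l) * mat_adjoint T $$ (l, i))"
      by (intro sum.cong refl) (simp add: mult_mat_sum[OF T A] del: index_mult_mat)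
    also have "\<dots> = (\<Sum>l<d. \<Sum>i<k. mat_adjoint T $$ (l, i) * T $$ (i, l))"
      by (subst sum.swap) (simp add: mult.commute)
    also have "\<dots> = (\<Sum>l<d. (mat_adjoint T * T) $$ (l, l))"
      by (intro sum.cong refl) (simp add: mult_mat_sum[OF A T] del: index_mult_mat)
    also have "\<dots> = of_nat d * y" by (simp add: y)
    finally have kd: "k = d" using xy x0 by simp
    have "T * (1 / x \<cdot>\<^sub>m mat_adjoint T) = 1\<^sub>m k"
      using mult_smult_distrib[OF T A] x x0 by (auto intro!: eq_matI)
    moreover have "(1 / x \<cdot>\<^sub>m mat_adjoint T) * T = 1\<^sub>m d"
      using mult_smult_assoc_mat[OF A T] y xy x0 by (auto intro!: eq_matI)
    ultimately have "invertible_mat T"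
      unfolding invertible_mat_def inverts_mat_def square_mat.simps
      using T A kd by (auto intro!: exI[of _ "1 / x \<cdot>\<^sub>m mat_adjoint T"])
    then have "equivalent_rep G \<pi> \<rho>"
      unfolding equivalent_rep_def using T kd comm
      by (auto simp: R.d_eq P.d_eq intro!: bexI[of _ T])
    then show False using neq by simp
  qed
  have "(\<Sum>g\<in>carrier G. diag_coeff \<rho> w g * cnj (diag_coeff \<pi> v g)) = (\<Sum>a<k. \<Sum>b<d. cnj (w $ a) * v $ b * T $$ (a, b))"
    unfolding diag_coeff_def T_def by (rule sum_coeff_intertwiner[OF \<rho>(1) \<pi>(1) w v])
  then show ?thesis by (simp add: T0)
qed

lemma finite_unitary_repI:
  assumes "group G" "finite (carrier G)" "irreducible_unitary_rep G \<pi>"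
  shows "finite_unitary_rep G \<pi> (rep_dim G \<pi>)"
  using assms by (simp add: finite_unitary_rep_def finite_unitary_rep_axioms_def irreducible_unitary_rep_def)

text \<open>Bessel's inequality for the indicator of the neutral element and the matrix coefficients
  \<open>g \<mapsto> \<langle>\<pi>(g) v, v\<rangle>\<close>.\<close>

lemma card_inequivalent_irreps:
  assumes G: "group G" "finite (carrier G)" and F: "finite F"
    and irr: "\<And>\<pi>. \<pi> \<in> F \<Longrightarrow> irreducible_unitary_rep G \<pi>"
    and neq: "\<And>\<pi> \<rho>. \<pi> \<in> F \<Longrightarrow> \<rho> \<in> F \<Longrightarrow> \<pi> \<noteq> \<rho> \<Longrightarrow> \<not> equivalent_rep G \<pi> \<rho>"
  shows "card F \<le> order G"
proof -
  interpret group G by fact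
  let ?d = "rep_dim G"
  have fin: "finite_unitary_rep G \<pi> (?d \<pi>)" if "\<pi> \<in> F" for \<pi>
    using finite_unitary_repI[OF G irr[OF that]] .
  have dpos: "?d \<pi> > 0" if "\<pi> \<in> F" for \<pi>
    using irr[OF that] by (simp add: irreducible_unitary_rep_def)
  have N: "real (order G) > 0" using G(2) by (simp add: order_gt_0_iff_finite)
  define e where "e \<pi> = (unit_vec (?d \<pi>) 0 :: complex vec)" for \<pi> :: "'a rep"
  have e: "e \<pi> \<in> carrier_vec (?d \<pi>)" "e \<pi> \<bullet>c e \<pi> = 1" if "\<pi> \<in> F" for \<pi>
    using dpos[OF that] by (auto simp: e_def cscalar_prod_sum[of _ "?d \<pi>"] unit_vec_def
        if_distrib[of "\<lambda>u. u * _"] cong: if_cong)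
  define c where "c \<pi> g = diag_coeff \<pi> (e \<pi>) g" for \<pi> g
  define a where "a \<pi> = (of_nat (?d \<pi>) / of_nat (order G) :: complex)" for \<pi> :: "'a rep"
  have cnj_a: "cnj (a \<pi>) = a \<pi>" for \<pi> by (simp add: a_def)
  have c1: "c \<pi> \<one>\<^bsub>G\<^esub> = 1" if "\<pi> \<in> F" for \<pi>
    using finite_unitary_rep.rep_one[OF fin[OF that]] e[OF that] by (simp add: c_def diag_coeff_def)
  have cc: "(\<Sum>g\<in>carrier G. c \<pi> g * cnj (c \<rho> g)) = (if \<pi> = \<rho> then 1 / a \<pi> else 0)"
    if "\<pi> \<in> F" "\<rho> \<in> F" for \<pi> \<rho>
  proof (cases "\<pi> = \<rho>")
    case True
    then show ?thesis
      using schur_norm[OF fin irr e] that by (simp add: c_def a_def)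
  next
    case False
    then show ?thesis
      using schur_orthogonality[OF fin irr fin irr neq e(1) e(1)] that by (simp add: c_def)
  qed
  define \<delta> where "\<delta> g = (if g = \<one>\<^bsub>G\<^esub> then 1 else 0 :: complex)" for g
  \<comment> \<open>The orthogonal projection of \<open>\<delta>\<close> onto the span of the
    coefficients: the inner product of \<open>\<delta>\<close> with \<open>c \<pi>\<close> is 1, and
    the squared norm of \<open>c \<pi>\<close> is \<open>1 / a \<pi>\<close>.\<close>
  define s where "s g = (\<Sum>\<pi>\<in>F. a \<pi> * c \<pi> g)" for g
  have delta_sum: "(\<Sum>g\<in>carrier G. \<delta> g * f g) = f \<one>\<^bsub>G\<^esub>" for f
    using G(2) by (simp add: \<delta>_def if_distrib[of "\<lambda>u. u * _"] cong: if_cong)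
  have s1: "s \<one>\<^bsub>G\<^esub> = (\<Sum>\<pi>\<in>F. a \<pi>)" by (simp add: s_def c1)
  have ss: "(\<Sum>g\<in>carrier G. s g * cnj (s g)) = (\<Sum>\<pi>\<in>F. a \<pi>)"
  proof -
    have "(\<Sum>g\<in>carrier G. s g * cnj (s g))
      = (\<Sum>g\<in>carrier G. \<Sum>\<pi>\<in>F. \<Sum>\<rho>\<in>F. a \<pi> * a \<rho> * (c \<pi> g * cnj (c \<rho> g)))"
      unfolding s_def cnj_sum sum_product by (simp add: cnj_a mult_ac)
    also have "\<dots> = (\<Sum>\<pi>\<in>F. \<Sum>g\<in>carrier G. \<Sum>\<rho>\<in>F. a \<pi> * a \<rho> * (c \<pi> g * cnj (c \<rho> g)))"
      by (rule sum.swap)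
    also have "\<dots> = (\<Sum>\<pi>\<in>F. \<Sum>\<rho>\<in>F. \<Sum>g\<in>carrier G. a \<pi> * a \<rho> * (c \<pi> g * cnj (c \<rho> g)))"
      by (intro sum.cong refl sum.swap)
    also have "\<dots> = (\<Sum>\<pi>\<in>F. \<Sum>\<rho>\<in>F. a \<pi> * a \<rho> * (if \<pi> = \<rho> then 1 / a \<pi> else 0))"
      by (intro sum.cong refl) (simp add: cc flip: sum_distrib_left)
    also have "\<dots> = (\<Sum>\<pi>\<in>F. a \<pi>)"
    proof (rule sum.cong[OF refl])
      fix \<pi> assume \<pi>: "\<pi> \<in> F"
      have "(\<Sum>\<rho>\<in>F. a \<pi> * a \<rho> * (if \<pi> = \<rho> then 1 / a \<pi> else 0))
        = (\<Sum>\<rho>\<in>F. if \<rho> = \<pi> then a \<pi> * a \<pi> * (1 / a \<pi>) else 0)"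
        by (intro sum.cong refl) auto
      then show "(\<Sum>\<rho>\<in>F. a \<pi> * a \<rho> * (if \<pi> = \<rho> then 1 / a \<pi> else 0)) = a \<pi>"
        using F \<pi> by simp
    qed
    finally show ?thesis .
  qed
  have a_sum: "(\<Sum>\<pi>\<in>F. a \<pi>) = of_real (\<Sum>\<pi>\<in>F. real (?d \<pi>) / real (order G))"
    by (simp add: a_def)
  have "of_real (\<Sum>g\<in>carrier G. (cmod (\<delta> g - s g))\<^sup>2)
      = (\<Sum>g\<in>carrier G. (\<delta> g - s g) * cnj (\<delta> g - s g))"
    by (simp add: complex_norm_square del: of_real_power)
  also have "\<dots> = (\<Sum>g\<in>carrier G. \<delta> g * cnj (\<delta> g)) - (\<Sum>g\<in>carrier G. \<delta> g * cnj (s g))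
      - (\<Sum>g\<in>carrier G. cnj (\<delta> g) * s g) + (\<Sum>g\<in>carrier G. s g * cnj (s g))"
    unfolding sum_subtractf[symmetric] sum.distrib[symmetric]
    by (intro sum.cong refl) (simp add: algebra_simps)
  also have "\<dots> = 1 - (\<Sum>\<pi>\<in>F. a \<pi>)"
  proof -
    have "cnj (\<delta> g) = \<delta> g" for g by (simp add: \<delta>_def)
    moreover have "\<delta> \<one>\<^bsub>G\<^esub> = 1" by (simp add: \<delta>_def)
    moreover have "cnj (\<Sum>\<pi>\<in>F. a \<pi>) = (\<Sum>\<pi>\<in>F. a \<pi>)" by (simp add: cnj_a)
    ultimately show ?thesis by (simp only: delta_sum s1 ss) simp
  qed
  finally have "of_real (\<Sum>g\<in>carrier G. (cmod (\<delta> g - s g))\<^sup>2)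
      = (of_real (1 - (\<Sum>\<pi>\<in>F. real (?d \<pi>) / real (order G))) :: complex)"
    by (simp add: a_sum)
  then have "(\<Sum>g\<in>carrier G. (cmod (\<delta> g - s g))\<^sup>2) = 1 - (\<Sum>\<pi>\<in>F. real (?d \<pi>) / real (order G))"
    by (simp only: of_real_eq_iff)
  moreover have "(\<Sum>g\<in>carrier G. (cmod (\<delta> g - s g))\<^sup>2) \<ge> 0" by (simp add: sum_nonneg)
  ultimately have "(\<Sum>\<pi>\<in>F. real (?d \<pi>) / real (order G)) \<le> 1" by linarith
  moreover have "(\<Sum>\<pi>\<in>F. 1 / real (order G)) \<le> (\<Sum>\<pi>\<in>F. real (?d \<pi>) / real (order G))"
    using dpos N by (intro sum_mono divide_right_mono) (auto simp: Suc_le_eq)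
  ultimately have "real (card F) / real (order G) \<le> 1" by simp
  then show ?thesis using N by simp
qed

text \<open>A sum over an infinite set is 0 in HOL, so the bound of the theorem has its intended
  meaning only for finite \<open>R\<close>. An infinite \<open>R\<close> would contain |G| + 1
  inequivalent irreducibles.\<close>

lemma finite_irrep_representatives:
  assumes G: "group G" "finite (carrier G)" and R: "irrep_representatives G R"
  shows "finite R"
proof (rule ccontr)
  assume "infinite R"
  then obtain F where F: "F \<subseteq> R" "finite F" "card F = Suc (order G)"
    using infinite_arbitrarily_large by blast
  have "card F \<le> order G"
  proof (rule card_inequivalent_irreps[OF G F(2)])
    show "irreducible_unitary_rep G \<pi>" if "\<pi> \<in> F" for \<pi>
      using that F(1) R by (auto simp: irrep_representatives_def)
    fix \<pi> \<rho> assume *: "\<pi> \<in> F" "\<rho> \<in> F" "\<pi> \<noteq> \<rho>"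
    have irr: "irreducible_unitary_rep G \<pi>" using * F(1) R by (auto simp: irrep_representatives_def)
    interpret finite_unitary_rep G \<pi> "rep_dim G \<pi>" by (rule finite_unitary_repI[OF G irr])
    have "1\<^sub>m (rep_dim G \<pi>) * \<pi> g = \<pi> g * 1\<^sub>m (rep_dim G \<pi>)" if "g \<in> carrier G" for g
      using rep_carrier[OF that] by simp
    \<comment> \<open>By reflexivity \<pi> is the representative of its own class, so uniqueness
      rules out an equivalence with a different \<rho> in \<open>R\<close>.\<close>
    then have "equivalent_rep G \<pi> \<pi>"
      unfolding equivalent_rep_def
      by (auto intro!: bexI[of _ "1\<^sub>m (rep_dim G \<pi>)"] exI[of _ "1\<^sub>m (rep_dim G \<pi>)"]
        simp: invertible_mat_def inverts_mat_def)
    then show "\<not> equivalent_rep G \<pi> \<rho>"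
      using * F(1) R irr unfolding irrep_representatives_def by blast
  qed
  then show False using F(3) by simp
qed

section \<open>Pseudo-reflections\<close>

text \<open>The operator 1 + (z - 1) a a*. For a unit vector a it multiplies a by z and fixes the
  orthogonal complement. With |z| = 1 it supplies one-parameter subgroups of U(V); with z = -1 and a
  in V_J it is a reflection of V_J, and two of these make a rotation.\<close>

definition pseudo_refl :: "nat \<Rightarrow> complex vec \<Rightarrow> complex \<Rightarrow> complex mat" where
  "pseudo_refl n a z = mat n n (\<lambda>(i, j). (if i = j then 1 else 0) + (z - 1) * (a $ i * cnj (a $ j)))"

lemma pseudo_refl_carrier: "pseudo_refl n a z \<in> carrier_mat n n"
  by (simp add: pseudo_refl_def)

lemma pseudo_refl_vec:
  assumes a: "a \<in> carrier_vec n" and x: "x \<in> carrier_vec n"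
  shows "pseudo_refl n a z *\<^sub>v x = x + ((z - 1) * (x \<bullet>c a)) \<cdot>\<^sub>v a"
proof (rule eq_vecI)
  fix i assume "i < dim_vec (x + ((z - 1) * (x \<bullet>c a)) \<cdot>\<^sub>v a)"
  then have i: "i < n" using a by simp
  have "(pseudo_refl n a z *\<^sub>v x) $ i = (\<Sum>j<n. pseudo_refl n a z $$ (i, j) * x $ j)"
    by (rule mult_mat_vec_sum[OF pseudo_refl_carrier x i])
  also have "\<dots> = (\<Sum>j<n. (if j = i then x $ j else 0) + (z - 1) * a $ i * (x $ j * cnj (a $ j)))"
    using i by (intro sum.cong refl) (auto simp: pseudo_refl_def algebra_simps)
  also have "\<dots> = x $ i + (z - 1) * a $ i * (x \<bullet>c a)"
    using i by (simp add: sum.distrib cscalar_prod_sum[OF a] sum_distrib_left)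
  finally show "(pseudo_refl n a z *\<^sub>v x) $ i = (x + ((z - 1) * (x \<bullet>c a)) \<cdot>\<^sub>v a) $ i"
    using i a x by simp
qed (use a pseudo_refl_carrier[of n a z] in auto)

lemma pseudo_refl_mult:
  assumes a: "a \<in> carrier_vec n" "a \<bullet>c a = 1"
  shows "pseudo_refl n a y * pseudo_refl n a z = pseudo_refl n a (y * z)"
proof (rule eq_matI)
  note c = pseudo_refl_carrier
  show "dim_row (pseudo_refl n a y * pseudo_refl n a z) = dim_row (pseudo_refl n a (y * z))"
    "dim_col (pseudo_refl n a y * pseudo_refl n a z) = dim_col (pseudo_refl n a (y * z))"
    by (simp_all add: pseudo_refl_def)
  fix i j assume "i < dim_row (pseudo_refl n a (y * z))" "j < dim_col (pseudo_refl n a (y * z))"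
  then have ij: "i < n" "j < n" by (simp_all add: pseudo_refl_def)
  have aa: "(\<Sum>l<n. a $ l * cnj (a $ l)) = 1" using a cscalar_prod_sum[OF a(1), of a] by simp
  have "(pseudo_refl n a y * pseudo_refl n a z) $$ (i, j)
    = (\<Sum>l<n. pseudo_refl n a y $$ (i, l) * pseudo_refl n a z $$ (l, j))"
    by (rule mult_mat_sum[OF c c ij])
  also have "\<dots> = (\<Sum>l<n. (if l = i then (if l = j then 1 else 0) + (z - 1) * (a $ l * cnj (a $ j)) else 0)
      + (if l = j then (y - 1) * (a $ i * cnj (a $ l)) else 0)
      + (y - 1) * (z - 1) * (a $ i * cnj (a $ j)) * (a $ l * cnj (a $ l)))"
    using ij by (intro sum.cong refl) (auto simp: pseudo_refl_def algebra_simps)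
  also have "\<dots> = (if i = j then 1 else 0) + (z - 1) * (a $ i * cnj (a $ j)) + (y - 1) * (a $ i * cnj (a $ j))
      + (y - 1) * (z - 1) * (a $ i * cnj (a $ j))"
    using ij by (simp add: sum.distrib aa flip: sum_distrib_left)
  also have "\<dots> = pseudo_refl n a (y * z) $$ (i, j)"
    using ij by (simp add: pseudo_refl_def algebra_simps)
  finally show "(pseudo_refl n a y * pseudo_refl n a z) $$ (i, j) = pseudo_refl n a (y * z) $$ (i, j)" .
qed

lemma pseudo_refl_one: "pseudo_refl n a 1 = 1\<^sub>m n"
  by (rule eq_matI) (auto simp: pseudo_refl_def)

lemma pseudo_refl_adjoint: "mat_adjoint (pseudo_refl n a z) = pseudo_refl n a (cnj z)"
proof (rule eq_matI)
  note c = mat_adjoint_carrier[OF pseudo_refl_carrier[of n a z]] pseudo_refl_carrier[of n a "cnj z"]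
  show "dim_row (mat_adjoint (pseudo_refl n a z)) = dim_row (pseudo_refl n a (cnj z))"
    "dim_col (mat_adjoint (pseudo_refl n a z)) = dim_col (pseudo_refl n a (cnj z))" using c by auto
  fix i j assume "i < dim_row (pseudo_refl n a (cnj z))" "j < dim_col (pseudo_refl n a (cnj z))"
  then have "i < n" "j < n" using c by auto
  moreover from this have "mat_adjoint (pseudo_refl n a z) $$ (i, j) = cnj (pseudo_refl n a z $$ (j, i))"
    by (rule mat_adjoint_index[OF pseudo_refl_carrier])
  ultimately show "mat_adjoint (pseudo_refl n a z) $$ (i, j) = pseudo_refl n a (cnj z) $$ (i, j)"
    by (auto simp: pseudo_refl_def mult.commute)
qed

lemma pseudo_refl_unitary:
  assumes "a \<in> carrier_vec n" "a \<bullet>c a = 1" "cmod z = 1"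
  shows "pseudo_refl n a z \<in> carrier (unitary_group n)"
proof -
  have "z * cnj z = 1" using assms(3) complex_norm_square[of z] by simp
  then show ?thesis
    by (simp add: unitary_group_def pseudo_refl_carrier pseudo_refl_adjoint
        pseudo_refl_mult[OF assms(1,2)] pseudo_refl_one mult.commute)
qed

section \<open>Invariance of Haar measure on matrix groups\<close>

lemma mult_unitary_group: "mult (unitary_group n) = (*)"
  by (simp add: unitary_group_def)

lemma unitary_group_closed:
  assumes "u \<in> carrier (unitary_group n)" "v \<in> carrier (unitary_group n)"
  shows "u * v \<in> carrier (unitary_group n)"
proof -
  have u: "u \<in> carrier_mat n n" "mat_adjoint u * u = 1\<^sub>m n" "u * mat_adjoint u = 1\<^sub>m n"
    and v: "v \<in> carrier_mat n n" "mat_adjoint v * v = 1\<^sub>m n" "v * mat_adjoint v = 1\<^sub>m n"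
    using assms by (auto simp: unitary_group_def)
  note au = mat_adjoint_carrier[OF u(1)] and av = mat_adjoint_carrier[OF v(1)]
  note uv = mult_carrier_mat[OF u(1) v(1)]
  have "mat_adjoint v * mat_adjoint u * (u * v) = mat_adjoint v * (mat_adjoint u * (u * v))"
    by (rule assoc_mult_mat[OF av au uv])
  also have "mat_adjoint u * (u * v) = v"
    using assoc_mult_mat[OF au u(1) v(1)] u(2) v(1) by simp
  finally have 1: "mat_adjoint v * mat_adjoint u * (u * v) = 1\<^sub>m n" using v(2) by simp
  have "u * v * (mat_adjoint v * mat_adjoint u) = u * (v * (mat_adjoint v * mat_adjoint u))"
    by (rule assoc_mult_mat[OF u(1) v(1) mult_carrier_mat[OF av au]])
  also have "v * (mat_adjoint v * mat_adjoint u) = mat_adjoint u"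
    using assoc_mult_mat[OF v(1) av au] v(3) au by simp
  finally have 2: "u * v * (mat_adjoint v * mat_adjoint u) = 1\<^sub>m n" using u(3) by simp
  show ?thesis using 1 2 uv by (simp add: unitary_group_def mat_adjoint_mult[OF u(1) v(1)])
qed

lemma unitary_isometry:
  assumes "u \<in> carrier (unitary_group n)" "x \<in> carrier_vec n"
  shows "u *\<^sub>v x \<in> carrier_vec n" "(u *\<^sub>v x) \<bullet>c (u *\<^sub>v x) = x \<bullet>c x"
proof -
  have u: "u \<in> carrier_mat n n" "mat_adjoint u * u = 1\<^sub>m n" using assms by (auto simp: unitary_group_def)
  show ux: "u *\<^sub>v x \<in> carrier_vec n" by (rule mult_mat_vec_carrier[OF u(1) assms(2)])
  have "mat_adjoint u *\<^sub>v (u *\<^sub>v x) = x"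
    using assoc_mult_mat_vec[OF mat_adjoint_carrier[OF u(1)] u(1) assms(2)] u(2) assms(2) by simp
  then show "(u *\<^sub>v x) \<bullet>c (u *\<^sub>v x) = x \<bullet>c x"
    using cscalar_prod_adjoint[OF u(1) assms(2) ux] by simp
qed

text \<open>Covers both U(V) and the orthogonal group of V_J, the latter realised inside the unitary
  matrices, so that measurability and invariance are derived once.\<close>

locale haar_matrix_group =
  fixes n :: nat and K :: "complex mat monoid" and H :: "complex mat measure"
  assumes haar: "haar_prob n K H" and sub: "carrier K \<subseteq> carrier (unitary_group n)"
    and mult_K: "mult K = (*)"
    and closed: "\<And>u v. u \<in> carrier K \<Longrightarrow> v \<in> carrier K \<Longrightarrow> u * v \<in> carrier K"
begin

sublocale prob_space H using haar by (simp add: haar_prob_def)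

lemma space_H: "space H = carrier K" using haar by (simp add: haar_prob_def)

lemma sets_H: "sets H = sets (matrix_borel n (carrier K))" using haar by (simp add: haar_prob_def)

lemma K_carrier: "u \<in> carrier K \<Longrightarrow> u \<in> carrier_mat n n"
  using sub by (auto simp: unitary_group_def)

lemma entry_measurable:
  assumes "a < n" "b < n"
  shows "(\<lambda>u. u $$ (a, b)) \<in> borel_measurable H"
proof (rule measurableI)
  fix B :: "complex set" assume B: "B \<in> sets borel"
  have "(\<lambda>u. u $$ (a, b)) -` B \<inter> space H = {u \<in> carrier K. u $$ (a, b) \<in> B}"
    by (auto simp: space_H)
  also have "\<dots> \<in> sets (matrix_borel n (carrier K))"
    unfolding matrix_borel_def using assms B
    by (subst sets_measure_of) (auto intro!: sigma_sets.Basic)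
  finally show "(\<lambda>u. u $$ (a, b)) -` B \<inter> space H \<in> sets H" by (simp add: sets_H)
qed simp

text \<open>The entries of u x are linear in those of x, and the entries generate the
  sigma-algebra.\<close>

lemma mult_measurable:
  assumes u: "u \<in> carrier K"
  shows "(\<lambda>x. u * x) \<in> measurable H H"
proof -
  have "(\<lambda>x. u * x) \<in> measurable H (matrix_borel n (carrier K))"
    unfolding matrix_borel_def
  proof (rule measurable_measure_of)
    show "(\<lambda>x. u * x) \<in> space H \<rightarrow> carrier K" using closed u by (auto simp: space_H)
    fix Y assume "Y \<in> {{w \<in> carrier K. w $$ (a, b) \<in> B} |a b B. a < n \<and> b < n \<and> B \<in> sets borel}"
    then obtain a b B where Y: "Y = {w \<in> carrier K. w $$ (a, b) \<in> B}" and ab: "a < n" "b < n"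
      and B: "B \<in> sets borel" by auto
    have "(\<lambda>x. \<Sum>l<n. u $$ (a, l) * x $$ (l, b)) \<in> borel_measurable H"
      using ab by (intro borel_measurable_sum borel_measurable_times borel_measurable_const entry_measurable) auto
    from measurable_sets[OF this B]
    have "(\<lambda>x. \<Sum>l<n. u $$ (a, l) * x $$ (l, b)) -` B \<inter> space H \<in> sets H" .
    also have "(\<lambda>x. \<Sum>l<n. u $$ (a, l) * x $$ (l, b)) -` B \<inter> space H = (\<lambda>x. u * x) -` Y \<inter> space H"
      using u closed mult_mat_sum[OF K_carrier[OF u] K_carrier ab]
      by (auto simp: Y space_H simp del: index_mult_mat)
    finally show "(\<lambda>x. u * x) -` Y \<inter> space H \<in> sets H" .
  qed auto
  then show ?thesis
    by (subst measurable_cong_sets[OF refl sets_H])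
qed

lemma mult_invariant: "u \<in> carrier K \<Longrightarrow> distr H H (\<lambda>x. u * x) = H"
  using haar by (simp add: haar_prob_def mult_K)

lemma mult_vec_measurable:
  assumes "x \<in> carrier_vec n" "a < n"
  shows "(\<lambda>u. (u *\<^sub>v x) $ a) \<in> borel_measurable H"
proof (subst measurable_cong[where g="\<lambda>u. \<Sum>l<n. u $$ (a, l) * x $ l"])
  show "(u *\<^sub>v x) $ a = (\<Sum>l<n. u $$ (a, l) * x $ l)" if "u \<in> space H" for u
    using mult_mat_vec_sum[OF K_carrier assms] that by (simp add: space_H)
  show "(\<lambda>u. \<Sum>l<n. u $$ (a, l) * x $ l) \<in> borel_measurable H"
    using assms by (intro borel_measurable_sum borel_measurable_times borel_measurable_const entry_measurable) auto
qed

lemma cscalar_prod_measurable: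
  assumes "x \<in> carrier_vec n" "y \<in> carrier_vec n"
  shows "(\<lambda>u. (u *\<^sub>v x) \<bullet>c y) \<in> borel_measurable H"
  unfolding cscalar_prod_sum[OF assms(2)] using assms
  by (intro borel_measurable_sum borel_measurable_times borel_measurable_const mult_vec_measurable) auto

lemma assoc_K: "u \<in> carrier K \<Longrightarrow> v \<in> carrier K \<Longrightarrow> x \<in> carrier_vec n \<Longrightarrow> (u * v) *\<^sub>v x = u *\<^sub>v (v *\<^sub>v x)"
  using assoc_mult_mat_vec[OF K_carrier K_carrier] by blast

end

section \<open>Concentration of a single eigenfunction\<close>

text \<open>\<open>a g\<close> stands for the real coordinates of \<pi>(g) v and \<open>X\<close>
  for those of w. The real dimension D cancels between the norm bound \<open>B\<close> and the scale
  s B / D of \<open>qform_tail\<close>, which is why the conclusion contains only d.\<close>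

lemma (in random_unit_vector) mu_tail:
  fixes a :: "'g \<Rightarrow> 'i \<Rightarrow> real" and f :: "'g \<Rightarrow> real"
  assumes stein and \<pi>: "finite_unitary_rep G \<pi> d" and irr: "irreducible_unitary_rep G \<pi>"
    and v: "v \<in> carrier_vec d" "v \<bullet>c v = 1"
    and a: "\<And>g h. g \<in> carrier G \<Longrightarrow> h \<in> carrier G \<Longrightarrow> dotp I (a g) (a h) = Re ((\<pi> g *\<^sub>v v) \<bullet>c (\<pi> h *\<^sub>v v))"
    and t: "t > 0"
  shows "prob {\<omega> \<in> space M.
      \<bar>(\<Sum>g\<in>carrier G. f g * (real (card I) / real (order G) * (dotp I (a g) (X \<omega>))\<^sup>2))
        - (\<Sum>g\<in>carrier G. f g) / real (order G)\<bar> > t * (l2_norm G f / sqrt (real (order G)))}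
    \<le> 3 * exp (- (t * sqrt (real d) / 12))"
proof -
  interpret P: finite_unitary_rep G \<pi> d by fact
  define D where "D = real (card I)"
  have D: "D > 0" using finite_I I_nonempty by (simp add: D_def card_gt_0_iff)
  define N where "N = real (order G)"
  have N: "N > 0" using P.order_pos by (simp add: N_def)
  have d: "d > 0" using irr by (simp add: irreducible_unitary_rep_def P.d_eq)
  define Q where "Q i j = (\<Sum>g\<in>carrier G. D / N * f g * (a g i * a g j))" for i j
  have sym: "symmetric_on I Q" by (simp add: symmetric_on_def Q_def mult_ac)
  have qf: "qform I Q x = (\<Sum>g\<in>carrier G. f g * (D / N * (dotp I (a g) x)\<^sup>2))" for x
  proof -
    have "qform I Q x = (\<Sum>i\<in>I. \<Sum>j\<in>I. \<Sum>g\<in>carrier G. D / N * f g * ((a g i * x i) * (a g j * x j)))"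
      unfolding qform_def dotp_def lapply_def Q_def
      by (simp add: sum_distrib_left sum_distrib_right mult_ac)
    also have "\<dots> = (\<Sum>i\<in>I. \<Sum>g\<in>carrier G. \<Sum>j\<in>I. D / N * f g * ((a g i * x i) * (a g j * x j)))"
      by (intro sum.cong refl sum.swap)
    also have "\<dots> = (\<Sum>g\<in>carrier G. \<Sum>i\<in>I. \<Sum>j\<in>I. D / N * f g * ((a g i * x i) * (a g j * x j)))"
      by (rule sum.swap)
    also have "\<dots> = (\<Sum>g\<in>carrier G. D / N * f g * (dotp I (a g) x * dotp I (a g) x))"
      by (simp only: dotp_def sum_product) (simp only: sum_distrib_left)
    finally show ?thesis by (simp add: power2_eq_square mult_ac)
  qed
  have aa: "dotp I (a g) (a g) = 1" if "g \<in> carrier G" for g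
    using a[OF that that] P.rep_isometry[OF that v(1) v(1)] v(2) by simp
  have trQ: "tr I Q = D / N * (\<Sum>g\<in>carrier G. f g)"
  proof -
    have "tr I Q = (\<Sum>g\<in>carrier G. \<Sum>i\<in>I. D / N * f g * (a g i * a g i))"
      unfolding tr_def Q_def by (rule sum.swap)
    also have "\<dots> = (\<Sum>g\<in>carrier G. D / N * f g * dotp I (a g) (a g))"
      unfolding dotp_def sum_distrib_left by simp
    finally show ?thesis by (simp add: aa sum_distrib_left)
  qed
  have avg: "tr I Q / real (card I) = (\<Sum>g\<in>carrier G. f g) / real (order G)"
    using D unfolding trQ N_def[symmetric] D_def[symmetric] by simp
  define c where "c g h = (dotp I (a g) (a h))\<^sup>2" for g h
  have c_sym: "c g h = c h g" for g h by (simp add: c_def dotp_commute)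
  \<comment> \<open>Row sums of the kernel \<open>c\<close>: after (Re z)^2 <= |z|^2, translation by
    the inverse of g reduces each of them to the norm of one diagonal coefficient, known from
    \<open>schur_norm\<close>.\<close>
  have c_sum: "(\<Sum>h\<in>carrier G. c g h) \<le> N / real d" if g: "g \<in> carrier G" for g
  proof -
    have c_le: "c g h \<le> (cmod (diag_coeff \<pi> v (inv\<^bsub>G\<^esub> g \<otimes>\<^bsub>G\<^esub> h)))\<^sup>2" if h: "h \<in> carrier G" for h
    proof -
      have "(\<pi> h *\<^sub>v v) \<bullet>c (\<pi> g *\<^sub>v v) = diag_coeff \<pi> v (inv\<^bsub>G\<^esub> g \<otimes>\<^bsub>G\<^esub> h)"
        using P.rep_isometry[OF P.inv_closed[OF g] P.rep_vec_carrier[OF h v(1)] P.rep_vec_carrier[OF g v(1)]]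
          P.rep_mult_vec[OF P.inv_closed[OF g] h v(1)] P.rep_mult_vec[OF P.inv_closed[OF g] g v(1)]
          g v(1) P.rep_one by (simp add: diag_coeff_def)
      then have "c g h = (Re (diag_coeff \<pi> v (inv\<^bsub>G\<^esub> g \<otimes>\<^bsub>G\<^esub> h)))\<^sup>2"
        using a[OF h g] by (simp add: c_def dotp_commute[of I "a g"])
      then show ?thesis by (simp add: cmod_power2)
    qed
    have "(\<Sum>h\<in>carrier G. c g h) \<le> (\<Sum>h\<in>carrier G. (cmod (diag_coeff \<pi> v (inv\<^bsub>G\<^esub> g \<otimes>\<^bsub>G\<^esub> h)))\<^sup>2)"
      by (intro sum_mono c_le)
    also have "\<dots> = (\<Sum>h\<in>carrier G. (cmod (diag_coeff \<pi> v h))\<^sup>2)"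
      using P.sum_left_translate[of "inv\<^bsub>G\<^esub> g"] g by simp
    also have "\<dots> = N / real d"
    proof -
      have "complex_of_real (\<Sum>h\<in>carrier G. (cmod (diag_coeff \<pi> v h))\<^sup>2) = of_real (N / real d)"
        using schur_norm[OF \<pi> irr v]
        by (simp add: complex_norm_square N_def del: of_real_power)
      then show ?thesis by (simp only: of_real_eq_iff)
    qed
    finally show ?thesis .
  qed
  have l2: "(l2_norm G f)\<^sup>2 = (\<Sum>g\<in>carrier G. (f g)\<^sup>2)"
    by (simp add: l2_norm_def sum_nonneg)
  define B where "B = D * l2_norm G f / (sqrt N * sqrt (real d))"
  have frob: "frob2 I Q \<le> B\<^sup>2"
  proof -
    have "frob2 I Q = (\<Sum>i\<in>I. \<Sum>j\<in>I. \<Sum>g\<in>carrier G. \<Sum>h\<in>carrier G.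
        (D / N)\<^sup>2 * (f g * f h) * ((a g i * a h i) * (a g j * a h j)))"
      unfolding frob2_def Q_def power2_eq_square sum_product by (simp add: mult_ac)
    also have "\<dots> = (\<Sum>i\<in>I. \<Sum>g\<in>carrier G. \<Sum>j\<in>I. \<Sum>h\<in>carrier G.
        (D / N)\<^sup>2 * (f g * f h) * ((a g i * a h i) * (a g j * a h j)))"
      by (intro sum.cong refl sum.swap)
    also have "\<dots> = (\<Sum>g\<in>carrier G. \<Sum>i\<in>I. \<Sum>j\<in>I. \<Sum>h\<in>carrier G.
        (D / N)\<^sup>2 * (f g * f h) * ((a g i * a h i) * (a g j * a h j)))"
      by (rule sum.swap)
    also have "\<dots> = (\<Sum>g\<in>carrier G. \<Sum>i\<in>I. \<Sum>h\<in>carrier G. \<Sum>j\<in>I.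
        (D / N)\<^sup>2 * (f g * f h) * ((a g i * a h i) * (a g j * a h j)))"
      by (intro sum.cong refl sum.swap)
    also have "\<dots> = (\<Sum>g\<in>carrier G. \<Sum>h\<in>carrier G. \<Sum>i\<in>I. \<Sum>j\<in>I.
        (D / N)\<^sup>2 * (f g * f h) * ((a g i * a h i) * (a g j * a h j)))"
      by (intro sum.cong refl sum.swap)
    also have "\<dots> = (\<Sum>g\<in>carrier G. \<Sum>h\<in>carrier G. (D / N)\<^sup>2 * (f g * f h) * c g h)"
      by (simp only: c_def dotp_def power2_eq_square[of "sum _ _"] sum_product) (simp only: sum_distrib_left)
    \<comment> \<open>Schur test: the arithmetic-geometric mean and the symmetry of \<open>c\<close>
      bound its quadratic form at f by the row-sum bound N / d times the squared norm of f.\<close>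
    also have "\<dots> \<le> (\<Sum>g\<in>carrier G. \<Sum>h\<in>carrier G. (D / N)\<^sup>2 * (((f g)\<^sup>2 + (f h)\<^sup>2) / 2) * c g h)"
    proof (intro sum_mono mult_right_mono mult_left_mono)
      show "f g * f h \<le> ((f g)\<^sup>2 + (f h)\<^sup>2) / 2" for g h
        using sum_squares_bound[of "f g" "f h"] by simp
      show "0 \<le> c g h" for g h by (simp add: c_def)
    qed auto
    also have "\<dots> = (D / N)\<^sup>2 / 2 * (\<Sum>g\<in>carrier G. \<Sum>h\<in>carrier G. (f g)\<^sup>2 * c g h)
       + (D / N)\<^sup>2 / 2 * (\<Sum>g\<in>carrier G. \<Sum>h\<in>carrier G. (f h)\<^sup>2 * c g h)"
      unfolding sum_distrib_left sum.distrib[symmetric]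
      by (intro sum.cong refl) (simp add: algebra_simps add_divide_distrib)
    also have "(\<Sum>g\<in>carrier G. \<Sum>h\<in>carrier G. (f h)\<^sup>2 * c g h) = (\<Sum>g\<in>carrier G. \<Sum>h\<in>carrier G. (f g)\<^sup>2 * c g h)"
      by (subst sum.swap) (simp add: c_sym)
    also have "(D / N)\<^sup>2 / 2 * (\<Sum>g\<in>carrier G. \<Sum>h\<in>carrier G. (f g)\<^sup>2 * c g h)
       + (D / N)\<^sup>2 / 2 * (\<Sum>g\<in>carrier G. \<Sum>h\<in>carrier G. (f g)\<^sup>2 * c g h)
       = (D / N)\<^sup>2 * (\<Sum>g\<in>carrier G. (f g)\<^sup>2 * (\<Sum>h\<in>carrier G. c g h))"
      by (simp add: sum_distrib_left)
    also have "\<dots> \<le> (D / N)\<^sup>2 * (\<Sum>g\<in>carrier G. (f g)\<^sup>2 * (N / real d))"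
      by (intro mult_left_mono sum_mono c_sum) auto
    also have "\<dots> = (D / N)\<^sup>2 * ((l2_norm G f)\<^sup>2 * (N / real d))"
      by (simp only: l2 sum_distrib_right)
    also have "\<dots> = B\<^sup>2"
      using N d by (simp add: B_def power_divide power_mult_distrib power2_eq_square[of N])
    finally show ?thesis .
  qed
  let ?E = "{\<omega> \<in> space M. \<bar>qform I Q (X \<omega>) - tr I Q / real (card I)\<bar> > t * (l2_norm G f / sqrt N)}"
  have "prob ?E \<le> 3 * exp (- (t * sqrt (real d) / 12))"
  \<comment> \<open>\<open>qform_tail\<close> needs B > 0. If f vanishes on the group, both sides of
    the strict inequality are 0 and the event is empty.\<close>
  proof (cases "l2_norm G f = 0")
    case True
    then have "(\<Sum>g\<in>carrier G. (f g)\<^sup>2) = 0" using l2 by simp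
    then have "f g = 0" if "g \<in> carrier G" for g
      using that P.finite_G by (subst (asm) sum_nonneg_eq_0_iff) auto
    then have "?E = {}" using True by (simp add: qf trQ)
    then have "prob ?E = 0" by (simp only: measure_empty)
    then show ?thesis by simp
  next
    case False
    moreover have "l2_norm G f \<ge> 0" by (simp add: l2_norm_def sum_nonneg)
    ultimately have B: "B > 0" using D N d by (simp add: B_def)
    have "t * sqrt (real d) * B / real (card I) = t * (l2_norm G f / sqrt N)"
      using D d unfolding D_def[symmetric] B_def by simp
    then show ?thesis
      using qform_tail[OF \<open>stein\<close> sym frob B, of "t * sqrt (real d)"] t d by simp
  qed
  then show ?thesis by (simp only: qf avg D_def N_def)
qed

section \<open>Unitary case: C^d as a Euclidean space of real dimension 2d\<close>

definition realify :: "complex vec \<Rightarrow> nat \<times> bool \<Rightarrow> real" where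
  "realify x = (\<lambda>(m, b). if b then Re (x $ m) else Im (x $ m))"

lemma sum_times_bool: "(\<Sum>i\<in>{..<n::nat} \<times> UNIV. h i) = (\<Sum>m<n. h (m, True) + h (m, False))"
proof -
  have "(\<Sum>m<n. \<Sum>b\<in>UNIV. h (m, b)) = (\<Sum>i\<in>{..<n} \<times> UNIV. h i)"
    by (simp add: sum.cartesian_product)
  then show ?thesis by (simp add: UNIV_bool add.commute)
qed

lemma dotp_realify:
  assumes "y \<in> carrier_vec n"
  shows "dotp ({..<n} \<times> UNIV) (realify x) (realify y) = Re (x \<bullet>c y)"
  unfolding cscalar_prod_sum[OF assms] dotp_def sum_times_bool by (simp add: realify_def)

lemma unitary_tail:
  assumes \<pi>: "finite_unitary_rep G \<pi> d" and irr: "irreducible_unitary_rep G \<pi>"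
    and H: "haar_prob d (unitary_group d) H"
    and v: "v \<in> carrier_vec d" "v \<bullet>c v = 1" and x0: "x0 \<in> carrier_vec d" "x0 \<bullet>c x0 = 1"
    and t: "t > 0"
  shows "measure H {u \<in> space H.
      \<bar>(\<Sum>g\<in>carrier G. f g * (2 * real d / real (order G) * (Re ((\<pi> g *\<^sub>v v) \<bullet>c (u *\<^sub>v x0)))\<^sup>2))
        - (\<Sum>g\<in>carrier G. f g) / real (order G)\<bar> > t * (l2_norm G f / sqrt (real (order G)))}
    \<le> 3 * exp (- (t * sqrt (real d) / 12))"
proof -
  interpret P: finite_unitary_rep G \<pi> d by fact
  interpret haar_matrix_group d "unitary_group d" H
    by unfold_locales (use H unitary_group_closed in \<open>auto simp: mult_unitary_group\<close>)
  have d: "d > 0" using irr by (simp add: irreducible_unitary_rep_def P.d_eq)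
  define I where "I = {..<d} \<times> (UNIV :: bool set)"
  have wc: "u *\<^sub>v x0 \<in> carrier_vec d" if "u \<in> space H" for u
    using that unitary_isometry(1)[OF _ x0(1)] by (simp add: space_H)
  interpret random_unit_vector H I "\<lambda>u. realify (u *\<^sub>v x0)"
  proof
    show "finite I" "I \<noteq> {}" using d by (auto simp: I_def)
    show "(\<lambda>u. realify (u *\<^sub>v x0) i) \<in> borel_measurable H" if iI: "i \<in> I" for i
    proof -
      obtain m b where i: "i = (m, b)" "m < d" using iI by (auto simp: I_def)
      note mult_vec_measurable[OF x0(1) i(2), measurable]
      show ?thesis unfolding i realify_def by (cases b) simp_all
    qed
    show "dotp I (realify (u *\<^sub>v x0)) (realify (u *\<^sub>v x0)) = 1" if "u \<in> space H" for u
      using that unitary_isometry(2)[OF _ x0(1)] x0(2) wc[OF that]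
      by (simp add: I_def dotp_realify space_H)
  qed
  \<comment> \<open>\<open>\<sigma>\<close> exchanges the real and imaginary part of a coordinate
    and \<open>s\<close> carries the sign, so that \<Omega> sends (Re, Im) to (-Im, Re), which is
    multiplication by i.\<close>
  define \<sigma> where "\<sigma> = (\<lambda>(m :: nat, b). (m, \<not> b))"
  define s where "s = (\<lambda>(m :: nat, b). if b then 1 else - 1 :: real)"
  have stein
  proof (rule stein_unitary[of \<sigma> s])
    fix c :: "nat \<times> bool \<Rightarrow> real"
    define oc where "oc i = s (\<sigma> i) * c (\<sigma> i)" for i
    have oc: "oc (m, True) = - c (m, False)" "oc (m, False) = c (m, True)" for m
      by (simp_all add: oc_def \<sigma>_def s_def)
    define C where "C = vec d (\<lambda>m. Complex (c (m, True)) (c (m, False)))"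
    have C: "C \<in> carrier_vec d" by (simp add: C_def)
    define Z where "Z = (\<Sum>m<d. (cmod (C $ m))\<^sup>2)"
    have CC: "C \<bullet>c C = of_real Z" unfolding Z_def by (rule cscalar_prod_self[OF C])
    have Z0: "Z \<ge> 0" by (simp add: Z_def sum_nonneg)
    have p: "dotp I c (realify w) = Re (w \<bullet>c C)" "dotp I oc (realify w) = Im (w \<bullet>c C)" for w
      unfolding cscalar_prod_sum[OF C] dotp_def I_def sum_times_bool
      by (auto simp: realify_def oc C_def algebra_simps intro!: sum.cong)
    let ?X = "\<lambda>u. realify (u *\<^sub>v x0)"
    show "killing (rot_gen c (\<lambda>i. s (\<sigma> i) * c (\<sigma> i)))"
    proof -
      define Y where "Y i u = dotp I c (?X u) * c i + dotp I oc (?X u) * oc i" for i u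
      have "killing (rot_gen c oc)"
      \<comment> \<open>Z = 0 says only that \<open>c\<close> vanishes on \<open>I\<close>. It may
        be nonzero elsewhere, so \<open>rot_gen c oc\<close> need not be the zero matrix; it acts as
        zero on \<open>I\<close>, and the constant flow fits it.\<close>
      proof (cases "Z = 0")
        case True
        have C0: "C $ m = 0" if "m < d" for m
        proof -
          have "(cmod (C $ m))\<^sup>2 = 0"
            using True that unfolding Z_def by (subst (asm) sum_nonneg_eq_0_iff) auto
          then show ?thesis by simp
        qed
        have c0: "c i = 0" "oc i = 0" if iI: "i \<in> I" for i
        proof -
          obtain m b where i: "i = (m, b)" "m < d" using iI by (auto simp: I_def)
          have "c (m, True) = 0" "c (m, False) = 0"
            using C0[OF i(2)] i(2) by (simp_all add: C_def complex_eq_iff)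
          then show "c i = 0" "oc i = 0" by (cases b; simp add: i oc)+
        qed
        show ?thesis
          by (rule killing_rotation[where \<Phi>="\<lambda>t u. u" and \<alpha>="\<lambda>_. 0" and \<beta>="\<lambda>t. t" and Y="\<lambda>_ _. 0" and C=0])
             (auto simp: lapply_rot_gen c0 bdd_rv_const distr_id)
      next
        case False
        then have Z: "Z > 0" using Z0 by simp
        define a where "a = complex_of_real (1 / sqrt Z) \<cdot>\<^sub>v C"
        have a: "a \<in> carrier_vec d" using C by (simp add: a_def)
        have wa: "w \<bullet>c a = of_real (1 / sqrt Z) * (w \<bullet>c C)" for w
          unfolding cscalar_prod_sum[OF a] cscalar_prod_sum[OF C] sum_distrib_left
          using C by (intro sum.cong refl) (simp add: a_def)
        have "a \<bullet>c a = 1"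
        proof -
          have "a \<bullet>c a = of_real (1 / sqrt Z) * (of_real (1 / sqrt Z) * (C \<bullet>c C))"
            unfolding wa unfolding a_def using C by simp
          also have "\<dots> = complex_of_real (1 / sqrt Z * (1 / sqrt Z * Z))" by (simp only: CC of_real_mult)
          also have "1 / sqrt Z * (1 / sqrt Z * Z) = 1"
            using Z by (simp add: field_simps)
          finally show ?thesis by simp
        qed
        \<comment> \<open>The generator is quadratic in c, so the angle is Z t with Z = |C|^2: U_t w
          = w + ((e^(iZt) - 1) / Z) <w, C> C. Its derivative at 0 is i <w, C> C, the field of
          \<open>rot_gen c oc\<close>.\<close>
        define U where "U t = pseudo_refl d a (cis (Z * t))" for t
        have U: "U t \<in> carrier (unitary_group d)" for t
          unfolding U_def by (rule pseudo_refl_unitary[OF a \<open>a \<bullet>c a = 1\<close>]) simp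
        define \<alpha> where "\<alpha> t = (cos (Z * t) - 1) / Z" for t
        define \<beta> where "\<beta> t = sin (Z * t) / Z" for t
        have Ux: "U t *\<^sub>v w = w + (Complex (\<alpha> t) (\<beta> t) * (w \<bullet>c C)) \<cdot>\<^sub>v C" if w: "w \<in> carrier_vec d" for t w
        proof -
          have "(cis (Z * t) - 1) * of_real (1 / sqrt Z) * of_real (1 / sqrt Z) = Complex (\<alpha> t) (\<beta> t)"
            using Z by (simp add: complex_eq_iff \<alpha>_def \<beta>_def field_simps)
          then have "(cis (Z * t) - 1) * (of_real (1 / sqrt Z) * (w \<bullet>c C)) * of_real (1 / sqrt Z)
            = Complex (\<alpha> t) (\<beta> t) * (w \<bullet>c C)"
            by (simp only: mult_ac flip: \<open>_ = Complex (\<alpha> t) (\<beta> t)\<close>)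
          then show ?thesis
            unfolding U_def pseudo_refl_vec[OF a w] wa unfolding a_def smult_smult_assoc by simp
        qed
        show ?thesis
        proof (rule killing_rotation[where \<Phi>="\<lambda>t u. U t * u" and \<alpha>=\<alpha> and \<beta>=\<beta> and Y=Y and C="Z"])
          show "bdd_rv (Y i)" if "i \<in> I" for i
            unfolding Y_def by (intro bdd_rv_add bdd_rv_mult bdd_rv_const bdd_rv_dotp bdd_rv_X)
          have half: "(Z * t)\<^sup>2 / 2 / Z \<le> Z * t\<^sup>2" for t
            using Z by (simp add: power2_eq_square)
          show "\<bar>\<alpha> t\<bar> \<le> Z * t\<^sup>2" for t
          proof -
            have "\<bar>\<alpha> t\<bar> = \<bar>cos (Z * t) - 1\<bar> / Z" using Z by (simp add: \<alpha>_def)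
            also have "\<dots> \<le> (Z * t)\<^sup>2 / 2 / Z"
              using Z by (intro divide_right_mono abs_cos_minus_1_le) simp
            finally show ?thesis using half by (rule order_trans)
          qed
          show "\<bar>\<beta> t - t\<bar> \<le> Z * t\<^sup>2" for t
          proof -
            have "\<beta> t - t = (sin (Z * t) - Z * t) / Z" using Z by (simp add: \<beta>_def diff_divide_distrib)
            then have "\<bar>\<beta> t - t\<bar> = \<bar>sin (Z * t) - Z * t\<bar> / Z" using Z by simp
            also have "\<dots> \<le> (Z * t)\<^sup>2 / 2 / Z"
              using Z by (intro divide_right_mono abs_sin_minus_self_le) simp
            finally show ?thesis using half by (rule order_trans)
          qed
          fix t i u assume i: "i \<in> I" and u: "u \<in> space H"
          obtain m b where mb: "i = (m, b)" "m < d" using i by (auto simp: I_def)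
          have "realify ((U t * u) *\<^sub>v x0) i = realify (U t *\<^sub>v (u *\<^sub>v x0)) i"
            using assoc_K[OF U _ x0(1)] u by (simp add: space_H)
          also have "\<dots> = realify (u *\<^sub>v x0) i
             + (if b then Re ((Complex (\<alpha> t) (\<beta> t) * ((u *\<^sub>v x0) \<bullet>c C)) * C $ m)
                else Im ((Complex (\<alpha> t) (\<beta> t) * ((u *\<^sub>v x0) \<bullet>c C)) * C $ m))"
            unfolding Ux[OF wc[OF u]] using mb wc[OF u] C by (simp add: realify_def)
          also have "\<dots> = realify (u *\<^sub>v x0) i + \<alpha> t * Y i u + \<beta> t * lapply I (rot_gen c oc) (?X u) i"
            unfolding Y_def lapply_rot_gen p using mb
            by (cases b) (simp_all add: oc C_def algebra_simps)
          finally show "realify ((U t * u) *\<^sub>v x0) i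
            = realify (u *\<^sub>v x0) i + \<alpha> t * Y i u + \<beta> t * lapply I (rot_gen c oc) (?X u) i" .
        qed (use U mult_measurable mult_invariant Z in auto)
      qed
      then show ?thesis by (simp add: oc_def[abs_def])
    qed
  qed (auto simp: \<sigma>_def s_def I_def)
  then have "prob {\<omega> \<in> space H.
      \<bar>(\<Sum>g\<in>carrier G. f g * (real (card I) / real (order G) * (dotp I (realify (\<pi> g *\<^sub>v v)) (realify (\<omega> *\<^sub>v x0)))\<^sup>2))
        - (\<Sum>g\<in>carrier G. f g) / real (order G)\<bar> > t * (l2_norm G f / sqrt (real (order G)))}
    \<le> 3 * exp (- (t * sqrt (real d) / 12))"
    using P.rep_vec_carrier[OF _ v(1)]
    by (intro mu_tail[OF _ \<pi> irr v _ t]) (auto simp: I_def dotp_realify)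
  moreover have "real (card I) = 2 * real d" by (simp add: I_def card_cartesian_product UNIV_bool)
  moreover have "{\<omega> \<in> space H.
      \<bar>(\<Sum>g\<in>carrier G. f g * (2 * real d / real (order G) * (dotp I (realify (\<pi> g *\<^sub>v v)) (realify (\<omega> *\<^sub>v x0)))\<^sup>2))
        - (\<Sum>g\<in>carrier G. f g) / real (order G)\<bar> > t * (l2_norm G f / sqrt (real (order G)))}
    = {u \<in> space H.
      \<bar>(\<Sum>g\<in>carrier G. f g * (2 * real d / real (order G) * (Re ((\<pi> g *\<^sub>v v) \<bullet>c (u *\<^sub>v x0)))\<^sup>2))
        - (\<Sum>g\<in>carrier G. f g) / real (order G)\<bar> > t * (l2_norm G f / sqrt (real (order G)))}"
    by (intro Collect_cong conj_cong refl) (simp add: I_def dotp_realify[OF wc])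
  ultimately show ?thesis by simp
qed

section \<open>Orthogonal case: the real form V_J and its rotations\<close>

lemma cscalar_prod_add_left:
  fixes x y z :: "complex vec"
  assumes "x \<in> carrier_vec n" "y \<in> carrier_vec n" "z \<in> carrier_vec n"
  shows "(x + y) \<bullet>c z = x \<bullet>c z + y \<bullet>c z"
  using assms by (simp add: cscalar_prod_sum[OF assms(3)] sum.distrib distrib_right)

lemma cscalar_prod_smult_left:
  fixes x z :: "complex vec"
  assumes "x \<in> carrier_vec n" "z \<in> carrier_vec n"
  shows "(c \<cdot>\<^sub>v x) \<bullet>c z = c * (x \<bullet>c z)"
  using assms by (simp add: cscalar_prod_sum[OF assms(2)] sum_distrib_left mult.assoc)

lemma cscalar_prod_add_right:
  fixes x y z :: "complex vec"
  assumes "x \<in> carrier_vec n" "y \<in> carrier_vec n" "z \<in> carrier_vec n"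
  shows "z \<bullet>c (x + y) = z \<bullet>c x + z \<bullet>c y"
proof -
  have "z \<bullet>c (x + y) = cnj ((x + y) \<bullet>c z)" using assms by (intro cscalar_prod_cnj[symmetric]) auto
  then show ?thesis
    using assms by (simp add: cscalar_prod_add_left[OF assms] cscalar_prod_cnj)
qed

lemma cscalar_prod_smult_right:
  fixes x z :: "complex vec"
  assumes "x \<in> carrier_vec n" "z \<in> carrier_vec n"
  shows "z \<bullet>c (c \<cdot>\<^sub>v x) = cnj c * (z \<bullet>c x)"
proof -
  have "z \<bullet>c (c \<cdot>\<^sub>v x) = cnj ((c \<cdot>\<^sub>v x) \<bullet>c z)" using assms by (intro cscalar_prod_cnj[symmetric]) auto
  then show ?thesis
    using assms by (simp add: cscalar_prod_smult_left[OF assms] cscalar_prod_cnj)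
qed

text \<open>Pairing with the basis recovers the coefficients. For real scalars this makes the
  Hermitian product real-valued on \<open>W\<close>, a fact that is derived from the existence of
  the basis instead of from a property of J.\<close>

lemma orthonormal_basis_expand:
  assumes b: "orthonormal_basis F n W m b" and W: "W \<subseteq> carrier_vec n" and x: "x \<in> W"
  shows "\<And>k. k < m \<Longrightarrow> x \<bullet>c b k \<in> F"
    and "\<And>y. y \<in> carrier_vec n \<Longrightarrow> x \<bullet>c y = (\<Sum>k<m. (x \<bullet>c b k) * cnj (y \<bullet>c b k))"
proof -
  obtain c where c: "\<forall>k<m. c k \<in> F"
    and xc: "x = finsum_vec TYPE(complex) n (\<lambda>k. c k \<cdot>\<^sub>v b k) {..<m}"
    using b x unfolding orthonormal_basis_def by blast
  have bc: "b k \<in> carrier_vec n" if "k < m" for k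
    using b W that unfolding orthonormal_basis_def by blast
  have x_i: "x $ i = (\<Sum>k<m. c k * b k $ i)" if "i < n" for i
    unfolding xc using that bc
    by (subst index_finsum_vec) (auto intro!: sum.cong dest: carrier_vecD[OF bc])
  have exp: "x \<bullet>c y = (\<Sum>k<m. c k * (b k \<bullet>c y))" if y: "y \<in> carrier_vec n" for y
  proof -
    have "x \<bullet>c y = (\<Sum>i<n. \<Sum>k<m. c k * b k $ i * cnj (y $ i))"
      by (simp add: cscalar_prod_sum[OF y] x_i sum_distrib_right)
    also have "\<dots> = (\<Sum>k<m. \<Sum>i<n. c k * b k $ i * cnj (y $ i))" by (rule sum.swap)
    finally show ?thesis by (simp add: cscalar_prod_sum[OF y] sum_distrib_left mult.assoc)
  qed
  have coord: "x \<bullet>c b k = c k" if k: "k < m" for k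
  proof -
    have "x \<bullet>c b k = (\<Sum>j<m. if j = k then c j else 0)"
      unfolding exp[OF bc[OF k]] using b k unfolding orthonormal_basis_def
      by (intro sum.cong refl) auto
    then show ?thesis using k by simp
  qed
  show "x \<bullet>c b k \<in> F" if "k < m" for k using that c by (simp add: coord)
  show "x \<bullet>c y = (\<Sum>k<m. (x \<bullet>c b k) * cnj (y \<bullet>c b k))" if y: "y \<in> carrier_vec n" for y
    unfolding exp[OF y] using bc y by (intro sum.cong refl) (simp add: coord cscalar_prod_cnj)
qed

text \<open>Coordinates in \<open>e\<close> turn w into a unit vector of R^d, so D = d. The second
  conclusion lets the squared modulus in \<open>phi_fun\<close> be replaced by the square of the
  real part.\<close>

lemma orthogonal_tail:
  assumes \<pi>: "finite_unitary_rep G \<pi> d" and irr: "irreducible_unitary_rep G \<pi>"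
    and J: "structure_map G \<pi> 1 J" and e: "orthonormal_basis \<real> d (fixed_space G \<pi> J) d e"
    and H: "haar_prob d (orthogonal_group G \<pi> J) H"
    and v: "v \<in> fixed_space G \<pi> J" "v \<bullet>c v = 1" and x0: "x0 \<in> fixed_space G \<pi> J" "x0 \<bullet>c x0 = 1"
    and t: "t > 0"
  shows "haar_matrix_group d (orthogonal_group G \<pi> J) H"
    and "\<And>u g. u \<in> space H \<Longrightarrow> g \<in> carrier G \<Longrightarrow> (\<pi> g *\<^sub>v v) \<bullet>c (u *\<^sub>v x0) \<in> \<real>"
    and "measure H {u \<in> space H.
      \<bar>(\<Sum>g\<in>carrier G. f g * (real d / real (order G) * (Re ((\<pi> g *\<^sub>v v) \<bullet>c (u *\<^sub>v x0)))\<^sup>2))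
        - (\<Sum>g\<in>carrier G. f g) / real (order G)\<bar> > t * (l2_norm G f / sqrt (real (order G)))}
    \<le> 3 * exp (- (t * sqrt (real d) / 12))"
proof -
  interpret P: finite_unitary_rep G \<pi> d by fact
  have d: "d > 0" using irr by (simp add: irreducible_unitary_rep_def P.d_eq)
  define W where "W = fixed_space G \<pi> J"
  define K where "K = orthogonal_group G \<pi> J"
  have Wc: "x \<in> carrier_vec d" if "x \<in> W" for x
    using that by (simp add: W_def fixed_space_def P.d_eq)
  have J_add: "J (x + y) = J x + J y" if "x \<in> carrier_vec d" "y \<in> carrier_vec d" for x y
    using J that unfolding structure_map_def conjugate_linear_def P.d_eq by blast
  have J_smult: "J (c \<cdot>\<^sub>v x) = cnj c \<cdot>\<^sub>v J x" if "x \<in> carrier_vec d" for c x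
    using J that unfolding structure_map_def conjugate_linear_def P.d_eq by blast
  have J_rep: "J (\<pi> g *\<^sub>v x) = \<pi> g *\<^sub>v J x" if "g \<in> carrier G" "x \<in> carrier_vec d" for g x
    using J that unfolding structure_map_def P.d_eq by blast
  have W_iff: "x \<in> W \<longleftrightarrow> x \<in> carrier_vec d \<and> J x = x" for x
    by (auto simp: W_def fixed_space_def P.d_eq)
  have W_add: "x + y \<in> W" if "x \<in> W" "y \<in> W" for x y
    using that by (simp add: W_iff J_add)
  have W_smult: "c \<cdot>\<^sub>v x \<in> W" if "x \<in> W" "c \<in> \<real>" for c x
    using that by (simp add: W_iff J_smult Reals_cnj_iff)
  have W_rep: "\<pi> g *\<^sub>v x \<in> W" if "g \<in> carrier G" "x \<in> W" for g x
    using that P.rep_vec_carrier by (simp add: W_iff J_rep)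
  have W_sub: "W \<subseteq> carrier_vec d" using Wc by blast
  have eW: "e k \<in> W" if "k < d" for k using e that unfolding orthonormal_basis_def W_def by blast
  have ee: "e j \<bullet>c e k = (if j = k then 1 else 0)" if "j < d" "k < d" for j k
    using e that unfolding orthonormal_basis_def by blast
  note expand = orthonormal_basis_expand[OF e[folded W_def] W_sub]
  have W_real: "x \<bullet>c y \<in> \<real>" if x: "x \<in> W" and y: "y \<in> W" for x y
    unfolding expand(2)[OF x Wc[OF y]]
    using expand(1)[OF x] expand(1)[OF y] by (intro sum_in_Reals Reals_mult) (auto simp: Reals_cnj_iff)
  have K_iff: "u \<in> carrier K \<longleftrightarrow> u \<in> carrier (unitary_group d) \<and> (\<lambda>x. u *\<^sub>v x) ` W = W" for u
    by (simp add: K_def orthogonal_group_def W_def P.d_eq)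
  show haar: "haar_matrix_group d (orthogonal_group G \<pi> J) H"
  proof (unfold_locales, fold K_def)
    show "haar_prob d K H" unfolding K_def by fact
    show "carrier K \<subseteq> carrier (unitary_group d)" using K_iff by blast
    show "monoid.mult K = (*)" by (simp add: K_def orthogonal_group_def P.d_eq mult_unitary_group)
    fix u w assume u: "u \<in> carrier K" and w: "w \<in> carrier K"
    have uc: "u \<in> carrier_mat d d" "w \<in> carrier_mat d d"
      using u w by (auto simp: K_iff unitary_group_def)
    have "(\<lambda>x. (u * w) *\<^sub>v x) ` W = (\<lambda>x. u *\<^sub>v x) ` ((\<lambda>x. w *\<^sub>v x) ` W)"
      unfolding image_image using assoc_mult_mat_vec[OF uc] Wc by (intro image_cong refl) auto
    then show "u * w \<in> carrier K"
      using u w unitary_group_closed by (simp add: K_iff)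
  qed
  interpret haar_matrix_group d K H using haar by (simp add: K_def)
  have K_W: "u *\<^sub>v x \<in> W" if "u \<in> carrier K" "x \<in> W" for u x
    using that K_iff by blast
  have x0W: "x0 \<in> W" and vW: "v \<in> W" using x0 v by (simp_all add: W_def)
  have wW: "u *\<^sub>v x0 \<in> W" if "u \<in> space H" for u using that x0W K_W by (simp add: space_H)
  show "(\<pi> g *\<^sub>v v) \<bullet>c (u *\<^sub>v x0) \<in> \<real>" if "u \<in> space H" "g \<in> carrier G" for u g
    using W_real[OF W_rep[OF that(2) vW] wW[OF that(1)]] .
  define rl where "rl x k = Re (x \<bullet>c e k)" for x k
  have dotp_rl: "dotp {..<d} (rl x) (rl y) = Re (x \<bullet>c y)" if x: "x \<in> W" and y: "y \<in> W" for x y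
  proof -
    have "Re ((x \<bullet>c e k) * cnj (y \<bullet>c e k)) = rl x k * rl y k" if "k < d" for k
      using expand(1)[OF x that] expand(1)[OF y that] by (auto simp: rl_def elim!: Reals_cases)
    then show ?thesis unfolding expand(2)[OF x Wc[OF y]] by (simp add: dotp_def)
  qed
  have refl_W: "pseudo_refl d a (- 1) *\<^sub>v x \<in> W" if a: "a \<in> W" and x: "x \<in> W" for a x
    unfolding pseudo_refl_vec[OF Wc[OF a] Wc[OF x]]
    by (intro W_add x W_smult a Reals_mult W_real) auto
  \<comment> \<open>An involution preserving V_J maps it onto itself, as membership in the group
    demands. Rotations are therefore assembled from reflections.\<close>
  have refl_K: "pseudo_refl d a (- 1) \<in> carrier K" if a: "a \<in> W" "a \<bullet>c a = 1" for a
  proof -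
    let ?r = "pseudo_refl d a (- 1)"
    have "?r *\<^sub>v (?r *\<^sub>v x) = x" if x: "x \<in> W" for x
      using assoc_mult_mat_vec[OF pseudo_refl_carrier[of d a "- 1"] pseudo_refl_carrier[of d a "- 1"] Wc[OF x]]
        pseudo_refl_mult[OF Wc[OF a(1)] a(2), of "- 1" "- 1"] Wc[OF x] by (simp add: pseudo_refl_one)
    then have "(\<lambda>x. ?r *\<^sub>v x) ` W = W"
      using refl_W[OF a(1)] by (intro equalityI subsetI) (auto intro!: image_eqI[of _ _ "?r *\<^sub>v _"])
    then show ?thesis using pseudo_refl_unitary[OF Wc[OF a(1)] a(2), of "- 1"] by (simp add: K_iff)
  qed
  interpret random_unit_vector H "{..<d}" "\<lambda>u. rl (u *\<^sub>v x0)"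
  proof
    show "finite {..<d}" "{..<d} \<noteq> {}" using d by auto
    show "(\<lambda>u. rl (u *\<^sub>v x0) k) \<in> borel_measurable H" if "k \<in> {..<d}" for k
    proof -
      note cscalar_prod_measurable[OF Wc[OF x0W] Wc[OF eW], measurable]
      show ?thesis unfolding rl_def using that by simp
    qed
    show "dotp {..<d} (rl (u *\<^sub>v x0)) (rl (u *\<^sub>v x0)) = 1" if u: "u \<in> space H" for u
      using dotp_rl[OF wW[OF u] wW[OF u]] unitary_isometry(2)[OF _ Wc[OF x0W], of u] u x0(2) K_iff
      by (simp add: space_H)
  qed
  have stein
  proof (rule stein_orthogonal)
    fix k l assume kl: "k \<in> {..<d}" "l \<in> {..<d}"
    then have k: "k < d" and l: "l < d" by auto
    note ec = Wc[OF eW]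
    show "killing (rot_gen (std k) (std l))"
    proof (cases "k = l")
      case True
      have "rot_gen (std l) (std l) = (\<lambda>i j. 0)" by (auto simp: rot_gen_def fun_eq_iff)
      then show ?thesis using killing_zero True by simp
    next
      case False
      \<comment> \<open>The reflections along e_k and along a unit vector at angle t / 2 to it
        compose to the rotation by t in the plane of e_k and e_l.\<close>
      define a where "a t = complex_of_real (cos (t / 2)) \<cdot>\<^sub>v e k + complex_of_real (sin (t / 2)) \<cdot>\<^sub>v e l" for t
      have aW: "a t \<in> W" for t
        unfolding a_def using k l by (intro W_add W_smult eW) auto
      have xa: "x \<bullet>c a t = of_real (cos (t / 2)) * (x \<bullet>c e k) + of_real (sin (t / 2)) * (x \<bullet>c e l)"
        if "x \<in> carrier_vec d" for x t
        unfolding a_def using that k l ec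
        by (simp add: cscalar_prod_add_right[where n=d] cscalar_prod_smult_right[where n=d])
      have ax: "a t \<bullet>c x = of_real (cos (t / 2)) * (e k \<bullet>c x) + of_real (sin (t / 2)) * (e l \<bullet>c x)"
        if "x \<in> carrier_vec d" for x t
        unfolding a_def using that k l ec
        by (simp add: cscalar_prod_add_left[where n=d] cscalar_prod_smult_left[where n=d])
      have aa: "a t \<bullet>c a t = 1" for t
      proof -
        have "cos (t / 2) * cos (t / 2) + sin (t / 2) * sin (t / 2) = 1"
          by (simp flip: power2_eq_square)
        then have "of_real (cos (t / 2)) * of_real (cos (t / 2)) + of_real (sin (t / 2)) * of_real (sin (t / 2)) = (1 :: complex)"
          by (simp only: of_real_1 flip: of_real_mult of_real_add)
        then show ?thesis
          using False k l by (simp add: xa[OF Wc[OF aW]] ax[OF ec] ee)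
      qed
      define U where "U t = pseudo_refl d (a t) (- 1) * pseudo_refl d (e k) (- 1)" for t
      have U: "U t \<in> carrier K" for t
        unfolding U_def using k ee[OF k k] by (intro closed refl_K aW aa eW) simp_all
      define Y where "Y i u = rl (u *\<^sub>v x0) k * std k i + rl (u *\<^sub>v x0) l * std l i" for i u
      have Uw: "rl (U t *\<^sub>v w) i = rl w i + (cos t - 1) * (rl w k * std k i + rl w l * std l i)
          + sin t * (rl w k * std l i - rl w l * std k i)"
        if w: "w \<in> W" and i: "i < d" for w t i
      proof -
        define y where "y = pseudo_refl d (e k) (- 1) *\<^sub>v w"
        have yW: "y \<in> W" unfolding y_def using refl_W[OF eW[OF k] w] .
        have std_cnj: "e k \<bullet>c e i = of_real (std k i)" "e l \<bullet>c e i = of_real (std l i)"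
          using k l i by (auto simp: ee std_def)
        have y_coord: "rl y i = rl w i - 2 * rl w k * std k i" if i: "i < d" for i
        proof -
          have "y \<bullet>c e i = w \<bullet>c e i + (- 1 - 1) * (w \<bullet>c e k) * (e k \<bullet>c e i)"
            unfolding y_def pseudo_refl_vec[OF ec[OF k] Wc[OF w]]
            using k i ec Wc[OF w]
            by (simp add: cscalar_prod_add_left[where n=d] cscalar_prod_smult_left[where n=d])
          then show ?thesis using k i by (auto simp: rl_def ee std_def)
        qed
        have "U t *\<^sub>v w = pseudo_refl d (a t) (- 1) *\<^sub>v y"
          unfolding U_def y_def
          by (rule assoc_mult_mat_vec[OF pseudo_refl_carrier pseudo_refl_carrier Wc[OF w]])
        also have "\<dots> = y + ((- 1 - 1) * (y \<bullet>c a t)) \<cdot>\<^sub>v a t"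
          by (rule pseudo_refl_vec[OF Wc[OF aW] Wc[OF yW]])
        finally have "(U t *\<^sub>v w) \<bullet>c e i = y \<bullet>c e i + (- 1 - 1) * (y \<bullet>c a t) * (a t \<bullet>c e i)"
          using i ec Wc[OF yW] Wc[OF aW[of t]]
          by (simp add: cscalar_prod_add_left[where n=d] cscalar_prod_smult_left[where n=d])
        also have "a t \<bullet>c e i = of_real (cos (t / 2) * std k i + sin (t / 2) * std l i)"
          by (simp add: ax[OF ec[OF i]] std_cnj)
        finally have "rl (U t *\<^sub>v w) i = rl y i - 2 * Re (y \<bullet>c a t) * (cos (t / 2) * std k i + sin (t / 2) * std l i)"
          by (simp add: rl_def)
        also have "Re (y \<bullet>c a t) = cos (t / 2) * rl y k + sin (t / 2) * rl y l"
          by (simp add: xa[OF Wc[OF yW]] rl_def)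
        finally have *: "rl (U t *\<^sub>v w) i = rl w i - 2 * rl w k * std k i
          - 2 * (sin (t / 2) * rl w l - cos (t / 2) * rl w k) * (cos (t / 2) * std k i + sin (t / 2) * std l i)"
          using False k l i by (simp add: y_coord std_def)
        \<comment> \<open>Both double-angle formulas for the cosine occur: the e_k component yields
          2 cos^2 - 1, the e_l component 1 - 2 sin^2.\<close>
        have c: "cos t = 2 * (cos (t / 2))\<^sup>2 - 1" "cos t = 1 - 2 * (sin (t / 2))\<^sup>2"
          and s: "sin t = 2 * sin (t / 2) * cos (t / 2)"
          using cos_double_cos[of "t / 2"] cos_double_sin[of "t / 2"] sin_double[of "t / 2"] by simp_all
        have "rl (U t *\<^sub>v w) i = rl w i + (2 * (cos (t / 2))\<^sup>2 - 1 - 1) * rl w k * std k i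
           + (1 - 2 * (sin (t / 2))\<^sup>2 - 1) * rl w l * std l i
           + 2 * sin (t / 2) * cos (t / 2) * (rl w k * std l i - rl w l * std k i)"
          unfolding * by (simp add: algebra_simps power2_eq_square)
        then show ?thesis unfolding c(1)[symmetric] c(2)[symmetric] s[symmetric]
          by (simp add: algebra_simps)
      qed
      show ?thesis
      proof (rule killing_rotation[where \<Phi>="\<lambda>t u. U t * u" and \<alpha>="\<lambda>t. cos t - 1" and \<beta>=sin and Y=Y and C=1])
        show "bdd_rv (Y i)" for i
          unfolding Y_def using kl by (intro bdd_rv_add bdd_rv_mult bdd_rv_const bdd_rv_X)
        show "\<bar>cos t - 1\<bar> \<le> 1 * t\<^sup>2" for t :: real
          using abs_cos_minus_1_le[of t] zero_le_power2[of t] by linarith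
        show "\<bar>sin t - t\<bar> \<le> 1 * t\<^sup>2" for t :: real
          using abs_sin_minus_self_le[of t] zero_le_power2[of t] by linarith
        fix t i u assume i: "i \<in> {..<d}" and u: "u \<in> space H"
        have "(U t * u) *\<^sub>v x0 = U t *\<^sub>v (u *\<^sub>v x0)"
          using assoc_K[OF U _ Wc[OF x0W]] u by (simp add: space_H)
        then show "rl ((U t * u) *\<^sub>v x0) i = rl (u *\<^sub>v x0) i + (cos t - 1) * Y i u
          + sin t * lapply {..<d} (rot_gen (std k) (std l)) (rl (u *\<^sub>v x0)) i"
          using Uw[OF wW[OF u], of i t] i kl by (simp add: Y_def lapply_rot_gen dotp_std)
      qed (use U mult_measurable mult_invariant in auto)
    qed
  qed
  then have "prob {\<omega> \<in> space H.
      \<bar>(\<Sum>g\<in>carrier G. f g * (real (card {..<d}) / real (order G) * (dotp {..<d} (rl (\<pi> g *\<^sub>v v)) (rl (\<omega> *\<^sub>v x0)))\<^sup>2))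
        - (\<Sum>g\<in>carrier G. f g) / real (order G)\<bar> > t * (l2_norm G f / sqrt (real (order G)))}
    \<le> 3 * exp (- (t * sqrt (real d) / 12))"
    by (intro mu_tail[OF _ \<pi> irr Wc[OF vW] v(2) _ t] dotp_rl W_rep vW)
  moreover have "{\<omega> \<in> space H.
      \<bar>(\<Sum>g\<in>carrier G. f g * (real (card {..<d}) / real (order G) * (dotp {..<d} (rl (\<pi> g *\<^sub>v v)) (rl (\<omega> *\<^sub>v x0)))\<^sup>2))
        - (\<Sum>g\<in>carrier G. f g) / real (order G)\<bar> > t * (l2_norm G f / sqrt (real (order G)))}
    = {u \<in> space H.
      \<bar>(\<Sum>g\<in>carrier G. f g * (real d / real (order G) * (Re ((\<pi> g *\<^sub>v v) \<bullet>c (u *\<^sub>v x0)))\<^sup>2))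
        - (\<Sum>g\<in>carrier G. f g) / real (order G)\<bar> > t * (l2_norm G f / sqrt (real (order G)))}"
    by (intro Collect_cong conj_cong refl) (simp add: dotp_rl[OF W_rep[OF _ vW] wW])
  ultimately show "measure H {u \<in> space H.
      \<bar>(\<Sum>g\<in>carrier G. f g * (real d / real (order G) * (Re ((\<pi> g *\<^sub>v v) \<bullet>c (u *\<^sub>v x0)))\<^sup>2))
        - (\<Sum>g\<in>carrier G. f g) / real (order G)\<bar> > t * (l2_norm G f / sqrt (real (order G)))}
    \<le> 3 * exp (- (t * sqrt (real d) / 12))"
    by simp
qed

section \<open>The union bound\<close>

definition well_distributed ::
  "('g, 'm) monoid_scheme \<Rightarrow> ('g \<Rightarrow> real) \<Rightarrow> real \<Rightarrow> ('g \<Rightarrow> complex) \<Rightarrow> bool" where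
  "well_distributed G f t \<phi> \<longleftrightarrow>
     \<bar>mu G \<phi> f - (\<Sum>g\<in>carrier G. f g) / real (order G)\<bar> \<le> t * (l2_norm G f / sqrt (real (order G)))"

lemma (in prob_space) finite_union_bound:
  assumes "finite A" "\<And>a. a \<in> A \<Longrightarrow> {\<omega> \<in> space M. P a \<omega>} \<in> events"
    "\<And>a. a \<in> A \<Longrightarrow> prob {\<omega> \<in> space M. P a \<omega>} \<le> q"
  shows "{\<omega> \<in> space M. \<exists>a\<in>A. P a \<omega>} \<in> events"
    and "prob {\<omega> \<in> space M. \<exists>a\<in>A. P a \<omega>} \<le> real (card A) * q"
proof -
  have eq: "{\<omega> \<in> space M. \<exists>a\<in>A. P a \<omega>} = (\<Union>a\<in>A. {\<omega> \<in> space M. P a \<omega>})" by blast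
  show "{\<omega> \<in> space M. \<exists>a\<in>A. P a \<omega>} \<in> events"
    unfolding eq using assms by (intro sets.finite_UN) auto
  have "prob (\<Union>a\<in>A. {\<omega> \<in> space M. P a \<omega>}) \<le> (\<Sum>a\<in>A. prob {\<omega> \<in> space M. P a \<omega>})"
    using assms by (intro finite_measure_subadditive_finite) auto
  also have "\<dots> \<le> (\<Sum>a\<in>A. q)" by (intro sum_mono assms)
  finally show "prob {\<omega> \<in> space M. \<exists>a\<in>A. P a \<omega>} \<le> real (card A) * q" unfolding eq by simp
qed

lemma mu_x_fun:
  "mu G (x_fun G \<pi> v w) f = (\<Sum>g\<in>carrier G.
     f g * (2 * real (rep_dim G \<pi>) / real (order G) * (Re ((\<pi> g *\<^sub>v v) \<bullet>c w))\<^sup>2))"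
  unfolding mu_def x_fun_def norm_of_real power2_abs matrix_coeff_def
  by (simp add: power_mult_distrib power_divide)

lemma mu_y_fun:
  "mu G (y_fun G \<pi> v w) f = (\<Sum>g\<in>carrier G.
     f g * (2 * real (rep_dim G \<pi>) / real (order G) * (Im ((\<pi> g *\<^sub>v v) \<bullet>c w))\<^sup>2))"
  unfolding mu_def y_fun_def norm_of_real power2_abs matrix_coeff_def
  by (simp add: power_mult_distrib power_divide)

lemma mu_phi_fun:
  "mu G (phi_fun G \<pi> v w) f = (\<Sum>g\<in>carrier G.
     f g * (real (rep_dim G \<pi>) / real (order G) * (cmod ((\<pi> g *\<^sub>v v) \<bullet>c w))\<^sup>2))"
  unfolding mu_def phi_fun_def norm_mult norm_of_real power_mult_distrib power2_abs matrix_coeff_def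
  by (simp add: power_divide)

lemma haar_unitary:
  "haar_prob d (unitary_group d) H \<Longrightarrow> haar_matrix_group d (unitary_group d) H"
  by unfold_locales (auto simp: mult_unitary_group unitary_group_closed)

lemma (in haar_matrix_group) sets_well_distributed:
  assumes x0: "x0 \<in> carrier_vec n" and y: "\<And>g. g \<in> carrier G \<Longrightarrow> y g \<in> carrier_vec n"
    and h: "h \<in> borel_measurable borel"
  shows "{u \<in> space H. \<not> \<bar>(\<Sum>g\<in>carrier G. f g * (c * (h (y g \<bullet>c (u *\<^sub>v x0)))\<^sup>2)) - a\<bar> \<le> (b :: real)} \<in> events"
proof -
  have m: "(\<lambda>u. h (y g \<bullet>c (u *\<^sub>v x0))) \<in> borel_measurable H" if g: "g \<in> carrier G" for g
  proof (rule measurable_compose[OF _ h])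
    \<comment> \<open>The random vector stands in the conjugate-linear slot, whereas
      \<open>cscalar_prod_measurable\<close> has it in the linear one; conjugation exchanges the
      slots.\<close>
    have c: "(\<lambda>u. cnj ((u *\<^sub>v x0) \<bullet>c y g)) \<in> borel_measurable H"
      using cscalar_prod_measurable[OF x0 y[OF g]]
      by (rule measurable_compose) (simp add: borel_measurable_continuous_onI continuous_intros)
    show "(\<lambda>u. y g \<bullet>c (u *\<^sub>v x0)) \<in> borel_measurable H"
    proof (subst measurable_cong)
      show "y g \<bullet>c (u *\<^sub>v x0) = cnj ((u *\<^sub>v x0) \<bullet>c y g)" if "u \<in> space H" for u
        using that x0 y[OF g] K_carrier[of u] by (intro cscalar_prod_cnj[symmetric]) (auto simp: space_H)
    qed (rule c)
  qed
  have "(\<lambda>u. \<bar>(\<Sum>g\<in>carrier G. f g * (c * (h (y g \<bullet>c (u *\<^sub>v x0)))\<^sup>2)) - a\<bar>) \<in> borel_measurable H"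
    using m by (intro borel_measurable_abs borel_measurable_diff borel_measurable_sum
      borel_measurable_times borel_measurable_power borel_measurable_const)
  then show ?thesis by measurable
qed

text \<open>Applied with m = d to the dual pairs and with m = d div 2 to the quaternionic type; the
  Boolean selects x or y. There are 2 m d M <= 2 M d^2 events of probability at most 3 exp(-t sqrt d
  / 12), whence the factor 6.\<close>

lemma unitary_family_bound:
  fixes f :: "nat \<Rightarrow> 'g \<Rightarrow> real" and M :: nat
  assumes \<pi>: "finite_unitary_rep G \<pi> d" and irr: "irreducible_unitary_rep G \<pi>"
    and H: "haar_prob d (unitary_group d) H"
    and v: "\<And>k. k < m \<Longrightarrow> v k \<in> carrier_vec d \<and> v k \<bullet>c v k = 1"
    and e: "\<And>j. j < d \<Longrightarrow> e j \<in> carrier_vec d \<and> e j \<bullet>c e j = 1"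
    and m: "m \<le> d" and t: "t > 0"
  defines "B \<equiv> {u \<in> space H. \<exists>(k, j, i, x)\<in>{..<m} \<times> {..<d} \<times> {1..M} \<times> UNIV.
     \<not> well_distributed G (f i) t ((if x then x_fun else y_fun) G \<pi> (v k) (u *\<^sub>v e j))}"
  shows "B \<in> sets H" and "measure H B \<le> 6 * real M * (real d)\<^sup>2 * exp (- (t * sqrt (real d) / 12))"
proof -
  interpret P: finite_unitary_rep G \<pi> d by fact
  interpret haar_matrix_group d "unitary_group d" H by (rule haar_unitary[OF H])
  let ?A = "{..<m} \<times> {..<d} \<times> {1..M} \<times> (UNIV :: bool set)"
  let ?q = "3 * exp (- (t * sqrt (real d) / 12))"
  let ?P = "\<lambda>(k, j, i, x) u. \<not> well_distributed G (f i) t ((if x then x_fun else y_fun) G \<pi> (v k) (u *\<^sub>v e j))"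
  have ev: "{u \<in> space H. ?P a u} \<in> events \<and> prob {u \<in> space H. ?P a u} \<le> ?q" if a: "a \<in> ?A" for a
  proof -
    obtain k j i x where a_eq: "a = (k, j, i, x)" by (cases a) auto
    have k: "k < m" and j: "j < d" using a by (auto simp: a_eq)
    define v' where "v' = (if x then v k else (- \<i>) \<cdot>\<^sub>v v k)"
    have v': "v' \<in> carrier_vec d" "v' \<bullet>c v' = 1"
      using v[OF k] by (auto simp: v'_def cscalar_prod_smult_left[where n=d] cscalar_prod_smult_right[where n=d])
    have uc: "u *\<^sub>v e j \<in> carrier_vec d" if "u \<in> space H" for u
      using mult_mat_vec_carrier[OF K_carrier] e[OF j] that by (simp add: space_H)
    have mu_eq: "mu G ((if x then x_fun else y_fun) G \<pi> (v k) (u *\<^sub>v e j)) (f i)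
      = (\<Sum>g\<in>carrier G. f i g * (2 * real d / real (order G) * (Re ((\<pi> g *\<^sub>v v') \<bullet>c (u *\<^sub>v e j)))\<^sup>2))"
      if u: "u \<in> space H" for u
    proof (cases x)
      case True
      then show ?thesis by (simp add: mu_x_fun P.d_eq v'_def)
    next
      case False
      have "Re ((\<pi> g *\<^sub>v v') \<bullet>c (u *\<^sub>v e j)) = Im ((\<pi> g *\<^sub>v v k) \<bullet>c (u *\<^sub>v e j))" if g: "g \<in> carrier G" for g
      proof -
        have "\<pi> g *\<^sub>v v' = (- \<i>) \<cdot>\<^sub>v (\<pi> g *\<^sub>v v k)"
          using False mult_mat_vec[OF P.rep_carrier[OF g], of "v k" "- \<i>"] v[OF k] by (simp add: v'_def)
        then show ?thesis
          using cscalar_prod_smult_left[OF P.rep_vec_carrier[OF g] uc[OF u], of "v k" "- \<i>"] v[OF k] by simp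
      qed
      then show ?thesis using False by (simp add: mu_y_fun P.d_eq)
    qed
    have set_eq: "{u \<in> space H. ?P a u} = {u \<in> space H.
      \<not> \<bar>(\<Sum>g\<in>carrier G. f i g * (2 * real d / real (order G) * (Re ((\<pi> g *\<^sub>v v') \<bullet>c (u *\<^sub>v e j)))\<^sup>2))
        - (\<Sum>g\<in>carrier G. f i g) / real (order G)\<bar> \<le> t * (l2_norm G (f i) / sqrt (real (order G)))}"
      unfolding a_eq prod.case well_distributed_def
      by (intro Collect_cong conj_cong refl) (simp only: mu_eq)
    show ?thesis
    proof
      show "{u \<in> space H. ?P a u} \<in> events"
        unfolding set_eq using e[OF j] P.rep_vec_carrier[OF _ v'(1)] by (intro sets_well_distributed) auto
      show "prob {u \<in> space H. ?P a u} \<le> ?q"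
        using unitary_tail[OF \<pi> irr H v' _ _ t, of "e j" "f i"] e[OF j]
        unfolding set_eq by (simp only: not_le)
    qed
  qed
  have fin: "finite ?A" by simp
  have B_eq: "B = {u \<in> space H. \<exists>a\<in>?A. ?P a u}" unfolding B_def by (simp add: case_prod_unfold)
  show "B \<in> sets H" unfolding B_eq using ev by (intro finite_union_bound(1)[OF fin]) blast+
  have "prob B \<le> real (card ?A) * ?q" unfolding B_eq using ev by (intro finite_union_bound(2)[OF fin]) blast+
  also have "card ?A = 2 * m * d * M" by (simp add: card_cartesian_product)
  also have "real (2 * m * d * M) * ?q \<le> real (2 * d * d * M) * ?q"
    using m by (intro mult_right_mono of_nat_mono mult_le_mono) auto
  finally show "prob B \<le> 6 * real M * (real d)\<^sup>2 * exp (- (t * sqrt (real d) / 12))"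
    by (simp add: power2_eq_square mult_ac)
qed

text \<open>One function per pair (k, j) in place of an x and a y gives d^2 M events, whence the
  factor 3.\<close>

lemma orthogonal_family_bound:
  fixes f :: "nat \<Rightarrow> 'g \<Rightarrow> real" and M :: nat
  assumes \<pi>: "finite_unitary_rep G \<pi> d" and irr: "irreducible_unitary_rep G \<pi>"
    and J: "structure_map G \<pi> 1 J" and v: "orthonormal_basis \<real> d (fixed_space G \<pi> J) d v"
    and e: "orthonormal_basis \<real> d (fixed_space G \<pi> J) d e"
    and H: "haar_prob d (orthogonal_group G \<pi> J) H" and t: "t > 0"
  defines "B \<equiv> {u \<in> space H. \<exists>(k, j, i)\<in>{..<d} \<times> {..<d} \<times> {1..M}.
     \<not> well_distributed G (f i) t (phi_fun G \<pi> (v k) (u *\<^sub>v e j))}"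
  shows "B \<in> sets H" and "measure H B \<le> 3 * real M * (real d)\<^sup>2 * exp (- (t * sqrt (real d) / 12))"
proof -
  interpret P: finite_unitary_rep G \<pi> d by fact
  have d: "d > 0" using irr by (simp add: irreducible_unitary_rep_def P.d_eq)
  have vk: "v k \<in> fixed_space G \<pi> J" "v k \<bullet>c v k = 1" if "k < d" for k
    using v that unfolding orthonormal_basis_def by auto
  have ej: "e j \<in> fixed_space G \<pi> J" "e j \<bullet>c e j = 1" if "j < d" for j
    using e that unfolding orthonormal_basis_def by auto
  note tail = orthogonal_tail[OF \<pi> irr J e H vk ej t]
  interpret haar_matrix_group d "orthogonal_group G \<pi> J" H
    by (rule tail(1)[OF d d d d])
  let ?A = "{..<d} \<times> {..<d} \<times> {1..M}"
  let ?q = "3 * exp (- (t * sqrt (real d) / 12))"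
  let ?P = "\<lambda>(k, j, i) u. \<not> well_distributed G (f i) t (phi_fun G \<pi> (v k) (u *\<^sub>v e j))"
  have ev: "{u \<in> space H. ?P a u} \<in> events \<and> prob {u \<in> space H. ?P a u} \<le> ?q" if a: "a \<in> ?A" for a
  proof -
    obtain k j i where a_eq: "a = (k, j, i)" by (cases a) auto
    have k: "k < d" and j: "j < d" using a by (auto simp: a_eq)
    have c: "v k \<in> carrier_vec d" "e j \<in> carrier_vec d"
      using vk[OF k] ej[OF j] by (auto simp: fixed_space_def P.d_eq)
    have mu_eq: "mu G (phi_fun G \<pi> (v k) (u *\<^sub>v e j)) (f i)
      = (\<Sum>g\<in>carrier G. f i g * (real d / real (order G) * (Re ((\<pi> g *\<^sub>v v k) \<bullet>c (u *\<^sub>v e j)))\<^sup>2))"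
      if u: "u \<in> space H" for u
      unfolding mu_phi_fun P.d_eq
    proof (rule sum.cong[OF refl])
      fix g assume "g \<in> carrier G"
      from tail(2)[OF k k j j u this]
      have "cmod ((\<pi> g *\<^sub>v v k) \<bullet>c (u *\<^sub>v e j)) = \<bar>Re ((\<pi> g *\<^sub>v v k) \<bullet>c (u *\<^sub>v e j))\<bar>"
        by (auto elim!: Reals_cases)
      then show "f i g * (real d / real (order G) * (cmod ((\<pi> g *\<^sub>v v k) \<bullet>c (u *\<^sub>v e j)))\<^sup>2)
        = f i g * (real d / real (order G) * (Re ((\<pi> g *\<^sub>v v k) \<bullet>c (u *\<^sub>v e j)))\<^sup>2)" by simp
    qed
    have set_eq: "{u \<in> space H. ?P a u} = {u \<in> space H.
      \<not> \<bar>(\<Sum>g\<in>carrier G. f i g * (real d / real (order G) * (Re ((\<pi> g *\<^sub>v v k) \<bullet>c (u *\<^sub>v e j)))\<^sup>2))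
        - (\<Sum>g\<in>carrier G. f i g) / real (order G)\<bar> \<le> t * (l2_norm G (f i) / sqrt (real (order G)))}"
      unfolding a_eq prod.case well_distributed_def
      by (intro Collect_cong conj_cong refl) (simp only: mu_eq)
    show ?thesis
    proof
      show "{u \<in> space H. ?P a u} \<in> events"
        unfolding set_eq using c P.rep_vec_carrier[OF _ c(1)] by (intro sets_well_distributed) auto
      show "prob {u \<in> space H. ?P a u} \<le> ?q"
        using tail(3)[OF k k j j, of "f i"] unfolding set_eq by (simp only: not_le)
    qed
  qed
  have fin: "finite ?A" by simp
  have B_eq: "B = {u \<in> space H. \<exists>a\<in>?A. ?P a u}" unfolding B_def by (simp add: case_prod_unfold)
  show "B \<in> sets H" unfolding B_eq using ev by (intro finite_union_bound(1)[OF fin]) blast+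
  have "prob B \<le> real (card ?A) * ?q" unfolding B_eq using ev by (intro finite_union_bound(2)[OF fin]) blast+
  also have "card ?A = d * d * M" by (simp add: card_cartesian_product)
  finally show "prob B \<le> 3 * real M * (real d)\<^sup>2 * exp (- (t * sqrt (real d) / 12))"
    by (simp add: power2_eq_square mult_ac)
qed

text \<open>Self-duality keeps the trivial class out of \<open>C\<close>, and dimension 1 leaves the
  quaternionic family empty, so only its real eigenfunction remains to be checked.\<close>

lemma equivalent_trivial_rep:
  assumes \<pi>: "finite_unitary_rep G \<pi> d" and triv: "equivalent_rep G \<pi> trivial_rep"
  shows "d = 1" and "\<And>g. g \<in> carrier G \<Longrightarrow> \<pi> g = 1\<^sub>m 1" and "self_dual G \<pi>"
proof -
  interpret finite_unitary_rep G \<pi> d by fact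
  show d: "d = 1" using triv unfolding equivalent_rep_def d_eq by (simp add: trivial_rep_def rep_dim_def)
  obtain T where T: "T \<in> carrier_mat 1 1" "invertible_mat T" "\<And>g. g \<in> carrier G \<Longrightarrow> T * \<pi> g = 1\<^sub>m 1 * T"
    using triv unfolding equivalent_rep_def d_eq d trivial_rep_def by blast
  obtain B where B: "T * B = 1\<^sub>m (dim_row T)" "B * T = 1\<^sub>m (dim_row B)"
    using T(2) by (auto simp: invertible_mat_def inverts_mat_def)
  have "dim_row B = 1" using B T(1) by (metis carrier_matD index_mult_mat(3) index_one_mat(3))
  moreover have "dim_col B = 1" using B T(1) by (metis carrier_matD(1) index_mult_mat(3) index_one_mat(3))
  ultimately have Bc: "B \<in> carrier_mat 1 1" by auto
  show one: "\<pi> g = 1\<^sub>m 1" if g: "g \<in> carrier G" for g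
  proof -
    have p: "\<pi> g \<in> carrier_mat 1 1" using rep_carrier[OF g] by (simp add: d)
    have "\<pi> g = B * T * \<pi> g" using B(2) Bc p by simp
    also have "\<dots> = B * (T * \<pi> g)" by (rule assoc_mult_mat[OF Bc T(1) p])
    also have "\<dots> = 1\<^sub>m 1" using T(1,3) g B(2) Bc by simp
    finally show ?thesis .
  qed
  have dual: "dual_rep G \<pi> g = \<pi> g" if "g \<in> carrier G" for g
    using that one by (simp add: dual_rep_def)
  show "self_dual G \<pi>"
    unfolding self_dual_def equivalent_rep_def
    using dual one one_closed
    by (auto simp: rep_dim_def invertible_mat_def inverts_mat_def intro!: bexI[of _ "1\<^sub>m 1"] exI[of _ "1\<^sub>m 1"])
qed

text \<open>The Boolean merges x and y, so the five families of functions become three, one for each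
  kind of bad event in the main proof.\<close>

lemma ball_random_eigenbasis:
  "(\<forall>\<phi>\<in>random_eigenbasis G R C v e \<omega>. P \<phi>) \<longleftrightarrow>
     (\<forall>\<pi>\<in>C. \<forall>k<rep_dim G \<pi>. \<forall>j<rep_dim G \<pi>. \<forall>x.
        P ((if x then x_fun else y_fun) G \<pi> (v \<pi> k) (\<omega> \<pi> *\<^sub>v e \<pi> j))) \<and>
     (\<forall>\<pi>\<in>R. real_rep G \<pi> \<longrightarrow> (\<forall>k<rep_dim G \<pi>. \<forall>j<rep_dim G \<pi>.
        P (phi_fun G \<pi> (v \<pi> k) (\<omega> \<pi> *\<^sub>v e \<pi> j)))) \<and>
     (\<forall>\<pi>\<in>R. quaternionic_rep G \<pi> \<longrightarrow> (\<forall>k<rep_dim G \<pi> div 2. \<forall>j<rep_dim G \<pi>. \<forall>x.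
        P ((if x then x_fun else y_fun) G \<pi> (v \<pi> k) (\<omega> \<pi> *\<^sub>v e \<pi> j))))"
proof -
  have ball3: "(\<forall>\<phi>\<in>{h a b c |a b c. Q a b c}. P \<phi>) \<longleftrightarrow> (\<forall>a b c. Q a b c \<longrightarrow> P (h a b c))" for h Q
    by blast
  show ?thesis
    unfolding random_eigenbasis_def ball_Un ball3 all_bool_eq if_True if_False by auto
qed

theorem theorem1p8:
  fixes G :: "('g, 'm) monoid_scheme"
    and S :: "'g set"
    and R C :: "'g rep set"
    and J :: "'g rep \<Rightarrow> complex vec \<Rightarrow> complex vec"
    and v e :: "'g rep \<Rightarrow> nat \<Rightarrow> complex vec"
    and H :: "'g rep \<Rightarrow> complex mat measure"
    and M :: nat
    and f :: "nat \<Rightarrow> 'g \<Rightarrow> real"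
    and t :: real
  assumes "group G" and "finite (carrier G)"
    and "S \<subseteq> carrier G" and "(\<lambda>s. inv\<^bsub>G\<^esub> s) ` S = S"
    and "irrep_representatives G R"
    and "dual_pair_representatives G R C"
    and J_real: "\<And>\<pi>. \<pi> \<in> R \<Longrightarrow> real_rep G \<pi> \<Longrightarrow> structure_map G \<pi> 1 (J \<pi>)"
    and J_quat: "\<And>\<pi>. \<pi> \<in> R \<Longrightarrow> quaternionic_rep G \<pi> \<Longrightarrow> structure_map G \<pi> (-1) (J \<pi>)"
    and complex_type: "\<And>\<pi>. \<pi> \<in> C \<Longrightarrow>
      orthonormal_basis UNIV (rep_dim G \<pi>) (rep_space G \<pi>) (rep_dim G \<pi>) (v \<pi>) \<and>
      (\<forall>k<rep_dim G \<pi>. is_eigenvector (rep_sum G \<pi> S) (v \<pi> k)) \<and>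
      orthonormal_basis UNIV (rep_dim G \<pi>) (rep_space G \<pi>) (rep_dim G \<pi>) (e \<pi>) \<and>
      haar_prob (rep_dim G \<pi>) (unitary_group (rep_dim G \<pi>)) (H \<pi>)"
    and real_type: "\<And>\<pi>. \<pi> \<in> R \<Longrightarrow> real_rep G \<pi> \<Longrightarrow>
      orthonormal_basis \<real> (rep_dim G \<pi>) (fixed_space G \<pi> (J \<pi>)) (rep_dim G \<pi>) (v \<pi>) \<and>
      (\<forall>k<rep_dim G \<pi>. is_eigenvector (rep_sum G \<pi> S) (v \<pi> k)) \<and>
      orthonormal_basis \<real> (rep_dim G \<pi>) (fixed_space G \<pi> (J \<pi>)) (rep_dim G \<pi>) (e \<pi>) \<and>
      haar_prob (rep_dim G \<pi>) (orthogonal_group G \<pi> (J \<pi>)) (H \<pi>)"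
    and quaternionic_type: "\<And>\<pi>. \<pi> \<in> R \<Longrightarrow> quaternionic_rep G \<pi> \<Longrightarrow>
      orthonormal_basis UNIV (rep_dim G \<pi>) (rep_space G \<pi>) (rep_dim G \<pi>)
        (quaternionic_family (rep_dim G \<pi>) (J \<pi>) (v \<pi>)) \<and>
      (\<forall>k<rep_dim G \<pi>. is_eigenvector (rep_sum G \<pi> S)
        (quaternionic_family (rep_dim G \<pi>) (J \<pi>) (v \<pi>) k)) \<and>
      orthonormal_basis UNIV (rep_dim G \<pi>) (rep_space G \<pi>) (rep_dim G \<pi>) (e \<pi>) \<and>
      haar_prob (rep_dim G \<pi>) (unitary_group (rep_dim G \<pi>)) (H \<pi>)"
    and "t > 0"
  shows "measure (PiM (random_index G R C) H)
      {\<omega> \<in> space (PiM (random_index G R C) H).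
        \<forall>\<phi> \<in> random_eigenbasis G R C v e \<omega>. \<forall>i \<in> {1..M}.
          \<bar>mu G \<phi> (f i) - (\<Sum>g\<in>carrier G. f i g) / real (order G)\<bar>
            \<le> t * (l2_norm G (f i) / sqrt (real (order G)))}
    \<ge> 1 - 2 * real M * (\<Sum>\<pi> \<in> {\<pi>\<in>R. \<not> equivalent_rep G \<pi> trivial_rep}.
          (real (rep_dim G \<pi>))\<^sup>2 *
          (6 * exp (- (t * sqrt (real (rep_dim G \<pi>)) / 64)) +
           2 * exp (- (real (rep_dim G \<pi>) / 12))))"
proof -
  note G = \<open>group G\<close> \<open>finite (carrier G)\<close>
  interpret group G by fact
  let ?I = "random_index G R C" and ?d = "rep_dim G"
  let ?P = "PiM ?I H"
  have finR: "finite R" using finite_irrep_representatives[OF G] assms(5) .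
  have CR: "C \<subseteq> R" and C_dual: "\<And>\<pi>. \<pi> \<in> C \<Longrightarrow> \<not> self_dual G \<pi>"
    using assms(6) by (auto simp: dual_pair_representatives_def)
  have IR: "?I \<subseteq> R" using CR by (auto simp: random_index_def)
  have irr: "irreducible_unitary_rep G \<pi>" if "\<pi> \<in> R" for \<pi>
    using that assms(5) by (auto simp: irrep_representatives_def)
  have rep: "finite_unitary_rep G \<pi> (?d \<pi>)" if "\<pi> \<in> R" for \<pi>
    using finite_unitary_repI[OF G irr[OF that]] .
  have types: "\<pi> \<in> C \<or> real_rep G \<pi> \<or> quaternionic_rep G \<pi>" if "\<pi> \<in> ?I" for \<pi>
    using that by (auto simp: random_index_def)
  have prob_H: "prob_space (H \<pi>)" if "\<pi> \<in> ?I" for \<pi>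
    using types[OF that] complex_type[of \<pi>] real_type[of \<pi>] quaternionic_type[of \<pi>] IR that
    by (auto simp: haar_prob_def)
  interpret PP: prob_space ?P by (rule prob_space_PiM) (rule prob_H)
  define good where "good i \<phi> \<longleftrightarrow> well_distributed G (f i) t \<phi>" for i \<phi>
  define BC where "BC \<pi> = {u \<in> space (H \<pi>). \<exists>(k, j, i, x)\<in>{..<?d \<pi>} \<times> {..<?d \<pi>} \<times> {1..M} \<times> UNIV.
     \<not> good i ((if x then x_fun else y_fun) G \<pi> (v \<pi> k) (u *\<^sub>v e \<pi> j))}" for \<pi>
  define BQ where "BQ \<pi> = {u \<in> space (H \<pi>). \<exists>(k, j, i, x)\<in>{..<?d \<pi> div 2} \<times> {..<?d \<pi>} \<times> {1..M} \<times> UNIV.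
     \<not> good i ((if x then x_fun else y_fun) G \<pi> (v \<pi> k) (u *\<^sub>v e \<pi> j))}" for \<pi>
  define BR where "BR \<pi> = {u \<in> space (H \<pi>). \<exists>(k, j, i)\<in>{..<?d \<pi>} \<times> {..<?d \<pi>} \<times> {1..M}.
     \<not> good i (phi_fun G \<pi> (v \<pi> k) (u *\<^sub>v e \<pi> j))}" for \<pi>
  \<comment> \<open>The bad operators at the index \<pi>, collected over every type that \<pi>
    has.\<close>
  define B where "B \<pi> = (if \<pi> \<in> C then BC \<pi> else {}) \<union> (if real_rep G \<pi> then BR \<pi> else {})
     \<union> (if quaternionic_rep G \<pi> then BQ \<pi> else {})" for \<pi>
  let ?q = "\<lambda>\<pi>. real M * (real (?d \<pi>))\<^sup>2 * exp (- (t * sqrt (real (?d \<pi>)) / 12))"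
  have q0: "?q \<pi> \<ge> 0" for \<pi> by simp
  have unit: "b k \<in> carrier_vec n \<and> b k \<bullet>c b k = 1"
    if "orthonormal_basis UNIV n (carrier_vec n) n b" "k < n" for b k n
    using that unfolding orthonormal_basis_def by auto
  have BC: "BC \<pi> \<in> sets (H \<pi>) \<and> measure (H \<pi>) (BC \<pi>) \<le> 6 * ?q \<pi>" if \<pi>: "\<pi> \<in> C" for \<pi>
  proof -
    have "\<pi> \<in> R" using \<pi> CR by blast
    note * = unitary_family_bound[OF rep[OF this] irr[OF this], where m="?d \<pi>" and v="v \<pi>" and e="e \<pi>" and t=t
        and H="H \<pi>" and f=f and M=M]
    show ?thesis
      unfolding BC_def good_def using complex_type[OF \<pi>] unit[of "?d \<pi>"] \<open>t > 0\<close>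
      by (intro conjI *(1) order_trans[OF *(2)]) auto
  qed
  have BQ: "BQ \<pi> \<in> sets (H \<pi>) \<and> measure (H \<pi>) (BQ \<pi>) \<le> 6 * ?q \<pi>" if \<pi>: "\<pi> \<in> R" "quaternionic_rep G \<pi>" for \<pi>
  proof -
    note * = unitary_family_bound[OF rep[OF \<pi>(1)] irr[OF \<pi>(1)], where m="?d \<pi> div 2" and v="v \<pi>" and e="e \<pi>" and t=t
        and H="H \<pi>" and f=f and M=M]
    have "v \<pi> k \<in> carrier_vec (?d \<pi>) \<and> v \<pi> k \<bullet>c v \<pi> k = 1" if k: "k < ?d \<pi> div 2" for k
      using quaternionic_type[OF \<pi>] unit[of "?d \<pi>" "quaternionic_family (?d \<pi>) (J \<pi>) (v \<pi>)" k] k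
      by (auto simp: quaternionic_family_def)
    then show ?thesis
      unfolding BQ_def good_def using quaternionic_type[OF \<pi>] unit[of "?d \<pi>" "e \<pi>"] \<open>t > 0\<close>
      by (intro conjI *(1) order_trans[OF *(2)]) auto
  qed
  have BR: "BR \<pi> \<in> sets (H \<pi>) \<and> measure (H \<pi>) (BR \<pi>) \<le> 3 * ?q \<pi>" if \<pi>: "\<pi> \<in> R" "real_rep G \<pi>" for \<pi>
  proof -
    note * = orthogonal_family_bound[OF rep[OF \<pi>(1)] irr[OF \<pi>(1)] J_real[OF \<pi>], where v="v \<pi>" and e="e \<pi>" and t=t
        and H="H \<pi>" and f=f and M=M]
    show ?thesis
      unfolding BR_def good_def using real_type[OF \<pi>] \<open>t > 0\<close>
      by (intro conjI *(1) order_trans[OF *(2)]) auto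
  qed
  have B_sets: "B \<pi> \<in> sets (H \<pi>)" if "\<pi> \<in> ?I" for \<pi>
    unfolding B_def using BC BQ BR IR that by (auto intro!: sets.Un)
  \<comment> \<open>12 = 2 * 6 is the coefficient of the first exponential in the claimed bound. A
    member of \<open>C\<close> costs 6, and for the other indices subadditivity gives at most 3 + 6
    = 9.\<close>
  have B_measure: "measure (H \<pi>) (B \<pi>) \<le> 12 * ?q \<pi>" if \<pi>: "\<pi> \<in> ?I" for \<pi>
  proof -
    interpret prob_space "H \<pi>" by (rule prob_H[OF \<pi>])
    have \<pi>R: "\<pi> \<in> R" using IR \<pi> by blast
    show ?thesis
    proof (cases "\<pi> \<in> C")
      case True
      then have "B \<pi> = BC \<pi>"
        using C_dual[OF True] by (simp add: B_def real_rep_def quaternionic_rep_def)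
      moreover have "prob (BC \<pi>) \<le> 12 * ?q \<pi>"
        using conjunct2[OF BC[OF True]] q0[of \<pi>] by linarith
      ultimately show ?thesis by (simp only:)
    next
      case False
      define B1 B2 where "B1 = (if real_rep G \<pi> then BR \<pi> else {})"
        and "B2 = (if quaternionic_rep G \<pi> then BQ \<pi> else {})"
      have B12: "B1 \<in> events" "prob B1 \<le> 3 * ?q \<pi>" "B2 \<in> events" "prob B2 \<le> 6 * ?q \<pi>"
        using BR[OF \<pi>R] BQ[OF \<pi>R] q0[of \<pi>] by (auto simp: B1_def B2_def)
      have "B \<pi> = B1 \<union> B2" using False by (simp add: B_def B1_def B2_def)
      then have "prob (B \<pi>) \<le> prob B1 + prob B2" using measure_Un_le[OF B12(1,3)] by simp
      then show ?thesis using B12(2,4) q0[of \<pi>] by linarith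
    qed
  qed
  have B_triv: "B \<pi> = {}" if \<pi>: "\<pi> \<in> ?I" and triv: "equivalent_rep G \<pi> trivial_rep" for \<pi>
  proof -
    have \<pi>R: "\<pi> \<in> R" using IR \<pi> by blast
    note T = equivalent_trivial_rep[OF rep[OF \<pi>R] triv]
    have "\<pi> \<notin> C" using C_dual T(3) by blast
    \<comment> \<open>Here 1 div 2 = 0, so there is no index k.\<close>
    moreover have "BQ \<pi> = {}" by (simp add: BQ_def T(1))
    moreover have "BR \<pi> = {}" if r: "real_rep G \<pi>"
    proof -
      have "good i (phi_fun G \<pi> (v \<pi> 0) (u *\<^sub>v e \<pi> 0))" if u: "u \<in> space (H \<pi>)" for u i
      proof -
        have on: "x 0 \<in> carrier_vec 1" "x 0 \<bullet>c x 0 = 1"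
          if "orthonormal_basis \<real> 1 (fixed_space G \<pi> (J \<pi>)) 1 x" for x
          using that by (auto simp: orthonormal_basis_def fixed_space_def T(1))
        have vc: "v \<pi> 0 \<in> carrier_vec 1" "v \<pi> 0 \<bullet>c v \<pi> 0 = 1"
          and ec: "e \<pi> 0 \<in> carrier_vec 1" "e \<pi> 0 \<bullet>c e \<pi> 0 = 1"
          using real_type[OF \<pi>R r] on by (auto simp: T(1))
        have "u \<in> carrier (unitary_group 1)"
          using real_type[OF \<pi>R r] u by (simp add: haar_prob_def orthogonal_group_def T(1))
        from unitary_isometry[OF this ec(1)] ec(2)
        have wc: "u *\<^sub>v e \<pi> 0 \<in> carrier_vec 1" "(u *\<^sub>v e \<pi> 0) \<bullet>c (u *\<^sub>v e \<pi> 0) = 1" by simp_all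
        have norm1: "cmod (x $ 0) = 1" if "x \<in> carrier_vec 1" "x \<bullet>c x = 1" for x
        proof -
          have "complex_of_real ((cmod (x $ 0))\<^sup>2) = 1" using cscalar_prod_self[OF that(1)] that(2) by simp
          then have "(cmod (x $ 0))\<^sup>2 = 1" by (simp only: of_real_eq_1_iff)
          then show ?thesis by (simp add: power2_eq_1_iff) (use norm_ge_zero[of "x $ 0"] in linarith)
        qed
        have "cmod ((\<pi> g *\<^sub>v v \<pi> 0) \<bullet>c (u *\<^sub>v e \<pi> 0)) = 1" if "g \<in> carrier G" for g
        proof -
          have "(\<pi> g *\<^sub>v v \<pi> 0) \<bullet>c (u *\<^sub>v e \<pi> 0) = v \<pi> 0 $ 0 * cnj ((u *\<^sub>v e \<pi> 0) $ 0)"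
            unfolding cscalar_prod_sum[OF wc(1)] T(2)[OF that] using vc(1) by simp
          then show ?thesis
            using norm1[OF vc] norm1[OF wc] by (simp add: norm_mult)
        qed
        then have "mu G (phi_fun G \<pi> (v \<pi> 0) (u *\<^sub>v e \<pi> 0)) (f i) = (\<Sum>g\<in>carrier G. f i g) / real (order G)"
          by (simp add: mu_phi_fun T(1) sum_divide_distrib)
        moreover have "l2_norm G (f i) \<ge> 0" by (simp add: l2_norm_def sum_nonneg)
        ultimately show ?thesis using \<open>t > 0\<close> by (simp add: good_def well_distributed_def)
      qed
      then show ?thesis by (auto simp: BR_def T(1))
    qed
    ultimately show ?thesis by (simp add: B_def)
  qed

  \<comment> \<open>From single representations to the product measure\<close>
  define N where "N = {\<pi>\<in>R. \<not> equivalent_rep G \<pi> trivial_rep}"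
  let ?bad = "\<Union>\<pi>\<in>N \<inter> ?I. {\<omega> \<in> space ?P. \<omega> \<pi> \<in> B \<pi>}"
  let ?good = "{\<omega> \<in> space ?P. \<forall>\<phi> \<in> random_eigenbasis G R C v e \<omega>. \<forall>i \<in> {1..M}.
          \<bar>mu G \<phi> (f i) - (\<Sum>g\<in>carrier G. f i g) / real (order G)\<bar>
            \<le> t * (l2_norm G (f i) / sqrt (real (order G)))}"
  have good_eq: "?good = space ?P - ?bad"
  proof -
    have sp: "\<omega> \<pi> \<in> space (H \<pi>)" if "\<omega> \<in> space ?P" "\<pi> \<in> ?I" for \<omega> \<pi>
      using that by (auto simp: space_PiM)
    have "(\<forall>\<phi> \<in> random_eigenbasis G R C v e \<omega>. \<forall>i \<in> {1..M}. good i \<phi>) \<longleftrightarrow> (\<forall>\<pi>\<in>?I. \<omega> \<pi> \<notin> B \<pi>)"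
      if \<omega>: "\<omega> \<in> space ?P" for \<omega>
    proof -
      have C: "\<omega> \<pi> \<notin> BC \<pi> \<longleftrightarrow> (\<forall>k<?d \<pi>. \<forall>j<?d \<pi>. \<forall>x. \<forall>i \<in> {1..M}.
          good i ((if x then x_fun else y_fun) G \<pi> (v \<pi> k) (\<omega> \<pi> *\<^sub>v e \<pi> j)))" if "\<pi> \<in> C" for \<pi>
        using sp[OF \<omega>, of \<pi>] that unfolding BC_def random_index_def by blast
      have Q: "\<omega> \<pi> \<notin> BQ \<pi> \<longleftrightarrow> (\<forall>k<?d \<pi> div 2. \<forall>j<?d \<pi>. \<forall>x. \<forall>i \<in> {1..M}.
          good i ((if x then x_fun else y_fun) G \<pi> (v \<pi> k) (\<omega> \<pi> *\<^sub>v e \<pi> j)))"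
        if "\<pi> \<in> R" "quaternionic_rep G \<pi>" for \<pi>
        using sp[OF \<omega>, of \<pi>] that unfolding BQ_def random_index_def by blast
      have Re: "\<omega> \<pi> \<notin> BR \<pi> \<longleftrightarrow> (\<forall>k<?d \<pi>. \<forall>j<?d \<pi>. \<forall>i \<in> {1..M}.
          good i (phi_fun G \<pi> (v \<pi> k) (\<omega> \<pi> *\<^sub>v e \<pi> j)))"
        if "\<pi> \<in> R" "real_rep G \<pi>" for \<pi>
        using sp[OF \<omega>, of \<pi>] that unfolding BR_def random_index_def by blast
      have "(\<forall>\<pi>\<in>?I. \<omega> \<pi> \<notin> B \<pi>) \<longleftrightarrow> (\<forall>\<pi>\<in>C. \<omega> \<pi> \<notin> BC \<pi>)
          \<and> (\<forall>\<pi>\<in>R. real_rep G \<pi> \<longrightarrow> \<omega> \<pi> \<notin> BR \<pi>) \<and> (\<forall>\<pi>\<in>R. quaternionic_rep G \<pi> \<longrightarrow> \<omega> \<pi> \<notin> BQ \<pi>)"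
        using CR by (auto simp: B_def random_index_def)
      then show ?thesis
        unfolding ball_random_eigenbasis by (simp only: C Q Re cong: imp_cong ball_cong)
    qed
    moreover have "(\<forall>\<pi>\<in>?I. \<omega> \<pi> \<notin> B \<pi>) \<longleftrightarrow> (\<forall>\<pi>\<in>N \<inter> ?I. \<omega> \<pi> \<notin> B \<pi>)" for \<omega>
      using B_triv IR by (auto simp: N_def)
    ultimately show ?thesis
      unfolding good_def well_distributed_def by auto
  qed
  have finN: "finite N" using finR by (simp add: N_def)
  \<comment> \<open>The event constrains one coordinate, so the product measure gives it the mass
    assigned by the marginal \<open>H \<pi>\<close>.\<close>
  have comp: "{\<omega> \<in> space ?P. \<omega> \<pi> \<in> B \<pi>} \<in> sets ?P \<and> measure ?P {\<omega> \<in> space ?P. \<omega> \<pi> \<in> B \<pi>} = measure (H \<pi>) (B \<pi>)"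
    if \<pi>: "\<pi> \<in> ?I" for \<pi>
  proof -
    have m: "(\<lambda>\<omega>. \<omega> \<pi>) \<in> measurable ?P (H \<pi>)" by (rule measurable_component_singleton[OF \<pi>])
    have eq: "{\<omega> \<in> space ?P. \<omega> \<pi> \<in> B \<pi>} = (\<lambda>\<omega>. \<omega> \<pi>) -` B \<pi> \<inter> space ?P" by auto
    have "measure (H \<pi>) (B \<pi>) = measure (distr ?P (H \<pi>) (\<lambda>\<omega>. \<omega> \<pi>)) (B \<pi>)"
      using distr_PiM_component[of ?I H \<pi>, OF prob_H \<pi>] by simp
    also have "\<dots> = measure ?P ((\<lambda>\<omega>. \<omega> \<pi>) -` B \<pi> \<inter> space ?P)"
      by (rule measure_distr[OF m B_sets[OF \<pi>]])
    finally show ?thesis unfolding eq using measurable_sets[OF m B_sets[OF \<pi>]] by simp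
  qed
  have bad_sets: "?bad \<in> sets ?P" using comp finN by (intro sets.finite_UN) auto
  have "measure ?P ?bad \<le> (\<Sum>\<pi>\<in>N \<inter> ?I. measure ?P {\<omega> \<in> space ?P. \<omega> \<pi> \<in> B \<pi>})"
    using comp finN by (intro PP.finite_measure_subadditive_finite) auto
  also have "\<dots> \<le> (\<Sum>\<pi>\<in>N \<inter> ?I. 12 * ?q \<pi>)"
    using comp B_measure by (intro sum_mono) auto
  \<comment> \<open>\<open>N\<close> also contains the members of dual pairs that were not chosen
    for \<open>C\<close>; their nonnegative terms only enlarge the sum.\<close>
  also have "\<dots> \<le> (\<Sum>\<pi>\<in>N. 12 * ?q \<pi>)"
    using finN by (intro sum_mono2) auto
  also have "\<dots> \<le> (\<Sum>\<pi>\<in>N. 2 * real M * ((real (?d \<pi>))\<^sup>2 *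
          (6 * exp (- (t * sqrt (real (?d \<pi>)) / 64)) + 2 * exp (- (real (?d \<pi>) / 12)))))"
  proof (rule sum_mono)
    fix \<pi>
    have "exp (- (t * sqrt (real (?d \<pi>)) / 12)) \<le> exp (- (t * sqrt (real (?d \<pi>)) / 64))"
      using \<open>t > 0\<close> by (simp add: mult_nonneg_nonneg field_simps)
    then have "6 * exp (- (t * sqrt (real (?d \<pi>)) / 12))
      \<le> 6 * exp (- (t * sqrt (real (?d \<pi>)) / 64)) + 2 * exp (- (real (?d \<pi>) / 12))"
      using exp_ge_zero[of "- (real (?d \<pi>) / 12)"] by linarith
    then have "2 * real M * ((real (?d \<pi>))\<^sup>2 * (6 * exp (- (t * sqrt (real (?d \<pi>)) / 12))))
      \<le> 2 * real M * ((real (?d \<pi>))\<^sup>2 *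
          (6 * exp (- (t * sqrt (real (?d \<pi>)) / 64)) + 2 * exp (- (real (?d \<pi>) / 12))))"
      by (intro mult_left_mono) auto
    then show "12 * ?q \<pi> \<le> 2 * real M * ((real (?d \<pi>))\<^sup>2 *
          (6 * exp (- (t * sqrt (real (?d \<pi>)) / 64)) + 2 * exp (- (real (?d \<pi>) / 12))))"
      by (simp add: mult_ac)
  qed
  finally have "measure ?P ?bad \<le> 2 * real M * (\<Sum>\<pi>\<in>N. (real (?d \<pi>))\<^sup>2 *
          (6 * exp (- (t * sqrt (real (?d \<pi>)) / 64)) + 2 * exp (- (real (?d \<pi>) / 12))))"
    by (simp only: sum_distrib_left)
  then show ?thesis
    unfolding good_eq N_def[symmetric] using PP.prob_compl[OF bad_sets] by linarith
qed

end
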